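(* Let $\lambda$ be a Borel probability measure on $\mathcal X$ that is absolutely continuous with respect to $\mu$, let $\mathcal A_1,\dots,\mathcal A_r$ be Borel subsets of $\mathbb R^k$, and let $N=(N_1,\dots,N_r)\in\mathbb Z_{\ge0}^r$. Then $$\lim_{L\to\infty}\lambda\big(\{x\in\mathcal X:\ \#\{j:L^{-n/k}\xi_j(x,L)\in\mathcal A_i\}=N_i\ \forall i\}\big)=\Psi^{(r)}_N(\mathcal A),$$ where $$\Psi^{(r)}_N(\mathcal A)=\mu\big(\{x\in\mathcal X:\#\{j:\xi_j(x,1)\in\mathcal A_i\}=N_i\ \forall i\}\big)=\mu\big(\{\Gamma g\in\mathcal X:\#(\widehat{\mathbb Z}^ng\cap\mathcal C(\mathcal A_i,\mathcal W))=N_i\ \forall i\}\big).$$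
   Context: Fix integers $k\ge1$, $m\ge0$ and set $n=k+m+1$. Let $G=\mathrm{SL}(n,\mathbb R)$, $\Gamma=\mathrm{SL}(n,\mathbb Z)$, $\mathcal X=\Gamma\backslash G$, and let $\mu$ be the unique right-$G$-invariant Borel probability measure on $\mathcal X$. Vectors in $\mathbb R^n$ are row vectors, written $y=(y',y'',y_n)$ with $y'\in\mathbb R^k$, $y''\in\mathbb R^m$, $y_n\in\mathbb R$; $G$ acts on $\mathbb R^n$ from the right. $\widehat{\mathbb Z}^n$ is the set of primitive integer vectors (coordinates with gcd 1); for $x=\Gamma g$ the set $\widehat{\mathbb Z}^ng$ does not depend on the representative $g$. For $s\in\mathbb R^k$ let $U(s)=\begin{pmatrix}1_k&0&0\\0&1_m&0\\-s&0&1\end{pmatrix}$ (middle block absent if $m=0$), so $yU(s)=(y'-y_ns,y'',y_n)$, and $h_s(x)=xU(s)$. Fix a norm $|\cdot|$ on $\mathbb R^k$. Let $\mathcal W\subset\mathbb R^m\times\mathbb R_{>0}$ be a bounded Borel set with non-empty interior and boundary of Lebesgue measure zero. For $\mathcal A\subset\mathbb R^k$ and $\widetilde{\mathcal W}\subset\mathbb R^m\times\mathbb R_{>0}$ put $\mathcal C(\mathcal A,\widetilde{\mathcal W})=\{y\in\mathbb R^n: y'\in y_n\mathcal A,\ (y'',y_n)\in\widetilde{\mathcal W}\}$. Hitting times: for $x=\Gamma g$ and $L>0$, $\xi_1(x,L),\xi_2(x,L),\dots\in\mathbb R^k$ is the list (with multiplicity, possibly finite or empty) of the multiset $\{v'/v_n: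 v=(v',v'',v_n)\in\widehat{\mathbb Z}^ng,\ (v'',v_n)\in L^{-1}\mathcal W\}$, ordered so that $|\xi_1|\le|\xi_2|\le\cdots$ (ties in arbitrary order); thus $\#\{j:\xi_j(x,L)\in\mathcal A\}=\#(\widehat{\mathbb Z}^ng\cap\mathcal C(\mathcal A,L^{-1}\mathcal W))$. These are exactly the times $s$ at which $h_s(x)$ lies in the section $\mathcal H(\mathcal W,L)=\Gamma\backslash\Gamma H\{R(w):w\in L^{-1}\mathcal W\}$ (with $H$ the stabilizer of $(0,\dots,0,1)$ in $G$ and $R(w)=\begin{pmatrix}w_{m+1}^{-(m+1)/k}1_k&0&0\\0&w_{m+1}1_m&0\\0&w'&w_{m+1}\end{pmatrix}$ for $w=(w',w_{m+1})$), counted with the multiplicity of self-intersection. *)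

theory Defs
  imports "HOL-Analysis.Analysis" "HOL-Probability.Probability"
begin

text \<open>Coordinates of R^n are indexed by the type 'k + 'j: the block Inl (CARD('k) = k
 coordinates) is y', the block Inr (CARD('j) = m+1 coordinates) carries (y'', y_n),
 where a distinguished index j0 :: 'j is the last coordinate y_n.\<close>

definition SLn :: "(real^'n^'n) set" where
  "SLn = {g. det g = 1}"

definition SLZ :: "(real^'n^'n) set" where
  "SLZ = {g. det g = 1 \<and> (\<forall>i j. g $ i $ j \<in> \<int>)}"

definition coset :: "real^'n^'n \<Rightarrow> (real^'n^'n) set" where
  "coset g = (\<lambda>\<gamma>. \<gamma> ** g) ` SLZ"

definition Xspace :: "(real^'n^'n) set set" where
  "Xspace = coset ` SLn"

text \<open>Quotient Borel structure: a set of cosets is measurable iff its preimage in G is Borel.\<close>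
definition Xmeas :: "(real^'n^'n) set measure" where
  "Xmeas = measure_of Xspace {S. S \<subseteq> Xspace \<and> \<Union>S \<in> sets borel} (\<lambda>_. 0)"

definition xact :: "(real^'n^'n) set \<Rightarrow> real^'n^'n \<Rightarrow> (real^'n^'n) set" where
  "xact x h = (\<lambda>g. g ** h) ` x"

definition muX :: "(real^'n^'n) set measure" where
  "muX = (THE M. sets M = sets Xmeas \<and> prob_space M \<and>
      (\<forall>h\<in>SLn. \<forall>S\<in>sets M. emeasure M ((\<lambda>x. xact x h) ` S) = emeasure M S))"

definition primitive :: "real^'n \<Rightarrow> bool" where
  "primitive v \<longleftrightarrow> (\<forall>i. v $ i \<in> \<int>) \<and> Gcd (range (\<lambda>i. \<lfloor>v $ i\<rfloor>)) = (1::int)"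

text \<open>The set of primitive vectors of the lattice x = Gamma g, i.e. hat-Z^n g
 (independent of the representative g).\<close>
definition primvecs :: "(real^'n^'n) set \<Rightarrow> (real^'n) set" where
  "primvecs x = (\<Union>g\<in>x. {v v* g | v. primitive v})"

definition ypart1 :: "real^('k::finite+'j::finite) \<Rightarrow> real^'k" where
  "ypart1 y = (\<chi> i. y $ Inl i)"

definition ypart2 :: "real^('k::finite+'j::finite) \<Rightarrow> real^'j" where
  "ypart2 y = (\<chi> j. y $ Inr j)"

text \<open>Primitive vectors v of x with (v'',v_n) in L^{-1} W whose hitting time
 xi = v'/v_n satisfies L^{-n/k} xi in A; its cardinality is
 #{j : L^{-n/k} xi_j(x,L) in A} (counted with multiplicity).\<close>
definition hits :: "'j::finite \<Rightarrow> (real^'j) set \<Rightarrow> (real^('k+'j)^('k+'j)) set \<Rightarrow> real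
     \<Rightarrow> (real^'k) set \<Rightarrow> (real^('k+'j)) set" where
  "hits j0 W x L A = {v \<in> primvecs x. ypart2 v \<in> (\<lambda>w. (1 / L) *\<^sub>R w) ` W \<and>
      (L powr (- (real CARD('k+'j) / real CARD('k)))) *\<^sub>R ((1 / v $ Inr j0) *\<^sub>R ypart1 v) \<in> A}"

definition coneC :: "'j::finite \<Rightarrow> (real^'k::finite) set \<Rightarrow> (real^'j) set \<Rightarrow> (real^('k+'j)) set" where
  "coneC j0 A W = {y. ypart1 y \<in> (\<lambda>a. (y $ Inr j0) *\<^sub>R a) ` A \<and> ypart2 y \<in> W}"

end

theory Submission
  imports Defs
begin

text \<open>With the diagonal matrix \<open>a\<^sub>L\<close> that multiplies the block \<open>y'\<close> by \<open>L\<close> to the power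
  \<open>-(m+1)/k\<close> and \<open>(y'', y\<^sub>n)\<close> by \<open>L\<close>, the rescaled hitting times of \<open>x\<close> at level \<open>L\<close> are the hitting
  times of \<open>x a\<^sub>L\<close> at level 1. The limit theorem is therefore the statement that the flow \<open>a\<^sub>L\<close> is
  mixing for the invariant probability measure.

  The measure itself is Lebesgue measure on the matrices with determinant in \<open>[1, 2]\<close>, restricted to
  a fundamental domain of \<open>SL(n, \<int>)\<close>. Its total mass is finite because the number of orbits of
  integer matrices with determinant at most \<open>D\<close> is \<open>O(D\<^sup>n)\<close>, by counting Hermite normal forms, while
  this number dominates a Riemann sum for the volume of the fundamental domain.

  For mixing, a cluster point of the measures \<open>S \<mapsto> \<mu>(B \<inter> S a\<^sub>L\<^sup>-\<^sup>1)\<close> is absolutely continuous and invariant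
  under the horospherical unipotent elements contracted by the flow. The level sets of its density
  are then invariant under the whole group by the Mautner phenomenon, so the density is constant by
  Fubini. Mixing also shows that no other invariant probability measure exists.\<close>

section \<open>Row operations and invariance of Lebesgue measure\<close>

text \<open>\<open>muX\<close> is a definite description, so nothing is known of it before an
  invariant probability measure is shown to exist and to be the only one. All work is done with the
  explicit \<open>haarX\<close>, and the two are identified after mixing. Lebesgue measure on
  matrices can replace Haar measure because determinant-one matrices preserve it from both sides:
  left invariance serves to fold along SL(n, Z), right invariance to translate.

  Two obstacles shape the limiting argument. The quotient is not compact and the sets are arbitrary
  Borel sets, so weak limits could lose mass and would not see boundaries. Cluster points are taken
  setwise instead, in a product of unit intervals indexed by all sets; total mass then survives, and
  domination by the invariant measure restores countable additivity. Moreover, the unipotent block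
  alone does not generate the group. The measure of what S loses under translation by h is, as a
  function of h, subadditive and continuous at the identity, and this forces it to vanish everywhere
  once it vanishes on the block.\<close>

definition transv :: "'n \<Rightarrow> 'n \<Rightarrow> real \<Rightarrow> real^'n^'n" where
  "transv m n c = (\<chi> i j. (if i = j then 1 else 0) + (if i = m \<and> j = n then c else 0))"

lemma transv_mult_nth:
  "(transv m n c ** A) $ i $ j = A $ i $ j + (if i = m then c * A $ n $ j else 0)"
proof -
  have "(transv m n c ** A) $ i $ j =
      (\<Sum>k\<in>UNIV. (if k = i then A $ k $ j else 0) + (if k = n then (if i = m then c * A $ k $ j else 0) else 0))"
    unfolding matrix_matrix_mult_def transv_def
    by (auto intro!: sum.cong simp: distrib_right)
  also have "\<dots> = A $ i $ j + (if i = m then c * A $ n $ j else 0)"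
    by (simp add: sum.distrib)
  finally show ?thesis .
qed

lemma det_transv_mult:
  assumes "m \<noteq> n"
  shows "det (transv m n c ** A) = det A"
proof -
  have "transv m n c ** A = (\<chi> k. if k = m then row m A + c *s row n A else row k A)"
    by (auto simp: vec_eq_iff transv_mult_nth row_def)
  then show ?thesis using det_row_operation[OF assms, of A c] by simp
qed

lemma det_transv: "m \<noteq> n \<Longrightarrow> det (transv m n c) = 1"
  using det_transv_mult[of m n c "mat 1"] by simp

lemma transv_add: "m \<noteq> n \<Longrightarrow> transv m n c ** transv m n d = transv m n (c + d)"
  by (auto simp: vec_eq_iff transv_mult_nth) (auto simp: transv_def)

lemma transv_0 [simp]: "transv m n 0 = mat 1"
  by (auto simp: vec_eq_iff transv_def mat_def)

text \<open>The columns in \<open>K\<close> are standard basis vectors. If column \<open>c\<close>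
  were supported on the rows in \<open>K\<close>, it would be a combination of them and
  \<open>A\<close> would have a kernel vector.\<close>

lemma pivot_exists:
  fixes A :: "real^'n^'n"
  assumes det: "det A = 1" and c: "c \<notin> K"
    and K: "\<And>i j. j \<in> K \<Longrightarrow> A $ i $ j = (if i = j then 1 else 0)"
  shows "\<exists>r. r \<notin> K \<and> A $ r $ c \<noteq> 0"
proof (rule ccontr)
  assume "\<nexists>r. r \<notin> K \<and> A $ r $ c \<noteq> 0"
  then have z: "A $ r $ c = 0" if "r \<notin> K" for r using that by blast
  define x :: "real^'n" where "x = (\<chi> i. if i = c then 1 else if i \<in> K then - A $ i $ c else 0)"
  have "A *v x = 0"
  proof (clarsimp simp: vec_eq_iff matrix_vector_mult_def)
    fix i
    have "(\<Sum>j\<in>UNIV. A $ i $ j * x $ j) =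
       (\<Sum>j\<in>UNIV. (if j = c then A $ i $ c else 0) + (if j = i then (if i \<in> K then - A $ i $ c else 0) else 0))"
      using c by (intro sum.cong) (auto simp: x_def K)
    also have "\<dots> = 0" by (simp add: sum.distrib z)
    finally show "(\<Sum>j\<in>UNIV. A $ i $ j * x $ j) = 0" .
  qed
  moreover have "x $ c = 1" by (simp add: x_def)
  moreover have "inj ((*v) A)" using det by (simp flip: det_nz_iff_inj)
  ultimately have "x = 0" by (metis injD matrix_vector_mult_0_right)
  with \<open>x $ c = 1\<close> show False by simp
qed

text \<open>Gaussian elimination without row swaps or scalings: the induction is on the set of columns
  that do not yet agree with the identity matrix.\<close>

lemma SL_induct:
  fixes A :: "real^'n^'n"
  assumes det: "det A = 1"
    and one: "P (mat 1)"
    and step: "\<And>A m n c. det A = 1 \<Longrightarrow> m \<noteq> n \<Longrightarrow> P A \<Longrightarrow> P (transv m n c ** A)"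
  shows "P A"
proof -
  \<comment> \<open>The inverse of a row operation is again one, so \<open>P\<close> may be proved
    for the reduced matrix and carried back.\<close>
  have undo: "P A" if "det A = 1" "m \<noteq> n" "P (transv m n c ** A)" for A :: "real^'n^'n" and m n c
  proof -
    have "P (transv m n (-c) ** (transv m n c ** A))"
      by (rule step) (use that in \<open>auto simp: det_transv_mult\<close>)
    then show ?thesis
      by (simp add: matrix_mul_assoc transv_add that)
  qed
  \<comment> \<open>\<open>R\<close> lists the rows still to be cleared against the pivot
    \<open>a\<close> in row \<open>c\<close>. Row \<open>c\<close> vanishes in the columns of
    \<open>K\<close>, so these stay intact.\<close>
  have clear: "P A"
    if "\<And>B. det B = 1 \<Longrightarrow> (\<And>i j. j \<in> K \<Longrightarrow> B $ i $ j = (if i = j then 1 else 0)) \<Longrightarrow>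
          (\<And>i. B $ i $ c = (if i = c then a else 0)) \<Longrightarrow> P B"
      "finite R" "det A = 1" "c \<notin> K" "A $ c $ c = a" "a \<noteq> 0"
      "\<And>i j. j \<in> K \<Longrightarrow> A $ i $ j = (if i = j then 1 else 0)"
      "R = {i. i \<noteq> c \<and> A $ i $ c \<noteq> 0}" for A c K R a
    using that(2-)
  proof (induction R arbitrary: A rule: finite_induct)
    case empty
    show ?case
      by (rule that(1)) (use empty in auto)
  next
    case (insert r R)
    have r: "r \<noteq> c" using insert.prems by auto
    show ?case
    proof (rule undo[of A r c "- A $ r $ c / a"])
      show "P (transv r c (- A $ r $ c / a) ** A)"
      proof (rule insert.IH)
        show "R = {i. i \<noteq> c \<and> (transv r c (- A $ r $ c / a) ** A) $ i $ c \<noteq> 0}"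
          using insert.hyps insert.prems by (auto simp: transv_mult_nth)
      qed (use insert.prems r in \<open>auto simp: transv_mult_nth det_transv_mult\<close>)
    qed (use insert.prems r in auto)
  qed
  have "P A" if "finite R" "det A = 1" "R = - K"
    "\<And>i j. j \<in> K \<Longrightarrow> A $ i $ j = (if i = j then 1 else 0)" for A :: "real^'n^'n" and K R
    using that
  proof (induction R arbitrary: A K rule: finite_induct)
    case empty
    then have "K = UNIV" by auto
    with empty have "A = mat 1" by (auto simp: vec_eq_iff mat_def)
    with one show ?case by simp
  next
    case (insert c R)
    have c: "c \<notin> K" using insert.prems by auto
    have fin: "P B" if "det B = 1" "B $ c $ c = 1"
      "\<And>i j. j \<in> K \<Longrightarrow> B $ i $ j = (if i = j then 1 else 0)" for B
    proof (rule clear[of K c 1 "{i. i \<noteq> c \<and> B $ i $ c \<noteq> 0}"])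
      fix B :: "real^'n^'n"
      assume B: "det B = 1" "\<And>i j. j \<in> K \<Longrightarrow> B $ i $ j = (if i = j then 1 else 0)"
        "\<And>i. B $ i $ c = (if i = c then 1 else 0)"
      show "P B"
        by (rule insert.IH[of B "insert c K"]) (use B insert.prems insert.hyps in auto)
    qed (use c that in auto)
    \<comment> \<open>A second row \<open>r\<close> outside \<open>K\<close> with a nonzero entry in
      column \<open>c\<close> allows the pivot to be made 1.\<close>
    have fin2: "P B" if B: "det B = 1" "r \<notin> K" "r \<noteq> c" "B $ r $ c \<noteq> 0"
      "\<And>i j. j \<in> K \<Longrightarrow> B $ i $ j = (if i = j then 1 else 0)" for B r
      by (rule undo[of B c r "(1 - B $ c $ c) / B $ r $ c"])
        (use B in \<open>auto simp: transv_mult_nth det_transv_mult intro!: fin\<close>)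
    obtain r where r: "r \<notin> K" "A $ r $ c \<noteq> 0"
      using pivot_exists[OF insert.prems(1) c insert.prems(3)] by blast
    show ?case
    proof (cases "r = c")
      case False
      then show ?thesis using fin2 r insert.prems by blast
    next
      case rc: True
      show ?thesis
      proof (cases "R = {}")
        \<comment> \<open>Column \<open>c\<close> is the last one and no other row can correct its
          pivot; but the cleared matrix is diagonal and its determinant 1 equals the pivot.\<close>
        case True
        then have K: "j \<in> K" if "j \<noteq> c" for j using insert.prems that by auto
        show ?thesis
        proof (rule clear[of K c "A $ c $ c" "{i. i \<noteq> c \<and> A $ i $ c \<noteq> 0}"])
          fix B :: "real^'n^'n"
          assume B: "det B = 1" "\<And>i j. j \<in> K \<Longrightarrow> B $ i $ j = (if i = j then 1 else 0)"
            "\<And>i. B $ i $ c = (if i = c then A $ c $ c else 0)"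
          have diag: "B $ i $ j = (if i = j then if i = c then A $ c $ c else 1 else 0)" for i j
            using B(2)[of j i] B(3)[of i] K[of j] by (cases "j = c") auto
          then have "det B = (\<Prod>i\<in>UNIV. if i = c then A $ c $ c else 1)"
            by (subst det_diagonal) auto
          also have "\<dots> = A $ c $ c" by simp
          finally have "B = mat 1" using B(1) diag by (auto simp: vec_eq_iff mat_def)
          then show "P B" using one by simp
        qed (use c r rc insert.prems in auto)
      next
        case False
        then obtain q where q: "q \<in> R" by auto
        then have "q \<noteq> c" "q \<notin> K" using insert.hyps insert.prems by auto
        show ?thesis
        proof (cases "A $ q $ c = 0")
          case False
          then show ?thesis using fin2 \<open>q \<noteq> c\<close> \<open>q \<notin> K\<close> insert.prems by blast
        next
          \<comment> \<open>Adding row \<open>c\<close> to row \<open>q\<close> gives row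
            \<open>q\<close> a nonzero entry in column \<open>c\<close>, which can then be used to
            set the pivot to 1.\<close>
          case True
          show ?thesis
            by (rule undo[of A q c 1], use insert.prems \<open>q \<noteq> c\<close> in simp_all, rule fin2[of _ q])
              (use insert.prems \<open>q \<noteq> c\<close> \<open>q \<notin> K\<close> True r rc c in \<open>auto simp: transv_mult_nth det_transv_mult\<close>)
        qed
      qed
    qed
  qed
  from this[OF finite det refl, of "{}"] show ?thesis by simp
qed

section \<open>Lebesgue measure under linear maps of determinant one\<close>

text \<open>Uniqueness of Haar measure on a Euclidean space: the two sides evaluate, in the two
  orders, the double integral of the indicator of \<open>B\<close> at x times the indicator of
  \<open>Q\<close> at x + y.\<close>

lemma translation_invariant_eq_lborel:
  fixes M :: "'a::euclidean_space measure"
  assumes sets_M [measurable_cong]: "sets M = sets borel" and "sigma_finite_measure M"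
    and inv: "\<And>t. distr M borel (\<lambda>x. x + t) = M"
    and [measurable]: "B \<in> sets borel" "Q \<in> sets borel"
  shows "emeasure M B * emeasure lborel Q = emeasure M Q * emeasure lborel B"
proof -
  interpret M: sigma_finite_measure M by fact
  interpret pair_sigma_finite M lborel ..
  have refl: "distr lborel borel (\<lambda>y. x - y) = lborel" for x :: 'a
    using lborel_affine[of "-1" x] by (simp add: density_1)
  have reflB: "(\<integral>\<^sup>+y. indicator B (x - y) \<partial>lborel) = emeasure lborel B" for x
    using nn_integral_distr[of "\<lambda>y. x - y" lborel borel "indicator B"] by (simp add: refl)
  have transQ: "(\<integral>\<^sup>+y. indicator Q (x + y) \<partial>lborel) = emeasure lborel Q" for x
    using nn_integral_distr[of "\<lambda>y. x + y" lborel borel "indicator Q"]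
    by (simp add: lborel_distr_plus)
  have "emeasure M B * emeasure lborel Q =
      (\<integral>\<^sup>+x. indicator B x * emeasure lborel Q \<partial>M)"
    by (simp add: nn_integral_multc)
  also have "\<dots> = (\<integral>\<^sup>+x. (\<integral>\<^sup>+y. indicator B x * indicator Q (x + y) \<partial>lborel) \<partial>M)"
    by (simp add: nn_integral_cmult transQ)
  also have "\<dots> = (\<integral>\<^sup>+y. (\<integral>\<^sup>+x. indicator B x * indicator Q (x + y) \<partial>M) \<partial>lborel)"
    by (intro Fubini'[symmetric]) measurable
  also have "\<dots> = (\<integral>\<^sup>+y. (\<integral>\<^sup>+x. indicator B (x - y) * indicator Q x \<partial>M) \<partial>lborel)"
  proof (rule nn_integral_cong)
    fix y
    have "(\<integral>\<^sup>+x. indicator B (x - y) * indicator Q x \<partial>M) =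
      (\<integral>\<^sup>+x. indicator B (x - y) * indicator Q x \<partial>distr M borel (\<lambda>x. x + y))"
      by (simp add: inv)
    also have "\<dots> = (\<integral>\<^sup>+x. indicator B x * indicator Q (x + y) \<partial>M)"
      by (subst nn_integral_distr) auto
    finally show "(\<integral>\<^sup>+x. indicator B x * indicator Q (x + y) \<partial>M) =
      (\<integral>\<^sup>+x. indicator B (x - y) * indicator Q x \<partial>M)" ..
  qed
  also have "\<dots> = (\<integral>\<^sup>+x. (\<integral>\<^sup>+y. indicator B (x - y) * indicator Q x \<partial>lborel) \<partial>M)"
    by (intro Fubini') measurable
  also have "\<dots> = (\<integral>\<^sup>+x. emeasure lborel B * indicator Q x \<partial>M)"
    by (simp add: nn_integral_multc reflB)
  also have "\<dots> = emeasure M Q * emeasure lborel B"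
    by (simp add: nn_integral_cmult mult.commute[of _ "emeasure lborel B"])
  finally show ?thesis .
qed

text \<open>The pushforward is translation invariant, hence a multiple of Lebesgue measure, and
  applying the map twice shows that the factor squares to 1.\<close>

lemma lborel_linear_involution:
  fixes T :: "'a::euclidean_space \<Rightarrow> 'a"
  assumes lin: "linear T" and invol: "\<And>x. T (T x) = x"
  shows "distr lborel borel T = lborel"
proof -
  have [measurable]: "T \<in> borel_measurable borel"
    using lin by (intro borel_measurable_continuous_onI linear_continuous_on)
      (simp add: linear_conv_bounded_linear)
  define M where "M = distr lborel borel T"
  have M: "emeasure M B = emeasure lborel (T -` B)" if "B \<in> sets borel" for B
    using that by (simp add: M_def emeasure_distr)
  have [measurable]: "T -` B \<in> sets borel" if "B \<in> sets borel" for B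
    using measurable_sets[OF \<open>T \<in> _\<close> that] by simp
  have TT: "T -` T -` B = B" for B by (auto simp: invol)
  have inv: "distr M borel (\<lambda>x. x + t) = M" for t
  proof -
    have "distr M borel (\<lambda>x. x + t) = distr lborel borel (\<lambda>x. T x + t)"
      by (simp add: M_def distr_distr comp_def)
    also have "(\<lambda>x. T x + t) = (\<lambda>x. T (T t + x))"
      by (simp add: linear_add[OF lin] invol add.commute)
    also have "distr lborel borel (\<lambda>x. T (T t + x)) = distr (distr lborel borel ((+) (T t))) borel T"
      by (simp add: distr_distr comp_def)
    finally show ?thesis by (simp add: lborel_distr_plus M_def)
  qed
  have fin: "sigma_finite_measure M"
  proof
    show "\<exists>A. countable A \<and> A \<subseteq> sets M \<and> \<Union>A = space M \<and> (\<forall>a\<in>A. emeasure M a \<noteq> \<infinity>)"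
    proof (intro exI[of _ "range (\<lambda>n. T -` ball 0 (real n))"] conjI ballI)
      show "\<Union> (range (\<lambda>n. T -` ball 0 (real n))) = space M"
        by (auto simp: M_def) (meson reals_Archimedean2)
      fix a assume "a \<in> range (\<lambda>n. T -` ball 0 (real n))"
      then obtain n where "a = T -` ball 0 (real n)" by auto
      then show "emeasure M a \<noteq> \<infinity>"
        using emeasure_lborel_ball_finite[of "0::'a" "real n"] by (simp add: M TT)
    qed (auto simp: M_def)
  qed
  define Q where "Q = box (0::'a) One"
  have Q: "Q \<in> sets borel" "emeasure lborel Q = 1" by (auto simp: Q_def)
  have eq: "emeasure M B = emeasure M Q * emeasure lborel B" if "B \<in> sets borel" for B
    using translation_invariant_eq_lborel[of M B Q] fin inv that Q by (simp add: M_def)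
  have "1 = emeasure M Q * emeasure M Q"
    using eq[of "T -` Q"] Q by (simp add: M TT)
  moreover have "x = 1" if "1 = x * x" for x :: ennreal
  proof (cases x)
    case (real r)
    then have "r * r = 1" using that by (simp flip: ennreal_mult)
    then show ?thesis using real by (simp add: square_eq_1_iff)
  qed (use that in \<open>simp add: ennreal_top_mult\<close>)
  ultimately have "emeasure M Q = 1" by blast
  with eq show ?thesis
    by (intro measure_eqI) (auto simp: M_def)
qed

lemma lborel_comp:
  fixes f g :: "'a::euclidean_space \<Rightarrow> 'a"
  assumes "distr lborel borel f = lborel" "distr lborel borel g = lborel"
    and [measurable]: "f \<in> borel_measurable borel" "g \<in> borel_measurable borel"
  shows "distr lborel borel (\<lambda>x. f (g x)) = lborel"
proof -
  have "distr lborel borel (\<lambda>x. f (g x)) = distr (distr lborel borel g) borel f"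
    by (simp add: distr_distr comp_def)
  with assms show ?thesis by simp
qed

lemma continuous_on_matrix_mult [continuous_intros]:
  fixes f :: "'a::topological_space \<Rightarrow> real^'m^'n" and g :: "'a \<Rightarrow> real^'p^'m"
  assumes "continuous_on S f" "continuous_on S g"
  shows "continuous_on S (\<lambda>x. f x ** g x)"
  unfolding matrix_matrix_mult_def
  by (intro continuous_intros assms)

lemma continuous_on_det [continuous_intros]:
  fixes f :: "'a::topological_space \<Rightarrow> real^'n^'n"
  assumes "continuous_on S f"
  shows "continuous_on S (\<lambda>x. det (f x))"
  unfolding det_def by (intro continuous_intros assms)

lemma borel_measurable_matrix_mult [measurable]:
  fixes f :: "'a \<Rightarrow> real^'m^'n" and g :: "'a \<Rightarrow> real^'p^'m"
  assumes [measurable]: "f \<in> borel_measurable M" "g \<in> borel_measurable M"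
  shows "(\<lambda>x. f x ** g x) \<in> borel_measurable M"
proof (rule borel_measurable_continuous_Pair[OF assms])
  show "continuous_on UNIV (\<lambda>x. fst x ** snd x :: real^'p^'n)" 
    by (intro continuous_intros)
qed

lemma borel_measurable_det [measurable]:
  fixes f :: "'a \<Rightarrow> real^'n^'n"
  assumes [measurable]: "f \<in> borel_measurable M"
  shows "(\<lambda>x. det (f x)) \<in> borel_measurable M"
  by (rule borel_measurable_continuous_on[OF continuous_on_det assms]) (rule continuous_on_id)

text \<open>A shear is a product of two linear involutions: \<open>D\<close> changes the sign of row
  \<open>m\<close>, and \<open>D\<close> after the shear is an involution too.\<close>

lemma lborel_transv_left:
  fixes c :: real
  assumes mn: "m \<noteq> n"
  shows "distr lborel borel (\<lambda>B :: real^'n^'n. transv m n c ** B) = lborel"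
proof -
  define D where "D = (\<lambda>B :: real^'n^'n. \<chi> i j. if i = m then - B $ i $ j else B $ i $ j)"
  have 1: "linear D" "linear (\<lambda>B. D (transv m n c ** B))"
    by (auto intro!: linearI simp: vec_eq_iff D_def matrix_add_ldistrib transv_mult_nth algebra_simps)
  then have [measurable]: "D \<in> borel_measurable borel" "(\<lambda>B. D (transv m n c ** B)) \<in> borel_measurable borel"
    by (auto intro!: borel_measurable_continuous_onI linear_continuous_on simp: linear_conv_bounded_linear)
  have 2: "D (D B) = B" "D (transv m n c ** D (transv m n c ** B)) = B" for B
    using mn by (auto simp: vec_eq_iff D_def transv_mult_nth)
  have "distr lborel borel (\<lambda>B. D (D (transv m n c ** B))) = lborel"
    by (rule lborel_comp[of D "\<lambda>B. D (transv m n c ** B)"])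
      (auto intro!: lborel_linear_involution 1 simp: 2)
  then show ?thesis by (simp add: 2)
qed

lemma lborel_SL_left:
  fixes A :: "real^'n^'n"
  assumes "det A = 1"
  shows "distr lborel borel (\<lambda>B :: real^'n^'n. A ** B) = lborel"
proof (rule SL_induct[OF assms], goal_cases)
  case 1
  show ?case by (simp add: distr_id2)
next
  case (2 A m n c)
  have "distr lborel borel (\<lambda>B :: real^'n^'n. transv m n c ** (A ** B)) = lborel"
    using 2 by (intro lborel_comp[of "\<lambda>B. transv m n c ** B" "\<lambda>B. A ** B"] lborel_transv_left) auto
  then show ?case by (simp add: matrix_mul_assoc)
qed

lemma lborel_transpose: "distr lborel borel (transpose :: real^'n^'n \<Rightarrow> _) = lborel"
  by (rule lborel_linear_involution) (auto intro!: linearI simp: transpose_def vec_eq_iff)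

lemma lborel_SL_right:
  fixes A :: "real^'n^'n"
  assumes "det A = 1"
  shows "distr lborel borel (\<lambda>B :: real^'n^'n. B ** A) = lborel"
proof -
  have [measurable]: "(transpose :: real^'n^'n \<Rightarrow> _) \<in> borel_measurable borel"
    by (intro borel_measurable_continuous_onI) (simp add: transpose_def continuous_intros)
  have "distr lborel borel (\<lambda>B :: real^'n^'n. transpose A ** transpose B) = lborel"
    using assms
    by (intro lborel_comp[of "\<lambda>B. transpose A ** B" transpose] lborel_SL_left lborel_transpose) simp_all
  then have "distr lborel borel (\<lambda>B :: real^'n^'n. transpose (transpose A ** transpose B)) = lborel"
    by (intro lborel_comp[of transpose "\<lambda>B. transpose A ** transpose B"] lborel_transpose) simp_all
  then show ?thesis by (simp add: matrix_transpose_mul)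
qed

section \<open>The arithmetic quotient and a strict fundamental domain\<close>

lemma borel_measurable_vec_lambda [measurable (raw)]:
  fixes f :: "'a \<Rightarrow> 'n::finite \<Rightarrow> 'b::euclidean_space"
  assumes "\<And>i. (\<lambda>x. f x i) \<in> borel_measurable M"
  shows "(\<lambda>x. \<chi> i. f x i) \<in> borel_measurable M"
proof (subst borel_measurable_euclidean_space, rule ballI)
  fix b :: "'b^'n" assume "b \<in> Basis"
  then obtain i u where "b = axis i u" by (auto simp: Basis_vec_def)
  then show "(\<lambda>x. (\<chi> i. f x i) \<bullet> b) \<in> borel_measurable M"
    using assms by (simp add: inner_axis)
qed

lemma borel_measurable_vec_nth [measurable (raw)]:
  fixes f :: "'a \<Rightarrow> 'b::euclidean_space^'n"
  assumes [measurable]: "f \<in> borel_measurable M"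
  shows "(\<lambda>x. f x $ i) \<in> borel_measurable M"
  by (rule borel_measurable_continuous_on[OF _ assms, of "\<lambda>v. v $ i"]) (intro continuous_intros)

text \<open>The inverse by Cramer's rule. As an explicit quotient of determinants it is visibly
  Borel, continuous where the determinant is nonzero, and integral on \<open>SLZ\<close>.\<close>

definition cramer_inv :: "real^'n^'n \<Rightarrow> real^'n^'n" where
  "cramer_inv A = (\<chi> k l. det (\<chi> i j. if j = k then mat 1 $ i $ l else A $ i $ j) / det A)"

lemma cramer_inv_right:
  assumes "det A \<noteq> 0"
  shows "A ** cramer_inv A = mat 1"
proof -
  have "A *v (\<chi> k. cramer_inv A $ k $ l) = (\<chi> i. mat 1 $ i $ l)" for l
    by (subst cramer[OF assms]) (simp add: cramer_inv_def cong: if_cong)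
  then show ?thesis
    by (simp add: vec_eq_iff matrix_matrix_mult_def matrix_vector_mult_def)
qed

lemma cramer_inv_left: "det A \<noteq> 0 \<Longrightarrow> cramer_inv A ** A = mat 1"
  using cramer_inv_right matrix_left_right_inverse by blast

lemma cramer_inv_cancel_left: "det A \<noteq> 0 \<Longrightarrow> cramer_inv A ** (A ** B) = B"
  by (simp add: matrix_mul_assoc cramer_inv_left)

lemma cramer_inv_cancel_left': "det A \<noteq> 0 \<Longrightarrow> A ** (cramer_inv A ** B) = B"
  by (simp add: matrix_mul_assoc cramer_inv_right)

lemma cramer_inv_cancel_right: "det A \<noteq> 0 \<Longrightarrow> (B ** A) ** cramer_inv A = B"
  by (simp add: cramer_inv_right flip: matrix_mul_assoc)

lemma cramer_inv_cancel_right': "det A \<noteq> 0 \<Longrightarrow> (B ** cramer_inv A) ** A = B"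
  by (simp add: cramer_inv_left flip: matrix_mul_assoc)

lemma det_cramer_inv: "det A \<noteq> 0 \<Longrightarrow> det (cramer_inv A) = 1 / det A"
  using det_mul[of A "cramer_inv A"] by (simp add: cramer_inv_right field_simps)

lemma cramer_inv_unique: "A ** B = mat 1 \<Longrightarrow> cramer_inv A = B"
  by (metis cramer_inv_cancel_left det_I det_mul matrix_mul_rid mult_zero_left zero_neq_one)

lemma borel_measurable_cramer_inv [measurable]:
  "(cramer_inv :: real^'n^'n \<Rightarrow> _) \<in> borel_measurable borel"
proof -
  have "(\<lambda>A :: real^'n^'n. if j = k then mat 1 $ i $ l else A $ i $ j) \<in> borel_measurable borel"
    for i j k l :: 'n
    by (cases "j = k") auto
  then show ?thesis
    unfolding cramer_inv_def[abs_def] by measurable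
qed

lemma continuous_on_cramer_inv: "continuous_on {A :: real^'n^'n. det A \<noteq> 0} cramer_inv"
proof -
  have "continuous_on S (\<lambda>A :: real^'n^'n. if j = k then mat 1 $ i $ l else A $ i $ j)"
    for S i j k l
    by (cases "j = k") (auto intro!: continuous_intros)
  then show ?thesis
    unfolding cramer_inv_def[abs_def] by (intro continuous_intros) auto
qed

lemma det_Ints:
  fixes A :: "real^'n^'n"
  assumes "\<And>i j. A $ i $ j \<in> \<int>"
  shows "det A \<in> \<int>"
  unfolding det_def by (intro Ints_sum Ints_mult Ints_prod Ints_of_int assms)

lemma SLn_one [simp]: "mat 1 \<in> SLn" by (simp add: SLn_def)

lemma SLn_mult: "g \<in> SLn \<Longrightarrow> h \<in> SLn \<Longrightarrow> g ** h \<in> SLn"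
  by (simp add: SLn_def det_mul)

lemma SLn_inv: "g \<in> SLn \<Longrightarrow> cramer_inv g \<in> SLn"
  by (simp add: SLn_def det_cramer_inv)

lemma SLn_det_nz: "g \<in> SLn \<Longrightarrow> det g \<noteq> 0" by (simp add: SLn_def)

lemma SLn_borel [measurable]: "SLn \<in> sets borel"
  unfolding SLn_def by measurable

lemma SLZ_SLn: "g \<in> SLZ \<Longrightarrow> g \<in> SLn" by (simp add: SLn_def SLZ_def)

lemma SLZ_det: "g \<in> SLZ \<Longrightarrow> det g = 1" by (simp add: SLZ_def)

lemma mat_1_Ints: "(mat 1 :: real^'n^'n) $ i $ j \<in> \<int>"
  by (simp add: mat_def)

lemma SLZ_one [simp]: "mat 1 \<in> SLZ"
  by (simp add: SLZ_def mat_1_Ints)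

lemma SLZ_mult: "g \<in> SLZ \<Longrightarrow> h \<in> SLZ \<Longrightarrow> g ** h \<in> SLZ"
  by (simp add: SLZ_def det_mul) (simp add: matrix_matrix_mult_def Ints_sum)

lemma SLZ_inv:
  assumes "g \<in> SLZ"
  shows "cramer_inv g \<in> SLZ"
proof -
  have "cramer_inv g $ i $ j \<in> \<int>" for i j
    using assms
    by (simp add: SLZ_def cramer_inv_def) (intro det_Ints, simp add: mat_1_Ints)
  then show ?thesis using SLn_inv[OF SLZ_SLn[OF assms]] by (simp add: SLZ_def SLn_def)
qed

lemma countable_int_matrices: "countable {A :: real^'n^'n. \<forall>i j. A $ i $ j \<in> \<int>}"
proof (rule countable_subset)
  show "{A :: real^'n^'n. \<forall>i j. A $ i $ j \<in> \<int>} \<subseteq> range (\<lambda>f. \<chi> i j. real_of_int (f i j))"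
  proof
    fix A :: "real^'n^'n" assume "A \<in> {A. \<forall>i j. A $ i $ j \<in> \<int>}"
    then have "A = (\<chi> i j. real_of_int \<lfloor>A $ i $ j\<rfloor>)" by (auto simp: vec_eq_iff)
    then show "A \<in> range (\<lambda>f. \<chi> i j. real_of_int (f i j))"
      by (auto intro!: image_eqI[where x = "\<lambda>i j. \<lfloor>A $ i $ j\<rfloor>"])
  qed
qed simp

lemma countable_SLZ: "countable SLZ"
  by (rule countable_subset[OF _ countable_int_matrices]) (auto simp: SLZ_def)

lemma coset_self: "g \<in> coset g"
  unfolding coset_def by (rule image_eqI[of _ _ "mat 1"]) auto

lemma coset_mult_SLZ:
  assumes "\<gamma> \<in> SLZ"
  shows "coset (\<gamma> ** g) = coset g"
proof -
  have "coset (\<gamma> ** g) \<subseteq> coset g" if "\<gamma> \<in> SLZ" for \<gamma> g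
    using that unfolding coset_def by (auto simp: matrix_mul_assoc SLZ_mult)
  from this[OF assms] this[OF SLZ_inv[OF assms], of "\<gamma> ** g"] show ?thesis
    using assms by (simp add: cramer_inv_cancel_left SLZ_det subset_antisym)
qed

lemma coset_in_Xspace: "g \<in> SLn \<Longrightarrow> coset g \<in> Xspace"
  by (simp add: Xspace_def)

lemma Union_eq_coset_vimage:
  assumes "S \<subseteq> Xspace"
  shows "\<Union>S = {g \<in> SLn. coset g \<in> S}"
proof (intro equalityI subsetI)
  fix g assume "g \<in> \<Union>S"
  then obtain h where h: "h \<in> SLn" "coset h \<in> S" "g \<in> coset h"
    using assms by (auto simp: Xspace_def)
  then obtain \<gamma> where "\<gamma> \<in> SLZ" "g = \<gamma> ** h" by (auto simp: coset_def)
  with h show "g \<in> {g \<in> SLn. coset g \<in> S}"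
    by (auto simp: coset_mult_SLZ SLn_mult SLZ_SLn)
qed (use coset_self in blast)

text \<open>Expressed by preimages under \<open>coset\<close>, the generating family of
  \<open>Xmeas\<close> is visibly closed under complements and countable unions, so generation adds
  no sets.\<close>

lemma sets_Xmeas:
  "sets Xmeas = {S. S \<subseteq> Xspace \<and> {g \<in> SLn :: (real^'n^'n) set. coset g \<in> S} \<in> sets borel}" (is "_ = ?A")
proof -
  have eq: "{S. S \<subseteq> Xspace \<and> \<Union>S \<in> sets borel} = ?A"
    by (auto simp: Union_eq_coset_vimage)
  have "sigma_algebra Xspace ?A"
  proof (rule sigma_algebra_iff2[THEN iffD2], intro conjI ballI allI impI)
    show "{} \<in> ?A" by simp
    fix S :: "(real^'n^'n) set set" assume S: "S \<in> ?A"
    have "{g \<in> SLn. coset g \<in> Xspace - S} = SLn - {g \<in> SLn. coset g \<in> S}"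
      by (auto simp: coset_in_Xspace)
    with S show "Xspace - S \<in> ?A" by auto
  next
    fix S :: "nat \<Rightarrow> (real^'n^'n) set set" assume S: "range S \<subseteq> ?A"
    have "{g \<in> SLn. coset g \<in> (\<Union>i. S i)} = (\<Union>i. {g \<in> SLn. coset g \<in> S i})"
      by auto
    moreover have "\<dots> \<in> sets borel" using S by auto
    ultimately show "(\<Union>i. S i) \<in> ?A" using S by auto
  qed (auto)
  then show ?thesis
    unfolding Xmeas_def eq by (rule sigma_algebra.sets_measure_of_eq)
qed

lemma space_Xmeas [simp]: "space Xmeas = Xspace"
  unfolding Xmeas_def by (rule space_measure_of) auto

lemma measurable_coset [measurable (raw)]:
  fixes f :: "'a \<Rightarrow> real^'n^'n"
  assumes [measurable]: "f \<in> borel_measurable M" and f: "\<And>x. x \<in> space M \<Longrightarrow> f x \<in> SLn"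
  shows "(\<lambda>x. coset (f x)) \<in> M \<rightarrow>\<^sub>M Xmeas"
proof (rule measurableI)
  fix S :: "(real^'n^'n) set set" assume "S \<in> sets Xmeas"
  then have "{g \<in> SLn. coset g \<in> S} \<in> sets borel" by (simp add: sets_Xmeas)
  then have "f -` {g \<in> SLn. coset g \<in> S} \<inter> space M \<in> sets M" by measurable
  also have "f -` {g \<in> SLn. coset g \<in> S} \<inter> space M = (\<lambda>x. coset (f x)) -` S \<inter> space M"
    using f by auto
  finally show "(\<lambda>x. coset (f x)) -` S \<inter> space M \<in> sets M" .
qed (use f in \<open>simp add: coset_in_Xspace\<close>)

lemma xact_coset: "xact (coset g) h = coset (g ** h)"
  unfolding xact_def coset_def by (auto simp: image_image matrix_mul_assoc)

section \<open>A Borel fundamental domain of the integer group\<close>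

text \<open>The map (B, C) \<mapsto> C B^(-1) is continuous with value 1 at (g, g). For B and
  \<gamma> B both near g its value \<gamma> differs from 1 by less than 1 in every entry, and
  integrality forces \<gamma> = 1.\<close>

lemma SLZ_translates_disjoint:
  fixes g :: "real^'n^'n"
  assumes g: "g \<in> SLn"
  shows "\<exists>e>0. \<forall>\<gamma>\<in>SLZ. \<forall>B\<in>SLn. B \<in> ball g e \<and> \<gamma> ** B \<in> ball g e \<longrightarrow> \<gamma> = mat 1"
proof -
  define \<phi> :: "(real^'n^'n) \<times> (real^'n^'n) \<Rightarrow> real^'n^'n"
    where "\<phi> = (\<lambda>z. snd z ** cramer_inv (fst z))"
  let ?U = "{A :: real^'n^'n. det A \<noteq> 0} \<times> (UNIV :: (real^'n^'n) set)"
  have op: "open ?U"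
    by (intro open_Times open_Collect_neq continuous_intros) auto
  have "continuous_on ?U \<phi>"
    unfolding \<phi>_def
    by (intro continuous_intros continuous_on_compose2[OF continuous_on_cramer_inv]) auto
  then have "isCont \<phi> (g, g)"
    using op g by (simp add: continuous_on_eq_continuous_at SLn_def)
  then obtain d where d: "d > 0" "\<And>z. dist z (g, g) < d \<Longrightarrow> dist (\<phi> z) (\<phi> (g, g)) < 1"
    unfolding continuous_at_eps_delta by (metis zero_less_one)
  have one: "\<phi> (g, g) = mat 1" using g by (simp add: \<phi>_def cramer_inv_right SLn_det_nz)
  show ?thesis
  proof (intro exI[of _ "d/2"] conjI ballI impI)
    fix \<gamma> B :: "real^'n^'n"
    assume \<gamma>: "\<gamma> \<in> SLZ" and B: "B \<in> SLn" "B \<in> ball g (d/2) \<and> \<gamma> ** B \<in> ball g (d/2)"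
    have "dist (B, \<gamma> ** B) (g, g) \<le> dist B g + dist (\<gamma> ** B) g"
      by (simp add: dist_Pair_Pair sqrt_sum_squares_le_sum)
    also have "\<dots> < d" using B by (simp add: dist_commute)
    finally have "dist (\<phi> (B, \<gamma> ** B)) (mat 1) < 1" using d(2)[of "(B, \<gamma> ** B)"] one by simp
    then have lt: "norm (\<gamma> - mat 1) < 1"
      using B by (simp add: \<phi>_def dist_norm cramer_inv_cancel_right SLn_det_nz)
    show "\<gamma> = mat 1"
    proof (clarsimp simp: vec_eq_iff)
      fix i j
      have "\<bar>\<gamma> $ i $ j - mat 1 $ i $ j\<bar> \<le> norm ((\<gamma> - mat 1) $ i)"
        using Finite_Cartesian_Product.norm_nth_le[of "(\<gamma> - mat 1) $ i" j] by simp
      also have "\<dots> \<le> norm (\<gamma> - mat 1)" by (rule Finite_Cartesian_Product.norm_nth_le)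
      also note lt
      finally have "\<bar>\<gamma> $ i $ j - mat 1 $ i $ j\<bar> < 1" .
      moreover have "\<gamma> $ i $ j - (mat 1 :: real^'n^'n) $ i $ j \<in> \<int>"
        using \<gamma> by (intro Ints_diff mat_1_Ints) (simp add: SLZ_def)
      ultimately show "\<gamma> $ i $ j = mat 1 $ i $ j"
        using Ints_nonzero_abs_less1 by fastforce
    qed
  qed (use d in auto)
qed

text \<open>Exactly one representative per orbit is required, not merely up to null sets, so that
  the translates partition the group and the quotient has a section.\<close>

definition strict_fd :: "(real^'n^'n) set \<Rightarrow> bool" where
  "strict_fd F \<longleftrightarrow> F \<subseteq> SLn \<and> F \<in> sets borel \<and> (\<forall>g\<in>SLn. \<exists>!\<gamma>. \<gamma> \<in> SLZ \<and> \<gamma> ** g \<in> F)"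

text \<open>By Lindelof, countably many open sets without self-overlap under \<open>SLZ\<close>
  cover the group. Each orbit is represented by its only point in the first of them that it meets;
  \<open>sat i\<close> collects the points whose orbit meets \<open>U i\<close>.\<close>

lemma strict_fd_exists: "\<exists>F :: (real^'n^'n) set. strict_fd F"
proof -
  let ?good = "\<lambda>V :: (real^'n^'n) set. \<forall>\<gamma>\<in>SLZ. \<forall>B\<in>SLn. B \<in> V \<and> \<gamma> ** B \<in> V \<longrightarrow> \<gamma> = mat 1"
  define \<F> where "\<F> = {V :: (real^'n^'n) set. open V \<and> ?good V}"
  obtain \<F>' where \<F>': "\<F>' \<subseteq> \<F>" "countable \<F>'" "\<Union>\<F>' = \<Union>\<F>"
    using Lindelof[of \<F>] unfolding \<F>_def by blast
  have cov: "g \<in> \<Union>\<F>'" if g: "g \<in> SLn" for g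
  proof -
    obtain e where "e > 0" "?good (ball g e)" using SLZ_translates_disjoint[OF g] by blast
    then have "ball g e \<in> \<F>" "g \<in> ball g e" by (auto simp: \<F>_def)
    then show ?thesis using \<F>' by blast
  qed
  then have ne: "\<F>' \<noteq> {}" using SLn_one by blast
  define U where "U = from_nat_into \<F>'"
  have U: "range U = \<F>'" unfolding U_def by (rule range_from_nat_into[OF ne \<F>'(2)])
  then have Ug: "open (U i)" "?good (U i)" for i using \<F>'(1) unfolding \<F>_def by auto
  have [measurable]: "U i \<in> sets borel" for i using Ug by auto
  define sat where "sat i = (\<Union>\<gamma>\<in>SLZ. (\<lambda>g. \<gamma> ** g) -` U i)" for i
  have sat_iff: "g \<in> sat i \<longleftrightarrow> (\<exists>\<gamma>\<in>SLZ. \<gamma> ** g \<in> U i)" for g i by (auto simp: sat_def)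
  have [measurable]: "sat i \<in> sets borel" for i
    unfolding sat_def
  proof (intro sets.countable_UN'' countable_SLZ)
    fix \<gamma> :: "real^'n^'n"
    have "(\<lambda>g. \<gamma> ** g) -` U i \<inter> space borel \<in> sets borel"
      by (rule measurable_sets[of _ borel borel]) measurable
    then show "(\<lambda>g. \<gamma> ** g) -` U i \<in> sets borel" by simp
  qed
  define F where "F = {g \<in> SLn. \<exists>i. g \<in> U i \<and> (\<forall>j<i. g \<notin> sat j)}"
  have sat_inv: "\<gamma> ** g \<in> sat i \<longleftrightarrow> g \<in> sat i" if "\<gamma> \<in> SLZ" for \<gamma> g i
  proof -
    have *: "\<gamma> ** g \<in> sat i \<Longrightarrow> g \<in> sat i" if "\<gamma> \<in> SLZ" for \<gamma> g
      using that unfolding sat_iff by (metis SLZ_mult matrix_mul_assoc)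
    from *[OF that] *[OF SLZ_inv[OF that], of "\<gamma> ** g"] that show ?thesis
      by (auto simp: cramer_inv_cancel_left SLZ_det)
  qed
  have "F \<in> sets borel" unfolding F_def by measurable
  moreover have "\<exists>!\<gamma>. \<gamma> \<in> SLZ \<and> \<gamma> ** g \<in> F" if g: "g \<in> SLn" for g
  proof -
    obtain k where "g \<in> U k" using cov[OF g] U by blast
    then have k: "g \<in> sat k" unfolding sat_iff by (metis SLZ_one matrix_mul_lid)
    define i where "i = (LEAST i. g \<in> sat i)"
    have i: "g \<in> sat i" "\<And>j. j < i \<Longrightarrow> g \<notin> sat j"
      unfolding i_def using LeastI[of "\<lambda>i. g \<in> sat i", OF k] not_less_Least by blast+
    then obtain \<gamma> where \<gamma>: "\<gamma> \<in> SLZ" "\<gamma> ** g \<in> U i" unfolding sat_iff by blast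
    have i_uniq: "i' = i" if "\<gamma>' \<in> SLZ" "\<gamma>' ** g \<in> U i'" "\<forall>j<i'. \<gamma>' ** g \<notin> sat j" for \<gamma>' i'
    proof -
      have "g \<in> sat i'" using that sat_iff by blast
      then have "i \<le> i'" using i(2) by (meson not_le)
      moreover have "i' \<le> i" using that(3) i(1) sat_inv[OF that(1)] by (meson not_le)
      ultimately show ?thesis by simp
    qed
    show ?thesis
    proof (intro ex1I conjI)
      show "\<gamma> \<in> SLZ" by fact
      show "\<gamma> ** g \<in> F"
        unfolding F_def using \<gamma> i g by (auto simp: sat_inv SLn_mult SLZ_SLn)
      fix \<gamma>' assume \<gamma>': "\<gamma>' \<in> SLZ \<and> \<gamma>' ** g \<in> F"
      then obtain i' where i': "\<gamma>' ** g \<in> U i'" "\<forall>j<i'. \<gamma>' ** g \<notin> sat j" by (auto simp: F_def)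
      then have "\<gamma>' ** g \<in> U i" using i_uniq \<gamma>' by blast
      moreover have eq: "(\<gamma>' ** cramer_inv \<gamma>) ** (\<gamma> ** g) = \<gamma>' ** g"
        using \<gamma> by (simp add: cramer_inv_cancel_left SLZ_det flip: matrix_mul_assoc)
      moreover have "\<gamma>' ** cramer_inv \<gamma> \<in> SLZ" using \<gamma> \<gamma>' by (simp add: SLZ_mult SLZ_inv)
      moreover have "\<gamma> ** g \<in> SLn" using \<gamma> g by (simp add: SLn_mult SLZ_SLn)
      ultimately have "\<gamma>' ** cramer_inv \<gamma> = mat 1" using Ug(2)[of i] \<gamma> by metis
      then show "\<gamma>' = \<gamma>" using \<gamma> by (metis SLZ_det cramer_inv_cancel_right' matrix_mul_lid zero_neq_one)
    qed
  qed
  moreover have "F \<subseteq> SLn" by (auto simp: F_def)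
  ultimately have "strict_fd F" by (simp add: strict_fd_def)
  then show ?thesis ..
qed

lemma det_scaleR:
  fixes A :: "real^'n^'n"
  shows "det (c *\<^sub>R A) = c ^ CARD('n) * det A"
proof -
  have "c *\<^sub>R A = (\<chi> i. c *s A $ i)" by (simp add: vec_eq_iff)
  then show ?thesis by (simp add: det_rows_mul)
qed

text \<open>The default \<open>mat 1\<close> for nonpositive determinant keeps every value in
  \<open>SLn\<close>, so that maps built from it are total and measurable on all matrices.\<close>

definition det_normalize :: "real^'n^'n \<Rightarrow> real^'n^'n" where
  "det_normalize A = (if det A > 0 then (1 / root CARD('n) (det A)) *\<^sub>R A else mat 1)"

lemma det_normalize_SLn [simp]: "det_normalize A \<in> SLn"
  by (simp add: det_normalize_def SLn_def det_scaleR power_divide)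

lemma measurable_det_normalize [measurable]:
  "(det_normalize :: real^'n^'n \<Rightarrow> _) \<in> borel_measurable borel"
proof -
  have [measurable]: "root n \<in> borel_measurable borel" for n
    by (intro borel_measurable_continuous_onI continuous_intros)
  show ?thesis unfolding det_normalize_def[abs_def] by measurable
qed

lemma matrix_mult_scaleR_left: "(c *\<^sub>R A) ** (B :: real^'m^'n) = c *\<^sub>R (A ** B)"
  by (simp add: vec_eq_iff matrix_matrix_mult_def sum_distrib_left mult.assoc)

lemma matrix_mult_scaleR_right: "A ** (c *\<^sub>R B :: real^'m^'n) = c *\<^sub>R ((A :: real^'n^'k) ** B)"
  by (simp add: vec_eq_iff matrix_matrix_mult_def sum_distrib_left mult.left_commute)

lemma det_normalize_mult_left:
  "g \<in> SLn \<Longrightarrow> det A > 0 \<Longrightarrow> det_normalize (g ** A) = g ** det_normalize A"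
  by (simp add: det_normalize_def SLn_def det_mul matrix_mult_scaleR_right)

lemma det_normalize_mult_right:
  "g \<in> SLn \<Longrightarrow> det A > 0 \<Longrightarrow> det_normalize (A ** g) = det_normalize A ** g"
  by (simp add: det_normalize_def SLn_def det_mul matrix_mult_scaleR_left)

section \<open>Counting Hermite normal forms\<close>

lemma transv_SLZ: "m \<noteq> n \<Longrightarrow> c \<in> \<int> \<Longrightarrow> transv m n c \<in> SLZ"
  by (simp add: SLZ_def det_transv) (simp add: transv_def)

text \<open>Hermite normal form of the columns that the enumeration \<open>e\<close> of the index type ranks below
  \<open>m\<close>; pivots may be negative, and a column with zero pivot is not reduced above it.\<close>

definition hnf_upto :: "('n \<Rightarrow> nat) \<Rightarrow> nat \<Rightarrow> real^'n^'n \<Rightarrow> bool" where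
  "hnf_upto e m w \<longleftrightarrow> (\<forall>i j. w $ i $ j \<in> \<int>) \<and> (\<forall>c r. e c < m \<longrightarrow> (e c < e r \<longrightarrow> w $ r $ c = 0) \<and>
     (e r < e c \<and> w $ c $ c \<noteq> 0 \<longrightarrow> 0 \<le> w $ r $ c \<and> w $ r $ c < \<bar>w $ c $ c\<bar>))"

text \<open>Rows ranked \<open>m\<close> or higher vanish in the finished columns, so adding
  multiples of them disturbs nothing there.\<close>

lemma hnf_upto_transv:
  assumes w: "hnf_upto e m w" and s: "m \<le> e s" and k: "k \<in> \<int>"
  shows "hnf_upto e m (transv r s k ** w)"
proof -
  have "(transv r s k ** w) $ i $ c = w $ i $ c" if "e c < m" for i c
  proof -
    have "w $ s $ c = 0" using w s that unfolding hnf_upto_def by (meson less_le_trans)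
    then show ?thesis by (simp add: transv_mult_nth)
  qed
  moreover have "(transv r s k ** w) $ i $ j \<in> \<int>" for i j
    using w k by (simp add: transv_mult_nth hnf_upto_def)
  ultimately show ?thesis using w unfolding hnf_upto_def by metis
qed

lemma Ints_less_imp_floor_less:
  fixes x y :: real
  assumes "x \<in> \<int>" "y \<in> \<int>" "x < y"
  shows "\<lfloor>x\<rfloor> < \<lfloor>y\<rfloor>"
  using assms by (auto elim!: Ints_cases)

text \<open>Euclid's algorithm as a minimality argument: an admissible \<open>\<gamma>\<close> with
  the least sum of absolute values in the lower part of column \<open>c0\<close> leaves at most one
  nonzero entry there.\<close>

lemma hnf_clear_column:
  fixes w :: "real^'n^'n"
  assumes w: "hnf_upto e m w" and e: "e c0 = m"
  shows "\<exists>\<gamma>\<in>SLZ. hnf_upto e m (\<gamma> ** w) \<and> (\<forall>r. m < e r \<longrightarrow> (\<gamma> ** w) $ r $ c0 = 0)"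
proof -
  define f where "f \<gamma> = nat (\<Sum>r | m \<le> e r. \<lfloor>\<bar>(\<gamma> ** w) $ r $ c0\<bar>\<rfloor>)" for \<gamma>
  have "hnf_upto e m (mat 1 ** w)" using w by simp
  then obtain \<gamma> where \<gamma>: "\<gamma> \<in> SLZ" "hnf_upto e m (\<gamma> ** w)"
    and min: "\<And>\<gamma>'. \<gamma>' \<in> SLZ \<Longrightarrow> hnf_upto e m (\<gamma>' ** w) \<Longrightarrow> f \<gamma> \<le> f \<gamma>'"
    using ex_has_least_nat[of "\<lambda>\<gamma>. \<gamma> \<in> SLZ \<and> hnf_upto e m (\<gamma> ** w)" "mat 1" f] by auto
  define v where "v = \<gamma> ** w"
  have v_int: "v $ i $ j \<in> \<int>" for i j using \<gamma> by (simp add: v_def hnf_upto_def)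
  have le: "\<not> \<bar>v $ s $ c0\<bar> \<le> \<bar>v $ r $ c0\<bar>"
    if rs: "r \<noteq> s" "m \<le> e r" "m \<le> e s" "v $ r $ c0 \<noteq> 0" "v $ s $ c0 \<noteq> 0" for r s
  proof
    assume le: "\<bar>v $ s $ c0\<bar> \<le> \<bar>v $ r $ c0\<bar>"
    \<comment> \<open>By the choice of sign, row \<open>s\<close> reduces the absolute value in row
      \<open>r\<close> by the one in row \<open>s\<close>.\<close>
    define k where "k = - sgn (v $ r $ c0) * sgn (v $ s $ c0)"
    have k: "k \<in> \<int>" by (simp add: k_def sgn_if)
    define v' where "v' = transv r s k ** v"
    have v': "v' = (transv r s k ** \<gamma>) ** w" by (simp add: v'_def v_def matrix_mul_assoc)
    have G: "transv r s k ** \<gamma> \<in> SLZ" using \<gamma> transv_SLZ[OF rs(1) k] by (simp add: SLZ_mult)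
    have "hnf_upto e m v'" unfolding v'_def v_def by (rule hnf_upto_transv[OF \<gamma>(2) rs(3) k])
    then have 1: "f \<gamma> \<le> f (transv r s k ** \<gamma>)" using min[OF G] v' by simp
    have oth: "v' $ i $ c0 = v $ i $ c0" if "i \<noteq> r" for i using that by (simp add: v'_def transv_mult_nth)
    have "\<bar>v' $ r $ c0\<bar> = \<bar>v $ r $ c0\<bar> - \<bar>v $ s $ c0\<bar>"
      using le rs by (auto simp: v'_def transv_mult_nth k_def sgn_if)
    then have lt: "\<bar>v' $ r $ c0\<bar> < \<bar>v $ r $ c0\<bar>" using rs by simp
    have "v' $ r $ c0 \<in> \<int>" using v_int k by (simp add: v'_def transv_mult_nth)
    then have lt': "\<lfloor>\<bar>v' $ r $ c0\<bar>\<rfloor> < \<lfloor>\<bar>v $ r $ c0\<bar>\<rfloor>"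
      using lt v_int by (intro Ints_less_imp_floor_less) (auto simp: Ints_abs)
    have "(\<Sum>i | m \<le> e i. \<lfloor>\<bar>v' $ i $ c0\<bar>\<rfloor>) < (\<Sum>i | m \<le> e i. \<lfloor>\<bar>v $ i $ c0\<bar>\<rfloor>)"
    proof (rule sum_strict_mono_ex1)
      show "\<forall>i\<in>{i. m \<le> e i}. \<lfloor>\<bar>v' $ i $ c0\<bar>\<rfloor> \<le> \<lfloor>\<bar>v $ i $ c0\<bar>\<rfloor>"
        using lt' oth by (metis less_imp_le order_refl)
      show "\<exists>i\<in>{i. m \<le> e i}. \<lfloor>\<bar>v' $ i $ c0\<bar>\<rfloor> < \<lfloor>\<bar>v $ i $ c0\<bar>\<rfloor>"
        using lt' rs by auto
    qed simp
    moreover have "0 \<le> (\<Sum>i | m \<le> e i. \<lfloor>\<bar>v' $ i $ c0\<bar>\<rfloor>)" by (intro sum_nonneg) auto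
    ultimately have "f (transv r s k ** \<gamma>) < f \<gamma>"
      unfolding f_def v'[symmetric] v_def[symmetric] by simp
    with 1 show False by simp
  qed
  then have uniq: "r = s" if "m \<le> e r" "m \<le> e s" "v $ r $ c0 \<noteq> 0" "v $ s $ c0 \<noteq> 0" for r s
    using that by (metis linear)
  show ?thesis
  proof (cases "\<exists>r. m < e r \<and> v $ r $ c0 \<noteq> 0")
    case False
    then show ?thesis using \<gamma> by (auto simp: v_def)
  next
    case True
    then obtain r where r: "m < e r" "v $ r $ c0 \<noteq> 0" by auto
    then have rc: "r \<noteq> c0" using e by auto
    have c0: "v $ c0 $ c0 = 0" using uniq[of r c0] r rc e by auto
    \<comment> \<open>The only nonzero entry moves from row \<open>r\<close> to the pivot row
      \<open>c0\<close>. Two shears replace a row swap, whose determinant would be -1.\<close>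
    define \<gamma>' where "\<gamma>' = transv r c0 (-1) ** (transv c0 r 1 ** \<gamma>)"
    have "\<gamma>' ** w = transv r c0 (-1) ** (transv c0 r 1 ** v)"
      by (simp add: \<gamma>'_def v_def matrix_mul_assoc)
    moreover have "\<gamma>' \<in> SLZ" unfolding \<gamma>'_def using rc \<gamma> by (intro SLZ_mult transv_SLZ) auto
    moreover have "hnf_upto e m (transv r c0 (-1) ** (transv c0 r 1 ** v))"
      using r e \<gamma> by (intro hnf_upto_transv) (auto simp: v_def)
    moreover have "(transv r c0 (-1) ** (transv c0 r 1 ** v)) $ i $ c0 = 0" if "m < e i" for i
    proof -
      have "i \<noteq> c0" using that e by auto
      moreover have "v $ i $ c0 = 0" if "i \<noteq> r" using that uniq[of i r] r \<open>m < e i\<close> by force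
      ultimately show ?thesis using c0 rc by (auto simp: transv_mult_nth)
    qed
    ultimately show ?thesis by metis
  qed
qed

lemma hnf_reduce_column:
  fixes w :: "real^'n^'n"
  assumes w: "hnf_upto e m w" and e: "e c0 = m" and inj: "inj e"
    and z: "\<And>r. m < e r \<Longrightarrow> w $ r $ c0 = 0"
  shows "\<exists>\<gamma>\<in>SLZ. hnf_upto e (Suc m) (\<gamma> ** w)"
proof -
  define a where "a = w $ c0 $ c0"
  have "\<exists>\<gamma>\<in>SLZ. hnf_upto e m (\<gamma> ** w) \<and> (\<forall>r. m \<le> e r \<longrightarrow> (\<gamma> ** w) $ r $ c0 = w $ r $ c0) \<and>
      (a \<noteq> 0 \<longrightarrow> (\<forall>r\<in>R. 0 \<le> (\<gamma> ** w) $ r $ c0 \<and> (\<gamma> ** w) $ r $ c0 < \<bar>a\<bar>))"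
    if "finite R" "R \<subseteq> {r. e r < m}" for R
    using that
  proof (induction R rule: finite_induct)
    case empty
    show ?case using w by (intro bexI[of _ "mat 1"]) auto
  next
    case (insert r R)
    then obtain \<gamma> where \<gamma>: "\<gamma> \<in> SLZ" "hnf_upto e m (\<gamma> ** w)"
      "\<And>r. m \<le> e r \<Longrightarrow> (\<gamma> ** w) $ r $ c0 = w $ r $ c0"
      "\<And>r. a \<noteq> 0 \<Longrightarrow> r \<in> R \<Longrightarrow> 0 \<le> (\<gamma> ** w) $ r $ c0 \<and> (\<gamma> ** w) $ r $ c0 < \<bar>a\<bar>"
      by auto
    define v where "v = \<gamma> ** w"
    \<comment> \<open>Division with remainder by |a|; the factor \<open>sgn a\<close> accounts for a
      negative pivot.\<close>
    define k where "k = - (sgn a * of_int \<lfloor>v $ r $ c0 / \<bar>a\<bar>\<rfloor>)"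
    have k: "k \<in> \<int>" by (simp add: k_def sgn_if)
    have r: "r \<noteq> c0" "e r < m" using insert.prems e by auto
    have va: "v $ c0 $ c0 = a" using \<gamma>(3)[of c0] e by (simp add: v_def a_def)
    have red: "0 \<le> (transv r c0 k ** v) $ r $ c0 \<and> (transv r c0 k ** v) $ r $ c0 < \<bar>a\<bar>" if "a \<noteq> 0"
    proof -
      let ?x = "v $ r $ c0" and ?q = "\<lfloor>v $ r $ c0 / \<bar>a\<bar>\<rfloor>"
      have "of_int ?q * \<bar>a\<bar> \<le> ?x"
        by (intro iffD1[OF pos_le_divide_eq]) (use that in auto)
      moreover have "?x < (of_int ?q + 1) * \<bar>a\<bar>"
        by (intro iffD1[OF pos_divide_less_eq]) (use that in auto)
      moreover have "(transv r c0 k ** v) $ r $ c0 = ?x - of_int ?q * \<bar>a\<bar>"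
        using va by (simp add: transv_mult_nth k_def sgn_if abs_if)
      ultimately show ?thesis by (simp add: algebra_simps)
    qed
    have oth: "(transv r c0 k ** v) $ i $ c0 = v $ i $ c0" if "i \<noteq> r" for i
      using that by (simp add: transv_mult_nth)
    show ?case
    proof (intro bexI[of _ "transv r c0 k ** \<gamma>"] conjI)
      show "transv r c0 k ** \<gamma> \<in> SLZ" using \<gamma> r k by (intro SLZ_mult transv_SLZ) auto
      have eq: "(transv r c0 k ** \<gamma>) ** w = transv r c0 k ** v" by (simp add: v_def matrix_mul_assoc)
      show "hnf_upto e m ((transv r c0 k ** \<gamma>) ** w)"
        unfolding eq using \<gamma> e k by (intro hnf_upto_transv) (auto simp: v_def)
      show "\<forall>i. m \<le> e i \<longrightarrow> ((transv r c0 k ** \<gamma>) ** w) $ i $ c0 = w $ i $ c0"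
        unfolding eq using oth \<gamma>(3) r by (metis not_le v_def)
      show "a \<noteq> 0 \<longrightarrow> (\<forall>i\<in>insert r R. 0 \<le> ((transv r c0 k ** \<gamma>) ** w) $ i $ c0 \<and>
          ((transv r c0 k ** \<gamma>) ** w) $ i $ c0 < \<bar>a\<bar>)"
        unfolding eq using red oth \<gamma>(4) by (metis insert_iff v_def)
    qed
  qed
  from this[of "{r. e r < m}"] obtain \<gamma> where \<gamma>: "\<gamma> \<in> SLZ" "hnf_upto e m (\<gamma> ** w)"
    "\<forall>r. m \<le> e r \<longrightarrow> (\<gamma> ** w) $ r $ c0 = w $ r $ c0"
    "a \<noteq> 0 \<longrightarrow> (\<forall>r. e r < m \<longrightarrow> 0 \<le> (\<gamma> ** w) $ r $ c0 \<and> (\<gamma> ** w) $ r $ c0 < \<bar>a\<bar>)"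
    by auto
  have "c = c0" if "e c = m" for c using that e inj by (auto dest: injD)
  then have "hnf_upto e (Suc m) (\<gamma> ** w)"
    using \<gamma> z e unfolding hnf_upto_def a_def less_Suc_eq by (metis less_imp_le order_refl)
  with \<gamma> show ?thesis by blast
qed

lemma hnf_exists:
  fixes z :: "real^'n^'n"
  assumes z: "\<And>i j. z $ i $ j \<in> \<int>" and e: "bij_betw e UNIV {..<CARD('n)}"
  shows "\<exists>\<gamma>\<in>SLZ. hnf_upto e CARD('n) (\<gamma> ** z)"
proof -
  have inj: "inj e" using e by (simp add: bij_betw_def)
  have "\<exists>\<gamma>\<in>SLZ. hnf_upto e m (\<gamma> ** z)" if "m \<le> CARD('n)" for m
    using that
  proof (induction m)
    case 0
    show ?case using z by (intro bexI[of _ "mat 1"]) (auto simp: hnf_upto_def)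
  next
    case (Suc m)
    then obtain \<gamma> where \<gamma>: "\<gamma> \<in> SLZ" "hnf_upto e m (\<gamma> ** z)" by auto
    have "m \<in> range e" using Suc.prems e by (auto simp: bij_betw_def)
    then obtain c0 where c0: "e c0 = m" by auto
    obtain \<gamma>1 where \<gamma>1: "\<gamma>1 \<in> SLZ" "hnf_upto e m (\<gamma>1 ** (\<gamma> ** z))"
      "\<forall>r. m < e r \<longrightarrow> (\<gamma>1 ** (\<gamma> ** z)) $ r $ c0 = 0"
      using hnf_clear_column[OF \<gamma>(2) c0] by blast
    obtain \<gamma>2 where "\<gamma>2 \<in> SLZ" "hnf_upto e (Suc m) (\<gamma>2 ** (\<gamma>1 ** (\<gamma> ** z)))"
      using hnf_reduce_column[OF \<gamma>1(2) c0 inj] \<gamma>1(3) by blast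
    then show ?case using \<gamma> \<gamma>1
      by (intro bexI[of _ "\<gamma>2 ** (\<gamma>1 ** \<gamma>)"]) (auto simp: matrix_mul_assoc SLZ_mult)
  qed
  then show ?thesis by simp
qed

text \<open>The matrix is triangular in the order given by \<open>e\<close>. A permutation with a
  nonzero term never lowers the rank, and since the sum of all ranks is unchanged it is the
  identity.\<close>

lemma det_hnf:
  fixes w :: "real^'n^'n"
  assumes w: "hnf_upto e CARD('n) w" and e: "bij_betw e UNIV {..<CARD('n)}"
  shows "det w = (\<Prod>i\<in>UNIV. w $ i $ i)"
proof -
  have inj: "inj e" using e by (simp add: bij_betw_def)
  have tri: "w $ r $ c = 0" if "e c < e r" for r c
    using w that e unfolding hnf_upto_def by (meson bij_betwE UNIV_I lessThan_iff)
  have zero: "(\<Prod>i\<in>UNIV. w $ i $ p i) = 0" if p: "p permutes UNIV" "p \<noteq> id" for p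
  proof (rule ccontr)
    assume "\<not> ?thesis"
    then have ge: "e i \<le> e (p i)" for i using tri by (auto simp: not_less[symmetric])
    have "(\<Sum>i\<in>UNIV. e (p i)) = (\<Sum>i\<in>UNIV. e i)"
      using sum.permute[OF p(1), of e] by (simp add: comp_def)
    then have "e (p i) = e i" for i
      using ge sum_mono_inv[of e UNIV "\<lambda>i. e (p i)" i] by simp
    then have "p i = i" for i using inj by (auto dest: injD)
    then have "p = id" by auto
    with p show False by simp
  qed
  have "det w = (\<Sum>p\<in>{p. p permutes (UNIV::'n set)}. if p = id then \<Prod>i\<in>UNIV. w $ i $ i else 0)"
    unfolding det_def by (rule sum.cong) (auto simp: zero sign_id)
  also have "\<dots> = (\<Prod>i\<in>UNIV. w $ i $ i)"
    by (subst sum.delta) (auto simp: finite_permutations permutes_id)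
  finally show ?thesis .
qed

section \<open>The number of normal forms of bounded determinant\<close>

text \<open>\<open>f c r\<close> is the entry in column \<open>c\<close> and row \<open>r\<close>,
  so that a column is one function value. Columns not yet reached are set to zero, which makes the
  set finite and lets the count proceed column by column.\<close>

definition hnf_cols :: "('n \<Rightarrow> nat) \<Rightarrow> nat \<Rightarrow> nat \<Rightarrow> ('n \<Rightarrow> 'n \<Rightarrow> int) set" where
  "hnf_cols e m D = {f. (\<forall>c. m \<le> e c \<longrightarrow> f c = (\<lambda>_. 0)) \<and>
     (\<forall>c. e c < m \<longrightarrow> f c c \<noteq> 0 \<and> (\<forall>r. (e c < e r \<longrightarrow> f c r = 0) \<and> (e r < e c \<longrightarrow> 0 \<le> f c r \<and> f c r < \<bar>f c c\<bar>))) \<and>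
     (\<Prod>c | e c < m. nat \<bar>f c c\<bar>) \<le> D}"

text \<open>Peel off the last column, with pivot a. The entries above the pivot allow |a|^m choices,
  and the other pivots have product at most D / |a|. The powers of |a| cancel, leaving at most 2^m
  D^m for each of the 2 D possible pivots.\<close>

lemma card_hnf_cols:
  fixes e :: "'n::finite \<Rightarrow> nat"
  assumes e: "bij_betw e UNIV {..<CARD('n)}" and "m \<le> CARD('n)"
  shows "finite (hnf_cols e m D) \<and> card (hnf_cols e m D) \<le> 2 ^ m * D ^ m"
  using assms(2)
proof (induction m arbitrary: D)
  case 0
  have sub: "hnf_cols e 0 D \<subseteq> {\<lambda>_ _. 0}" by (auto simp: hnf_cols_def)
  have "finite (hnf_cols e 0 D)" by (rule finite_subset[OF sub]) simp
  moreover have "card (hnf_cols e 0 D) \<le> card {\<lambda>(_ :: 'n) (_ :: 'n). 0 :: int}" by (rule card_mono[OF _ sub]) simp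
  ultimately show ?case by simp
next
  case (Suc m)
  have inj: "inj e" using e by (simp add: bij_betw_def)
  have "m \<in> range e" using Suc.prems e by (auto simp: bij_betw_def)
  then obtain c0 where c0: "e c0 = m" by auto
  have c0_uniq: "e c = m \<longleftrightarrow> c = c0" for c using inj c0 by (auto dest: injD)
  have card_m: "card {r. e r < m} = m"
  proof -
    have "e ` {r. e r < m} = {..<m}" using e Suc.prems by (auto simp: bij_betw_def)
    then show ?thesis using inj by (metis card_image card_lessThan inj_on_subset subset_UNIV)
  qed
  define V where "V a r = (if r = c0 then {a} else if m < e r then {0} else {0..<\<bar>a\<bar>})" for a :: int and r
  define U where "U a = {u. \<forall>r. u r \<in> V a r}" for a
  have U: "finite (U a)" "card (U a) = nat \<bar>a\<bar> ^ m" for a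
  proof -
    have eq: "U a = PiE UNIV (V a)" by (auto simp: U_def PiE_def)
    show "finite (U a)" unfolding eq by (rule finite_PiE) (auto simp: V_def)
    have "card (U a) = (\<Prod>r\<in>UNIV. card (V a r))" unfolding eq by (simp add: card_PiE)
    also have "\<dots> = (\<Prod>r\<in>UNIV. if e r < m then nat \<bar>a\<bar> else 1)"
      using c0 by (intro prod.cong) (auto simp: V_def c0_uniq[symmetric])
    also have "\<dots> = nat \<bar>a\<bar> ^ m" by (simp add: prod.If_cases card_m)
    finally show "card (U a) = nat \<bar>a\<bar> ^ m" .
  qed
  define I where "I = {- int D..int D} - {0}"
  define X where "X a = (\<lambda>(u, f). f(c0 := u)) ` (U a \<times> hnf_cols e m (D div nat \<bar>a\<bar>))" for a
  have IH: "finite (hnf_cols e m E)" "card (hnf_cols e m E) \<le> 2 ^ m * E ^ m" for E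
    using Suc.IH[of E] Suc.prems by auto
  have X: "finite (X a)" "card (X a) \<le> 2 ^ m * D ^ m" if "a \<in> I" for a
  proof -
    show "finite (X a)" unfolding X_def using U IH by auto
    have "card (X a) \<le> card (U a \<times> hnf_cols e m (D div nat \<bar>a\<bar>))"
      unfolding X_def using U IH by (intro card_image_le) auto
    also have "\<dots> \<le> nat \<bar>a\<bar> ^ m * (2 ^ m * (D div nat \<bar>a\<bar>) ^ m)"
      using IH U by (simp add: card_cartesian_product)
    also have "\<dots> = 2 ^ m * (nat \<bar>a\<bar> * (D div nat \<bar>a\<bar>)) ^ m"
      by (simp add: power_mult_distrib)
    also have "\<dots> \<le> 2 ^ m * D ^ m"
      by (intro mult_left_mono power_mono) auto
    finally show "card (X a) \<le> 2 ^ m * D ^ m" .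
  qed
  have sub: "hnf_cols e (Suc m) D \<subseteq> (\<Union>a\<in>I. X a)"
  proof
    fix f assume f: "f \<in> hnf_cols e (Suc m) D"
    define a where "a = f c0 c0"
    have a0: "a \<noteq> 0" using f c0 by (auto simp: hnf_cols_def a_def)
    have "{c. e c < Suc m} = insert c0 {c. e c < m}" using c0 c0_uniq by (auto simp: less_Suc_eq)
    then have "(\<Prod>c | e c < Suc m. nat \<bar>f c c\<bar>) = nat \<bar>a\<bar> * (\<Prod>c | e c < m. nat \<bar>f c c\<bar>)"
      using c0 by (simp add: a_def)
    then have prod: "nat \<bar>a\<bar> * (\<Prod>c | e c < m. nat \<bar>f c c\<bar>) \<le> D"
      using f by (simp add: hnf_cols_def)
    have "nat \<bar>f c c\<bar> \<ge> 1" if "e c < m" for c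
    proof -
      have "f c c \<noteq> 0" using f that by (simp add: hnf_cols_def)
      then show ?thesis by linarith
    qed
    then have "(\<Prod>c | e c < m. nat \<bar>f c c\<bar>) \<ge> 1"
      by (intro prod_ge_1) auto
    then have "nat \<bar>a\<bar> * 1 \<le> nat \<bar>a\<bar> * (\<Prod>c | e c < m. nat \<bar>f c c\<bar>)" by (intro mult_le_mono2)
    then have "nat \<bar>a\<bar> \<le> D" using prod by linarith
    then have aI: "a \<in> I" using a0 by (auto simp: I_def)
    define g where "g = f(c0 := (\<lambda>_. 0))"
    have "g \<in> hnf_cols e m (D div nat \<bar>a\<bar>)"
    proof -
      have gc: "g c = f c" if "e c < m" for c using that c0 by (auto simp: g_def)
      have "(\<Prod>c | e c < m. nat \<bar>g c c\<bar>) = (\<Prod>c | e c < m. nat \<bar>f c c\<bar>)"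
        by (intro prod.cong) (auto simp: gc)
      also have "\<dots> \<le> D div nat \<bar>a\<bar>"
        using prod a0 by (simp add: less_eq_div_iff_mult_less_eq mult.commute)
      finally have "(\<Prod>c | e c < m. nat \<bar>g c c\<bar>) \<le> D div nat \<bar>a\<bar>" .
      moreover have "g c = (\<lambda>_. 0)" if "m \<le> e c" for c
      proof (cases "c = c0")
        case False
        then have "Suc m \<le> e c" using that c0_uniq[of c] by simp
        then show ?thesis using f False by (simp add: g_def hnf_cols_def)
      qed (simp add: g_def)
      ultimately show ?thesis
        using f unfolding hnf_cols_def by (auto simp: gc)
    qed
    moreover have "f c0 \<in> U a"
    proof -
      have "f c0 r \<in> V a r" for r
        using f c0 c0_uniq[of r] unfolding hnf_cols_def V_def a_def
        by (auto simp: neq_iff)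
      then show ?thesis by (simp add: U_def)
    qed
    moreover have "f = g(c0 := f c0)" by (simp add: g_def)
    ultimately have "f \<in> X a" unfolding X_def by (intro image_eqI[of _ _ "(f c0, g)"]) auto
    with aI show "f \<in> (\<Union>a\<in>I. X a)" by blast
  qed
  have finI: "finite I" by (simp add: I_def)
  have cardI: "card I = 2 * D" by (simp add: I_def)
  have fin: "finite (\<Union>a\<in>I. X a)" using finI X by auto
  have "card (hnf_cols e (Suc m) D) \<le> card (\<Union>a\<in>I. X a)" by (rule card_mono[OF fin sub])
  also have "\<dots> \<le> (\<Sum>a\<in>I. card (X a))" by (rule card_UN_le[OF finI])
  also have "\<dots> \<le> (\<Sum>a\<in>I. 2 ^ m * D ^ m)" by (intro sum_mono X)
  also have "\<dots> = 2 ^ Suc m * D ^ Suc m" by (simp add: cardI)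
  finally show ?case using finite_subset[OF sub fin] by simp
qed

text \<open>Two elements of \<open>Z\<close> with the same normal form lie in one orbit and hence
  coincide, so the number of normal forms bounds the size of \<open>Z\<close>.\<close>

lemma card_SLZ_inequivalent:
  fixes Z :: "(real^'n^'n) set"
  assumes int: "\<And>z i j. z \<in> Z \<Longrightarrow> z $ i $ j \<in> \<int>"
    and det: "\<And>z. z \<in> Z \<Longrightarrow> 0 < det z \<and> det z \<le> real D"
    and inequiv: "\<And>z \<gamma>. z \<in> Z \<Longrightarrow> \<gamma> \<in> SLZ \<Longrightarrow> \<gamma> ** z \<in> Z \<Longrightarrow> \<gamma> ** z = z"
  shows "finite Z \<and> card Z \<le> 2 ^ CARD('n) * D ^ CARD('n)"
proof -
  obtain e :: "'n \<Rightarrow> nat" where e: "bij_betw e UNIV {..<CARD('n)}"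
    using ex_bij_betw_finite_nat[of "UNIV :: 'n set"] by (auto simp: atLeast0LessThan)
  have "\<forall>z\<in>Z. \<exists>\<gamma>\<in>SLZ. hnf_upto e CARD('n) (\<gamma> ** z)"
    using hnf_exists[OF int e] by blast
  then obtain \<gamma> where \<gamma>: "\<And>z. z \<in> Z \<Longrightarrow> \<gamma> z \<in> SLZ" "\<And>z. z \<in> Z \<Longrightarrow> hnf_upto e CARD('n) (\<gamma> z ** z)"
    by metis
  define h where "h z = (\<lambda>c r. \<lfloor>(\<gamma> z ** z) $ r $ c\<rfloor>)" for z
  have h: "(\<gamma> z ** z) $ r $ c = of_int (h z c r)" if "z \<in> Z" for z r c
    using \<gamma>(2)[OF that] by (auto simp: h_def hnf_upto_def)
  have "inj_on h Z"
  proof (rule inj_onI)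
    fix z z' assume z: "z \<in> Z" "z' \<in> Z" "h z = h z'"
    then have eq: "\<gamma> z ** z = \<gamma> z' ** z'" by (simp add: vec_eq_iff h)
    have "z' = (cramer_inv (\<gamma> z') ** \<gamma> z) ** z"
      using \<gamma>(1)[OF z(2)] by (simp add: eq cramer_inv_cancel_left SLZ_det flip: matrix_mul_assoc)
    moreover have "cramer_inv (\<gamma> z') ** \<gamma> z \<in> SLZ" using \<gamma>(1) z by (simp add: SLZ_mult SLZ_inv)
    ultimately show "z = z'" using inequiv z by metis
  qed
  moreover have sub: "h ` Z \<subseteq> hnf_cols e CARD('n) D"
  proof
    fix f assume "f \<in> h ` Z"
    then obtain z where z: "z \<in> Z" "f = h z" by auto
    define w where "w = \<gamma> z ** z"
    have w: "hnf_upto e CARD('n) w" using \<gamma> z by (simp add: w_def)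
    have wf: "w $ r $ c = of_int (f c r)" for r c using h z by (simp add: w_def)
    have dw: "det w = det z" using \<gamma>(1)[OF z(1)] by (simp add: w_def det_mul SLZ_det)
    have dp: "det w = of_int (\<Prod>c\<in>UNIV. f c c)" using det_hnf[OF w e] by (simp add: wf)
    have n0: "f c c \<noteq> 0" for c
    proof
      assume "f c c = 0"
      then have "(\<Prod>c\<in>UNIV. f c c) = 0" by (intro prod_zero) auto
      then have "det w = of_int 0" by (simp only: dp)
      then show False using dw det[OF z(1)] by simp
    qed
    have elt: "e c < CARD('n)" for c using e by (auto simp: bij_betw_def)
    have ab: "\<bar>x\<bar> = x" if "of_int x > (0::real)" for x :: int using that by simp
    have "real (\<Prod>c\<in>UNIV. nat \<bar>f c c\<bar>) = of_int \<bar>\<Prod>c\<in>UNIV. f c c\<bar>"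
      by (simp add: abs_prod)
    also have "\<dots> = det z" using dp dw det[OF z(1)] by (simp del: of_int_abs of_int_prod add: ab)
    also have "\<dots> \<le> real D" using det[OF z(1)] by simp
    finally have "(\<Prod>c\<in>UNIV. nat \<bar>f c c\<bar>) \<le> D" by (simp del: of_nat_prod)
    moreover have "f c r = 0" if "e c < e r" for c r
      using w elt[of c] that wf[of r c] by (auto simp: hnf_upto_def)
    moreover have "0 \<le> f c r \<and> f c r < \<bar>f c c\<bar>" if "e r < e c" for c r
      using w elt[of c] that n0[of c] unfolding hnf_upto_def wf
      by (metis of_int_0_eq_iff of_int_0_le_iff of_int_abs of_int_less_iff)
    ultimately show "f \<in> hnf_cols e CARD('n) D"
      using elt n0 by (simp add: hnf_cols_def not_le[symmetric])
  qed
  moreover have "finite (hnf_cols e CARD('n) D)" "card (hnf_cols e CARD('n) D) \<le> 2 ^ CARD('n) * D ^ CARD('n)"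
    using card_hnf_cols[OF e, of "CARD('n)" D] by auto
  ultimately show ?thesis
    by (metis card_image card_mono finite_imageD finite_subset le_trans)
qed

section \<open>Finite covolume\<close>

text \<open>Subsets of \<open>SLn\<close> are Lebesgue null, so they are thickened by the scalars
  that keep the determinant between 1 and 2.\<close>

definition det_cone :: "(real^'n^'n) set \<Rightarrow> (real^'n^'n) set" where
  "det_cone F = {A. 1 \<le> det A \<and> det A \<le> 2 \<and> det_normalize A \<in> F}"

lemma det_cone_borel [measurable]:
  assumes [measurable]: "F \<in> sets borel"
  shows "det_cone F \<in> sets borel"
  unfolding det_cone_def by measurable

lemma det_cone_detD: "A \<in> det_cone F \<Longrightarrow> 0 < det A"
  by (simp add: det_cone_def)

lemma det_cone_strict:
  assumes F: "strict_fd F" and A: "A \<in> det_cone F" "\<gamma> ** A \<in> det_cone F" and \<gamma>: "\<gamma> \<in> SLZ"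
  shows "\<gamma> = mat 1"
proof -
  have "\<gamma> ** det_normalize A \<in> F"
    using A \<gamma> det_cone_detD[OF A(1)] by (simp add: det_cone_def det_normalize_mult_left SLZ_SLn)
  moreover have "mat 1 ** det_normalize A \<in> F" using A by (simp add: det_cone_def)
  ultimately show ?thesis
    using F \<gamma> det_normalize_SLn[of A] SLZ_one unfolding strict_fd_def by blast
qed

section \<open>Linear changes of variables\<close>

lemma nn_integral_lborel_SL_left:
  fixes A :: "real^'n^'n" and f :: "real^'n^'n \<Rightarrow> ennreal"
  assumes "det A = 1" and [measurable]: "f \<in> borel_measurable borel"
  shows "(\<integral>\<^sup>+X. f (A ** X) \<partial>lborel) = (\<integral>\<^sup>+X. f X \<partial>lborel)"
proof -
  have "(\<integral>\<^sup>+X. f X \<partial>lborel) = (\<integral>\<^sup>+X. f X \<partial>distr lborel borel (\<lambda>X. A ** X))"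
    by (simp add: lborel_SL_left[OF assms(1)])
  also have "\<dots> = (\<integral>\<^sup>+X. f (A ** X) \<partial>lborel)" by (subst nn_integral_distr) auto
  finally show ?thesis ..
qed

lemma nn_integral_lborel_scaleR:
  fixes f :: "'a::euclidean_space \<Rightarrow> ennreal"
  assumes "t > 0" and [measurable]: "f \<in> borel_measurable borel"
  shows "(\<integral>\<^sup>+x. f x \<partial>lborel) = ennreal (t ^ DIM('a)) * (\<integral>\<^sup>+x. f (t *\<^sub>R x) \<partial>lborel)"
proof -
  have eq: "(lborel :: 'a measure) = density (distr lborel borel (\<lambda>x. t *\<^sub>R x)) (\<lambda>_. ennreal (t ^ DIM('a)))"
    using lborel_affine[of t "0::'a"] assms by simp
  have "(\<integral>\<^sup>+x. f x \<partial>lborel) =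
      (\<integral>\<^sup>+x. f x \<partial>density (distr lborel borel (\<lambda>x. t *\<^sub>R x)) (\<lambda>_. ennreal (t ^ DIM('a))))"
    by (subst eq) (rule refl)
  also have "\<dots> = (\<integral>\<^sup>+x. ennreal (t ^ DIM('a)) * f x \<partial>distr lborel borel (\<lambda>x. t *\<^sub>R x))"
    by (rule nn_integral_density) auto
  also have "\<dots> = (\<integral>\<^sup>+x. ennreal (t ^ DIM('a)) * f (t *\<^sub>R x) \<partial>lborel)"
    by (subst nn_integral_distr) auto
  also have "\<dots> = ennreal (t ^ DIM('a)) * (\<integral>\<^sup>+x. f (t *\<^sub>R x) \<partial>lborel)"
    by (rule nn_integral_cmult) auto
  finally show ?thesis .
qed

text \<open>Factor \<open>A\<close> into a scalar t and a matrix of determinant 1. Only the scalar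
  changes volume, by t^(n^2) = (det A)^n.\<close>

lemma nn_integral_lborel_GL_left:
  fixes A :: "real^'n^'n" and f :: "real^'n^'n \<Rightarrow> ennreal"
  assumes det: "det A > 0" and [measurable]: "f \<in> borel_measurable borel"
  shows "(\<integral>\<^sup>+X. f X \<partial>lborel) = ennreal (det A ^ CARD('n)) * (\<integral>\<^sup>+X. f (A ** X) \<partial>lborel)"
proof -
  define t where "t = root CARD('n) (det A)"
  have t: "t > 0" "t ^ CARD('n) = det A" using det by (auto simp: t_def)
  have A: "A = t *\<^sub>R det_normalize A" using det t by (simp add: det_normalize_def t_def)
  have d1: "det (det_normalize A) = 1" using det_normalize_SLn[of A] by (simp add: SLn_def)
  have "(\<integral>\<^sup>+X. f (A ** X) \<partial>lborel) = (\<integral>\<^sup>+X. f (t *\<^sub>R (det_normalize A ** X)) \<partial>lborel)"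
    by (subst A) (simp add: matrix_mult_scaleR_left)
  also have "\<dots> = (\<integral>\<^sup>+X. f (t *\<^sub>R X) \<partial>lborel)"
    by (rule nn_integral_lborel_SL_left[OF d1, of "\<lambda>X. f (t *\<^sub>R X)"]) auto
  finally show ?thesis
    using nn_integral_lborel_scaleR[OF t(1) assms(2)] by (simp add: t(2) power_mult flip: t(2))
qed

lemma norm_matrix_mult_le:
  obtains K where "K > 0" "\<And>(A :: real^'n^'n) (B :: real^'n^'n). norm (A ** B) \<le> K * norm A * norm B"
proof -
  have "bilinear ((**) :: real^'n^'n \<Rightarrow> real^'n^'n \<Rightarrow> _)"
    unfolding bilinear_def
    by (auto intro!: linearI simp: matrix_add_ldistrib matrix_mult_scaleR_left matrix_mult_scaleR_right
        matrix_matrix_mult_def vec_eq_iff algebra_simps sum.distrib sum_distrib_left)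
  then have "bounded_bilinear ((**) :: real^'n^'n \<Rightarrow> real^'n^'n \<Rightarrow> _)"
    by (simp add: bilinear_conv_bounded_bilinear)
  then obtain K where "K > 0" "\<And>(A :: real^'n^'n) (B :: real^'n^'n). norm (A ** B) \<le> norm A * norm B * K"
    using bounded_bilinear.pos_bounded by blast
  then show thesis by (intro that[of K]) (auto simp: algebra_simps)
qed

text \<open>If \<open>C ** h = mat 1\<close> then h = 1 - (C - 1) h. With K |C - 1| at most 1/2 this
  bounds |h| by twice the norm of the identity.\<close>

lemma identity_neighbourhood:
  obtains \<delta> R where "\<delta> > 0"
    "\<And>C :: real^'n^'n. C \<in> ball (mat 1) \<delta> \<Longrightarrow> 1/2 < det C \<and> det C < 2"
    "\<And>C h :: real^'n^'n. C \<in> ball (mat 1) \<delta> \<Longrightarrow> C ** h = mat 1 \<Longrightarrow> norm h \<le> R"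
proof -
  obtain K where K: "K > 0" "\<And>(A :: real^'n^'n) (B :: real^'n^'n). norm (A ** B) \<le> K * norm A * norm B"
    using norm_matrix_mult_le by blast
  have "isCont det (mat 1 :: real^'n^'n)"
    using continuous_on_det[of UNIV "\<lambda>x :: real^'n^'n. x"] by (simp add: continuous_on_eq_continuous_at)
  then obtain d where d: "d > 0" "\<And>C :: real^'n^'n. dist C (mat 1) < d \<Longrightarrow> dist (det C) (det (mat 1 :: real^'n^'n)) < 1/2"
    unfolding continuous_at_eps_delta by (metis half_gt_zero zero_less_one)
  define \<delta> where "\<delta> = min d (1 / (2 * K))"
  have \<delta>: "\<delta> > 0" "\<delta> \<le> d" "K * \<delta> \<le> 1 / 2"
    using d(1) K(1) by (auto simp: \<delta>_def min_def field_simps)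
  show thesis
  proof (rule that[of \<delta> "2 * norm (mat 1 :: real^'n^'n)"])
    show "\<delta> > 0" by fact
    fix C :: "real^'n^'n" assume C: "C \<in> ball (mat 1) \<delta>"
    have "dist (det C) 1 < 1/2" using d(2)[of C] C \<delta> by (simp add: dist_commute)
    then show "1/2 < det C \<and> det C < 2" by (auto simp: dist_real_def abs_if split: if_splits)
    fix h :: "real^'n^'n" assume h: "C ** h = mat 1"
    have "h = mat 1 - (C - mat 1) ** h"
      using h by (simp add: vec_eq_iff matrix_matrix_mult_def left_diff_distrib sum_subtractf mat_def if_distrib[of "\<lambda>x. x * _"] cong: if_cong)
    then have "norm h \<le> norm (mat 1 :: real^'n^'n) + norm ((C - mat 1) ** h)"
      using norm_triangle_ineq4 by metis
    also have "norm ((C - mat 1) ** h) \<le> K * norm (C - mat 1) * norm h" by (rule K)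
    also have "\<dots> \<le> 1/2 * norm h"
    proof (rule mult_right_mono)
      have "K * norm (C - mat 1) \<le> K * \<delta>" using C K(1) by (intro mult_left_mono) (auto simp: dist_norm norm_minus_commute)
      with \<delta> show "K * norm (C - mat 1) \<le> 1/2" by simp
    qed simp
    finally show "norm h \<le> 2 * norm (mat 1 :: real^'n^'n)" by simp
  qed
qed

section \<open>Riemann sums over integer matrices\<close>

definition int_matrices :: "(real^'n^'n) set" where
  "int_matrices = {A. \<forall>i j. A $ i $ j \<in> \<int>}"

lemma countable_int_matrices': "countable int_matrices"
  unfolding int_matrices_def by (rule countable_int_matrices)

definition floor_matrix :: "real^'n^'n \<Rightarrow> real^'n^'n" where
  "floor_matrix A = (\<chi> i j. of_int \<lfloor>A $ i $ j\<rfloor>)"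

lemma floor_matrix_int: "floor_matrix A \<in> int_matrices"
  by (simp add: floor_matrix_def int_matrices_def)

lemma measurable_floor_matrix [measurable]:
  "(floor_matrix :: real^'n^'n \<Rightarrow> _) \<in> borel_measurable borel"
  unfolding floor_matrix_def[abs_def] by measurable

lemma emeasure_floor_matrix_fibre:
  "emeasure lborel {A :: real^'n^'n. floor_matrix A = z} \<le> 1"
proof -
  have "{A :: real^'n^'n. floor_matrix A = z} \<subseteq> cbox z (z + One)"
  proof (clarsimp simp: mem_box)
    fix A b :: "real^'n^'n" assume b: "b \<in> Basis" and z: "z = floor_matrix A"
    from b obtain i j where bij: "b = axis i (axis j 1)" by (auto simp: Basis_vec_def)
    have "A \<bullet> b = A $ i $ j" "floor_matrix A \<bullet> b = of_int \<lfloor>A $ i $ j\<rfloor>"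
      by (auto simp: bij inner_axis floor_matrix_def)
    then show "floor_matrix A \<bullet> b \<le> A \<bullet> b \<and> A \<bullet> b \<le> (floor_matrix A + One) \<bullet> b"
      using b by (simp add: inner_add_left)
  qed
  then have "emeasure lborel {A :: real^'n^'n. floor_matrix A = z} \<le> emeasure lborel (cbox z (z + One))"
    by (intro emeasure_mono) auto
  also have "\<dots> = 1" by (subst emeasure_lborel_cbox) (auto simp: inner_add_left)
  finally show ?thesis .
qed

lemma floor_matrix_approx:
  "(\<lambda>s. (1 / real (Suc s)) *\<^sub>R floor_matrix (real (Suc s) *\<^sub>R A)) \<longlonglongrightarrow> (A :: real^'n^'n)"
proof (rule vec_tendstoI, rule vec_tendstoI)
  fix i j
  let ?f = "\<lambda>s. ((1 / real (Suc s)) *\<^sub>R floor_matrix (real (Suc s) *\<^sub>R A)) $ i $ j"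
  have f: "?f s = of_int \<lfloor>real (Suc s) * A $ i $ j\<rfloor> / real (Suc s)" for s
    by (simp add: floor_matrix_def)
  show "?f \<longlonglongrightarrow> A $ i $ j"
  proof (rule tendsto_sandwich)
    show "\<forall>\<^sub>F s in sequentially. A $ i $ j - 1 / real (Suc s) \<le> ?f s"
    proof (intro always_eventually allI)
      fix s
      have "real (Suc s) * A $ i $ j - 1 \<le> of_int \<lfloor>real (Suc s) * A $ i $ j\<rfloor>" by linarith
      then have "(real (Suc s) * A $ i $ j - 1) / real (Suc s) \<le> ?f s"
        unfolding f by (intro divide_right_mono) auto
      then show "A $ i $ j - 1 / real (Suc s) \<le> ?f s" by (simp add: diff_divide_distrib)
    qed
    show "\<forall>\<^sub>F s in sequentially. ?f s \<le> A $ i $ j"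
    proof (intro always_eventually allI)
      fix s
      have "of_int \<lfloor>real (Suc s) * A $ i $ j\<rfloor> / real (Suc s) \<le> real (Suc s) * A $ i $ j / real (Suc s)"
        by (intro divide_right_mono) auto
      then show "?f s \<le> A $ i $ j" unfolding f by simp
    qed
    show "(\<lambda>s. A $ i $ j - 1 / real (Suc s)) \<longlonglongrightarrow> A $ i $ j"
      using tendsto_diff[OF tendsto_const LIMSEQ_Suc[OF lim_1_over_n]] by simp
  qed simp
qed

text \<open>For fixed \<open>h\<close>, the integer matrices \<open>z\<close> with \<open>(z/s) h \<in> F\<close> lie in different orbits and have
  determinant \<open>O(s\<^sup>n)\<close>. Averaging their number over \<open>h\<close> near the identity gives a Riemann sum of mesh
  \<open>1/s\<close> for \<open>\<integral> G\<close>, and Fatou's lemma only needs \<open>G\<close> to be lower semicontinuous.\<close>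

lemma det_cone_finite_measure:
  fixes F0 :: "(real^'n^'n) set"
  assumes F0: "strict_fd F0"
  shows "emeasure lborel (det_cone F0) < \<infinity>"
proof -
  define F where "F = det_cone F0"
  have [measurable]: "F \<in> sets borel" using F0 by (auto simp: F_def strict_fd_def)
  obtain \<delta> R where \<delta>: "\<delta> > 0"
    "\<And>C :: real^'n^'n. C \<in> ball (mat 1) \<delta> \<Longrightarrow> 1/2 < det C \<and> det C < 2"
    "\<And>C h :: real^'n^'n. C \<in> ball (mat 1) \<delta> \<Longrightarrow> C ** h = mat 1 \<Longrightarrow> norm h \<le> R"
    using identity_neighbourhood[where 'n='n] by metis
  define Q' where "Q' = ball (mat 1 :: real^'n^'n) \<delta>"
  \<comment> \<open>\<open>Q\<close> contains the inverses of the elements of \<open>Q'\<close>: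
    their determinants exceed 1/2 because those in \<open>Q'\<close> are below 2.\<close>
  define Q where "Q = {h :: real^'n^'n. 1/2 < det h \<and> norm h \<le> R}"
  have [measurable]: "Q' \<in> sets borel" "Q \<in> sets borel" by (auto simp: Q'_def Q_def)
  have Q_fin: "emeasure lborel Q < \<infinity>"
  proof -
    have "emeasure lborel Q \<le> emeasure lborel (cball (0 :: real^'n^'n) R)"
      by (intro emeasure_mono) (auto simp: Q_def)
    then show ?thesis using emeasure_lborel_cball_finite[of "0 :: real^'n^'n" R] by (rule le_less_trans)
  qed
  \<comment> \<open>\<open>\<psi> B A\<close> tests whether B lies in \<open>F\<close> and A in B
    \<open>Q'\<close>. Integrating over A first gives at least vol(F) vol(Q'); integrating over B
    first gives \<open>G\<close>, which the lattice count controls.\<close>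
  define \<psi> :: "real^'n^'n \<Rightarrow> real^'n^'n \<Rightarrow> ennreal"
    where "\<psi> B A = indicator F B * indicator Q' (cramer_inv B ** A)" for B A
  have [measurable]: "(\<lambda>(B, A). \<psi> B A) \<in> borel_measurable (borel \<Otimes>\<^sub>M borel)"
    unfolding \<psi>_def by measurable
  define G where "G A = (\<integral>\<^sup>+B. \<psi> B A \<partial>lborel)" for A
  have [measurable]: "G \<in> borel_measurable borel" unfolding G_def by measurable
  have supp: "0 < det A \<and> det A < 4" if "\<psi> B A \<noteq> 0" for B A
  proof -
    have B: "B \<in> F" "cramer_inv B ** A \<in> Q'" using that by (auto simp: \<psi>_def indicator_def split: if_splits)
    then have dB: "1 \<le> det B" "det B \<le> 2" by (auto simp: F_def det_cone_def)
    let ?C = "cramer_inv B ** A"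
    have dC: "1/2 < det ?C" "det ?C < 2" using \<delta>(2) B by (auto simp: Q'_def)
    have "A = B ** ?C" using dB by (simp add: cramer_inv_cancel_left')
    then have eq: "det A = det B * det ?C" by (metis det_mul)
    have "det B * det ?C < 2 * 2" using dB dC by (intro mult_le_less_imp_less) auto
    then show ?thesis using eq dB dC by auto
  qed
  have G0: "G A = 0" if "\<not> (0 < det A \<and> det A < 4)" for A
  proof -
    have "\<psi> B A = 0" for B using supp[of B A] that by blast
    then show ?thesis by (simp add: G_def)
  qed
  \<comment> \<open>Substitute B = A h. Then h is the inverse of an element of \<open>Q'\<close>,
    hence lies in \<open>Q\<close>, and the Jacobian (det A)^n is below 4^n.\<close>
  have G_le: "G A \<le> 4 ^ CARD('n) * (\<integral>\<^sup>+h. indicator Q h * indicator F (A ** h) \<partial>lborel)"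
    if A: "0 < det A" "det A < 4" for A
  proof -
    have "G A = ennreal (det A ^ CARD('n)) * (\<integral>\<^sup>+h. \<psi> (A ** h) A \<partial>lborel)"
      unfolding G_def by (rule nn_integral_lborel_GL_left[OF A(1)]) measurable
    also have "\<dots> \<le> ennreal (4 ^ CARD('n)) * (\<integral>\<^sup>+h. indicator Q h * indicator F (A ** h) \<partial>lborel)"
    proof (intro mult_mono nn_integral_mono)
      show "ennreal (det A ^ CARD('n)) \<le> ennreal (4 ^ CARD('n))"
        using A by (intro ennreal_leI power_mono) auto
      fix h :: "real^'n^'n"
      show "\<psi> (A ** h) A \<le> indicator Q h * indicator F (A ** h)"
      proof (cases "A ** h \<in> F \<and> cramer_inv (A ** h) ** A \<in> Q'")
        case True
        let ?C = "cramer_inv (A ** h) ** A"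
        have "det (A ** h) \<noteq> 0" using True by (auto simp: F_def det_cone_def)
        then have "?C ** h = mat 1" by (simp add: cramer_inv_left flip: matrix_mul_assoc)
        moreover have C: "?C \<in> ball (mat 1) \<delta>" using True by (simp add: Q'_def)
        ultimately have "norm h \<le> R" "det ?C * det h = 1"
          using \<delta>(3)[OF C] by (auto simp flip: det_mul)
        moreover have "1/2 < det ?C" "det ?C < 2" using \<delta>(2)[OF C] by auto
        ultimately have "1/2 < det h"
        proof -
          have "det h = 1 / det ?C" using \<open>det ?C * det h = 1\<close> \<open>1/2 < det ?C\<close>
            by (simp add: field_simps)
          moreover have "1 / 2 < 1 / det ?C" using \<open>1/2 < det ?C\<close> \<open>det ?C < 2\<close> by (simp add: field_simps)
          ultimately show ?thesis by (simp only:)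
        qed
        with \<open>norm h \<le> R\<close> have "h \<in> Q" by (simp add: Q_def)
        then show ?thesis using True by (simp add: \<psi>_def)
      qed (auto simp: \<psi>_def indicator_def)
    qed auto
    finally show ?thesis by (simp add: ennreal_power flip: ennreal_numeral)
  qed
  \<comment> \<open>The factor 4^n is the Jacobian bound of \<open>G_le\<close>; 8^n = 2^n 4^n comes
    from counting orbits of determinant at most 4 s^n.\<close>
  define C where "C = 4 ^ CARD('n) * (8 ^ CARD('n) * emeasure lborel Q)"
  have C_fin: "C < \<infinity>"
    unfolding C_def using Q_fin by (auto simp: ennreal_mult_less_top power_less_top_ennreal)
  have sum_G: "(\<integral>\<^sup>+z. G ((1 / real s) *\<^sub>R z) \<partial>count_space int_matrices)
      \<le> C * ennreal (real s ^ (CARD('n) * CARD('n)))" if s: "s > 0" for s :: nat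
  proof -
    let ?N = "CARD('n) * CARD('n)"
    define P where "P = {z :: real^'n^'n. 0 < det z}"
    let ?I = "\<lambda>z h. indicator P z * (indicator Q h * indicator F (((1 / real s) *\<^sub>R z) ** h)) :: ennreal"
    have "(\<integral>\<^sup>+z. G ((1 / real s) *\<^sub>R z) \<partial>count_space int_matrices)
      \<le> (\<integral>\<^sup>+z. 4 ^ CARD('n) * (\<integral>\<^sup>+h. ?I z h \<partial>lborel)
        \<partial>count_space int_matrices)"
    proof (rule nn_integral_mono)
      fix z :: "real^'n^'n"
      let ?A = "(1 / real s) *\<^sub>R z"
      show "G ?A \<le> 4 ^ CARD('n) * (\<integral>\<^sup>+h. ?I z h \<partial>lborel)"
      proof (cases "0 < det ?A \<and> det ?A < 4")
        case True
        then have "z \<in> P" using s by (simp add: det_scaleR P_def zero_less_mult_iff)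
        then show ?thesis using G_le True by simp
      qed (simp add: G0)
    qed
    also have "\<dots> = 4 ^ CARD('n) * (\<integral>\<^sup>+z. (\<integral>\<^sup>+h. ?I z h \<partial>lborel)
        \<partial>count_space int_matrices)"
      by (rule nn_integral_cmult) simp
    also have "(\<integral>\<^sup>+z. (\<integral>\<^sup>+h. ?I z h \<partial>lborel)
        \<partial>count_space int_matrices)
      = (\<integral>\<^sup>+h. (\<integral>\<^sup>+z. ?I z h \<partial>count_space int_matrices) \<partial>lborel)"
      by (rule nn_integral_count_space_nn_integral[symmetric, OF countable_int_matrices']) measurable
    also have "\<dots> \<le> (\<integral>\<^sup>+h. ennreal (8 ^ CARD('n) * real s ^ ?N) * indicator Q h \<partial>lborel)"
    proof (rule nn_integral_mono)
      fix h :: "real^'n^'n"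
      show "(\<integral>\<^sup>+z. ?I z h \<partial>count_space int_matrices)
        \<le> ennreal (8 ^ CARD('n) * real s ^ ?N) * indicator Q h"
      proof (cases "h \<in> Q")
        case True
        define Z where "Z = {z \<in> int_matrices. z \<in> P \<and> ((1 / real s) *\<^sub>R z) ** h \<in> F}"
        have "finite Z \<and> card Z \<le> 2 ^ CARD('n) * (4 * s ^ CARD('n)) ^ CARD('n)"
        proof (rule card_SLZ_inequivalent)
          fix z :: "real^'n^'n" assume z: "z \<in> Z"
          then show "z $ i $ j \<in> \<int>" for i j by (simp add: Z_def int_matrices_def)
          have h: "1/2 < det h" using True by (simp add: Q_def)
          have "(1 / real s) ^ CARD('n) * det z * det h \<le> 2"
            using z by (simp add: Z_def F_def det_cone_def det_mul det_scaleR)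
          then have "det z * det h \<le> 2 * real s ^ CARD('n)"
            using s by (simp add: power_divide field_simps)
          moreover have "det z * (1/2) \<le> det z * det h"
            using z h by (intro mult_left_mono) (auto simp: Z_def P_def)
          ultimately have "det z \<le> 4 * real s ^ CARD('n)" by simp
          then show "0 < det z \<and> det z \<le> real (4 * s ^ CARD('n))"
            using z by (simp add: Z_def P_def)
          fix \<gamma> assume \<gamma>: "\<gamma> \<in> SLZ" "\<gamma> ** z \<in> Z"
          have "((1 / real s) *\<^sub>R (\<gamma> ** z)) ** h = \<gamma> ** (((1 / real s) *\<^sub>R z) ** h)"
            by (simp add: matrix_mult_scaleR_left matrix_mult_scaleR_right matrix_mul_assoc)
          then have "\<gamma> = mat 1"
            using det_cone_strict[OF F0, of "((1 / real s) *\<^sub>R z) ** h" \<gamma>] \<gamma> z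
            by (simp add: Z_def F_def)
          then show "\<gamma> ** z = z" by simp
        qed
        then have fin: "finite Z" and card: "card Z \<le> 2 ^ CARD('n) * (4 * s ^ CARD('n)) ^ CARD('n)" by auto
        have "(\<integral>\<^sup>+z. ?I z h \<partial>count_space int_matrices)
          = (\<integral>\<^sup>+z. indicator Z z \<partial>count_space int_matrices)"
          using True by (intro nn_integral_cong) (auto simp: Z_def indicator_def)
        also have "\<dots> = ennreal (real (card Z))"
        proof -
          have "Z \<subseteq> int_matrices" by (auto simp: Z_def)
          then show ?thesis using fin by (simp add: emeasure_count_space_finite ennreal_of_nat_eq_real_of_nat)
        qed
        also have "\<dots> \<le> ennreal (8 ^ CARD('n) * real s ^ ?N)"
        proof (rule ennreal_leI)
          have "2 ^ CARD('n) * (4 * s ^ CARD('n)) ^ CARD('n) = (2 * 4) ^ CARD('n) * s ^ ?N"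
            by (simp only: power_mult_distrib power_mult mult.assoc)
          with card have "card Z \<le> 8 ^ CARD('n) * s ^ ?N" by simp
          then have "real (card Z) \<le> real (8 ^ CARD('n) * s ^ ?N)" by (simp only: of_nat_le_iff)
          then show "real (card Z) \<le> 8 ^ CARD('n) * real s ^ ?N" by simp
        qed
        finally show ?thesis using True by simp
      qed simp
    qed
    also have "\<dots> = ennreal (8 ^ CARD('n) * real s ^ ?N) * emeasure lborel Q"
      by (subst nn_integral_cmult) auto
    also have "4 ^ CARD('n) * \<dots> = C * ennreal (real s ^ ?N)"
      by (simp add: C_def ennreal_mult mult.assoc mult.commute mult.left_commute ennreal_power flip: ennreal_numeral)
    finally show ?thesis by (simp add: mult_left_mono)
  qed
  define As where "As s A = (1 / real (Suc s)) *\<^sub>R floor_matrix (real (Suc s) *\<^sub>R A)" for s and A :: "real^'n^'n"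
  have [measurable]: "As s \<in> borel_measurable borel" for s unfolding As_def by measurable
  have int_G: "(\<integral>\<^sup>+A. G (As s A) \<partial>lborel) \<le> C" for s
  proof -
    let ?s = "real (Suc s)"
    let ?fib = "\<lambda>z. {A :: real^'n^'n. floor_matrix (?s *\<^sub>R A) = z}" and ?N = "CARD('n) * CARD('n)"
    define c where "c = ennreal (?s ^ ?N)"
    have c: "0 < c" "c < \<infinity>" by (auto simp: c_def)
    \<comment> \<open>A level set of the rounding fits in a cube of side 1/(s+1), so the integral of
      \<open>G\<close> after rounding is at most the normalised sum of \<open>G\<close> over grid
      points.\<close>
    have fib: "c * emeasure lborel (?fib z) \<le> 1" for z
    proof -
      have "(\<integral>\<^sup>+A. indicator {A. floor_matrix A = z} (?s *\<^sub>R A) \<partial>lborel) =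
        (\<integral>\<^sup>+A. indicator (?fib z) A \<partial>lborel)"
        by (intro nn_integral_cong) (simp add: indicator_def)
      also have "\<dots> = emeasure lborel (?fib z)"
        by (rule nn_integral_indicator) measurable
      finally have "c * emeasure lborel (?fib z) =
        c * (\<integral>\<^sup>+A. indicator {A. floor_matrix A = z} (?s *\<^sub>R A) \<partial>lborel)"
        by simp
      also have "\<dots> = (\<integral>\<^sup>+A. indicator {A :: real^'n^'n. floor_matrix A = z} A \<partial>lborel)"
        unfolding c_def using nn_integral_lborel_scaleR[of ?s "indicator {A :: real^'n^'n. floor_matrix A = z}"]
        by simp
      also have "\<dots> \<le> 1" using emeasure_floor_matrix_fibre[of z] by simp
      finally show ?thesis .
    qed
    have "(\<integral>\<^sup>+A. G (As s A) \<partial>lborel) =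
      (\<integral>\<^sup>+A. (\<integral>\<^sup>+z. G ((1 / ?s) *\<^sub>R z) * indicator (?fib z) A \<partial>count_space int_matrices) \<partial>lborel)"
    proof (rule nn_integral_cong)
      fix A :: "real^'n^'n"
      have "(\<integral>\<^sup>+z. G ((1 / ?s) *\<^sub>R z) * indicator (?fib z) A \<partial>count_space int_matrices) =
        (\<integral>\<^sup>+z. G ((1 / ?s) *\<^sub>R z) * indicator {floor_matrix (?s *\<^sub>R A)} z \<partial>count_space int_matrices)"
        by (intro nn_integral_cong) (auto simp: indicator_def)
      then show "G (As s A) = (\<integral>\<^sup>+z. G ((1 / ?s) *\<^sub>R z) * indicator (?fib z) A \<partial>count_space int_matrices)"
        by (simp add: As_def floor_matrix_int)
    qed
    also have "\<dots> = (\<integral>\<^sup>+z. (\<integral>\<^sup>+A. G ((1 / ?s) *\<^sub>R z) * indicator (?fib z) A \<partial>lborel) \<partial>count_space int_matrices)"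
      by (rule nn_integral_count_space_nn_integral[OF countable_int_matrices']) measurable
    also have "\<dots> = (\<integral>\<^sup>+z. G ((1 / ?s) *\<^sub>R z) * emeasure lborel (?fib z) \<partial>count_space int_matrices)"
      by (intro nn_integral_cong, subst nn_integral_cmult) auto
    finally have "c * (\<integral>\<^sup>+A. G (As s A) \<partial>lborel) =
      (\<integral>\<^sup>+z. c * (G ((1 / ?s) *\<^sub>R z) * emeasure lborel (?fib z)) \<partial>count_space int_matrices)"
      by (simp add: nn_integral_cmult)
    also have "\<dots> \<le> (\<integral>\<^sup>+z. G ((1 / ?s) *\<^sub>R z) \<partial>count_space int_matrices)"
    proof (rule nn_integral_mono)
      fix z :: "real^'n^'n"
      have "G ((1 / ?s) *\<^sub>R z) * (c * emeasure lborel (?fib z)) \<le> G ((1 / ?s) *\<^sub>R z) * 1"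
        by (intro mult_left_mono fib) auto
      then show "c * (G ((1 / ?s) *\<^sub>R z) * emeasure lborel (?fib z)) \<le> G ((1 / ?s) *\<^sub>R z)"
        by (simp add: mult.left_commute)
    qed
    also have "\<dots> \<le> c * C" using sum_G[of "Suc s"] by (simp add: c_def mult.commute)
    finally show ?thesis using c by (subst (asm) ennreal_mult_le_mult_iff) auto
  qed
  have "emeasure lborel F * emeasure lborel Q' = (\<integral>\<^sup>+B. indicator F B * emeasure lborel Q' \<partial>lborel)"
    by (simp add: nn_integral_multc)
  also have "\<dots> \<le> (\<integral>\<^sup>+B. (\<integral>\<^sup>+A. \<psi> B A \<partial>lborel) \<partial>lborel)"
  proof (rule nn_integral_mono)
    fix B :: "real^'n^'n"
    show "indicator F B * emeasure lborel Q' \<le> (\<integral>\<^sup>+A. \<psi> B A \<partial>lborel)"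
    proof (cases "B \<in> F")
      case True
      then have B: "1 \<le> det B" by (simp add: F_def det_cone_def)
      \<comment> \<open>As \<open>det B\<close> is at least 1, multiplication by \<open>B\<close>
        does not shrink the volume of \<open>Q'\<close>.\<close>
      then have d: "0 < det (cramer_inv B)" "det (cramer_inv B) \<le> 1" by (auto simp: det_cramer_inv)
      have "emeasure lborel Q' = ennreal (det (cramer_inv B) ^ CARD('n)) * (\<integral>\<^sup>+A. indicator Q' (cramer_inv B ** A) \<partial>lborel)"
        using nn_integral_lborel_GL_left[OF d(1), of "indicator Q'"] by simp
      also have "\<dots> \<le> 1 * (\<integral>\<^sup>+A. indicator Q' (cramer_inv B ** A) \<partial>lborel)"
        using d by (intro mult_right_mono) (auto simp: power_le_one)
      finally show ?thesis using True by (simp add: \<psi>_def)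
    qed simp
  qed
  also have "\<dots> = (\<integral>\<^sup>+A. G A \<partial>lborel)"
    unfolding G_def by (intro lborel_pair.Fubini') measurable
  also have "\<dots> \<le> (\<integral>\<^sup>+A. liminf (\<lambda>s. G (As s A)) \<partial>lborel)"
  proof (rule nn_integral_mono)
    fix A :: "real^'n^'n"
    have "G A \<le> (\<integral>\<^sup>+B. liminf (\<lambda>s. \<psi> B (As s A)) \<partial>lborel)"
      unfolding G_def
    proof (rule nn_integral_mono)
      fix B :: "real^'n^'n"
      \<comment> \<open>\<open>Q'\<close> is open, so once A is in B \<open>Q'\<close> its roundings
        are eventually there too. Fatou's lemma is then used in B and afterwards in A.\<close>
      have "eventually (\<lambda>s. \<psi> B A \<le> \<psi> B (As s A)) sequentially"
      proof (cases "cramer_inv B ** A \<in> Q'")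
        case True
        have "continuous_on UNIV (\<lambda>A. cramer_inv B ** A)" by (intro continuous_intros)
        then have "(\<lambda>s. cramer_inv B ** As s A) \<longlonglongrightarrow> cramer_inv B ** A"
          using floor_matrix_approx[of A] unfolding As_def
          by (intro continuous_on_tendsto_compose[of UNIV "\<lambda>A. cramer_inv B ** A"]) auto
        then have "eventually (\<lambda>s. cramer_inv B ** As s A \<in> Q') sequentially"
          by (rule topological_tendstoD) (use True in \<open>auto simp: Q'_def\<close>)
        then show ?thesis by (rule eventually_mono) (simp add: \<psi>_def True)
      qed (simp add: \<psi>_def)
      then show "\<psi> B A \<le> liminf (\<lambda>s. \<psi> B (As s A))" by (rule Liminf_bounded)
    qed
    also have "\<dots> \<le> liminf (\<lambda>s. G (As s A))"
      unfolding G_def by (rule nn_integral_liminf) measurable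
    finally show "G A \<le> liminf (\<lambda>s. G (As s A))" .
  qed
  also have "\<dots> \<le> liminf (\<lambda>s. \<integral>\<^sup>+A. G (As s A) \<partial>lborel)"
    by (rule nn_integral_liminf) measurable
  also have "\<dots> \<le> limsup (\<lambda>s. \<integral>\<^sup>+A. G (As s A) \<partial>lborel)"
    by (rule Liminf_le_Limsup) simp
  also have "\<dots> \<le> C" by (rule Limsup_bounded) (simp add: int_G)
  finally have le: "emeasure lborel F * emeasure lborel Q' \<le> C" .
  have "emeasure lborel Q' \<noteq> 0"
  proof
    assume "emeasure lborel Q' = 0"
    then have "Q' \<in> null_sets lborel" by (simp add: null_sets_def)
    then have "negligible Q'" by (simp add: negligible_iff_null_sets null_sets_completionI)
    then show False using \<delta>(1) open_not_negligible[of Q'] by (auto simp: Q'_def)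
  qed
  then have "emeasure lborel F \<noteq> \<infinity>"
    using le C_fin by (auto simp: ennreal_top_mult)
  then show ?thesis by (simp add: F_def less_top)
qed

section \<open>The invariant probability measure\<close>

lemma null_sets_mono:
  assumes "N \<in> null_sets M" "B \<subseteq> N" "B \<in> sets M"
  shows "B \<in> null_sets M"
  using assms emeasure_mono[of B N M] by (auto simp: null_sets_def)

definition fd :: "(real^'n^'n) set" where
  "fd = (SOME F. strict_fd F)"

lemma strict_fd_fd: "strict_fd (fd :: (real^'n^'n) set)"
  unfolding fd_def by (rule someI_ex) (rule strict_fd_exists)

lemma fd_borel [measurable]: "(fd :: (real^'n^'n) set) \<in> sets borel"
  using strict_fd_fd[where 'n='n] by (simp add: strict_fd_def)

definition shell :: "(real^'n^'n) set" where
  "shell = {A. 1 \<le> det A \<and> det A \<le> 2}"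

lemma shell_borel [measurable]: "shell \<in> sets borel"
  unfolding shell_def by measurable

lemma shell_mult_left: "g \<in> SLn \<Longrightarrow> g ** A \<in> shell \<longleftrightarrow> A \<in> shell"
  by (simp add: shell_def SLn_def det_mul)

lemma shell_mult_right: "g \<in> SLn \<Longrightarrow> A ** g \<in> shell \<longleftrightarrow> A \<in> shell"
  by (simp add: shell_def SLn_def det_mul)

lemma shell_det: "A \<in> shell \<Longrightarrow> 0 < det A"
  by (simp add: shell_def)

lemma det_cone_shell: "A \<in> det_cone F \<Longrightarrow> A \<in> shell"
  by (simp add: det_cone_def shell_def)

lemma shell_fd:
  assumes A: "A \<in> shell"
  shows "\<exists>!\<gamma>. \<gamma> \<in> SLZ \<and> \<gamma> ** A \<in> det_cone fd"
proof -
  have "\<gamma> ** A \<in> det_cone fd \<longleftrightarrow> \<gamma> ** det_normalize A \<in> fd" if "\<gamma> \<in> SLZ" for \<gamma>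
    using A that shell_det[OF A]
    by (simp add: det_cone_def shell_def det_normalize_mult_left SLZ_SLn det_mul SLZ_det)
  then show ?thesis
    using strict_fd_fd det_normalize_SLn[of A] unfolding strict_fd_def by metis
qed

definition proj :: "real^'n^'n \<Rightarrow> (real^'n^'n) set" where
  "proj A = coset (det_normalize A)"

lemma measurable_proj [measurable]: "(proj :: real^'n^'n \<Rightarrow> _) \<in> borel \<rightarrow>\<^sub>M Xmeas"
  unfolding proj_def[abs_def] by (rule measurable_coset) auto

lemma proj_Xspace [simp]: "proj A \<in> Xspace"
  by (simp add: proj_def coset_in_Xspace)

lemma proj_SLZ: "\<gamma> \<in> SLZ \<Longrightarrow> 0 < det A \<Longrightarrow> proj (\<gamma> ** A) = proj A"
  by (simp add: proj_def det_normalize_mult_left SLZ_SLn coset_mult_SLZ)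

lemma xact_proj: "h \<in> SLn \<Longrightarrow> 0 < det A \<Longrightarrow> xact (proj A) h = proj (A ** h)"
  by (simp add: proj_def det_normalize_mult_right xact_coset)

lemma xact_coset_normalize: "g \<in> SLn \<Longrightarrow> 0 < det A \<Longrightarrow> xact (coset g) (det_normalize A) = proj (g ** A)"
  by (simp add: proj_def det_normalize_mult_left xact_coset)

lemma borel_vimage_mult [measurable (raw)]:
  fixes B :: "(real^'n^'n) set"
  assumes [measurable]: "B \<in> sets borel"
  shows "{A. g ** A \<in> B} \<in> sets borel" "{A. A ** g \<in> B} \<in> sets borel"
  by measurable

lemma emeasure_lborel_SL_left:
  fixes B :: "(real^'n^'n) set"
  assumes "g \<in> SLn" and [measurable]: "B \<in> sets borel"
  shows "emeasure lborel {A. g ** A \<in> B} = emeasure lborel B"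
proof -
  have "emeasure lborel B = emeasure (distr lborel borel (\<lambda>A. g ** A)) B"
    using lborel_SL_left[of g] assms(1) by (simp add: SLn_def)
  also have "\<dots> = emeasure lborel ((\<lambda>A. g ** A) -` B \<inter> space lborel)"
    by (rule emeasure_distr) auto
  finally show ?thesis by (simp add: vimage_def)
qed

lemma emeasure_lborel_SL_right:
  fixes B :: "(real^'n^'n) set"
  assumes "g \<in> SLn" and [measurable]: "B \<in> sets borel"
  shows "emeasure lborel {A. A ** g \<in> B} = emeasure lborel B"
proof -
  have "emeasure lborel B = emeasure (distr lborel borel (\<lambda>A. A ** g)) B"
    using lborel_SL_right[of g] assms(1) by (simp add: SLn_def)
  also have "\<dots> = emeasure lborel ((\<lambda>A. A ** g) -` B \<inter> space lborel)"
    by (rule emeasure_distr) auto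
  finally show ?thesis by (simp add: vimage_def)
qed

lemma null_saturation:
  fixes B :: "(real^'n^'n) set"
  assumes B: "B \<in> sets borel" "emeasure lborel B = 0"
  shows "(\<Union>\<gamma>\<in>SLZ. {A. \<gamma> ** A \<in> B}) \<in> null_sets lborel"
proof (rule null_sets_UN')
  show "countable (SLZ :: (real^'n^'n) set)" by (rule countable_SLZ)
  fix \<gamma> :: "real^'n^'n" assume "\<gamma> \<in> SLZ"
  then show "{A. \<gamma> ** A \<in> B} \<in> null_sets lborel"
    using B emeasure_lborel_SL_left[of \<gamma> B] by (simp add: null_sets_def SLZ_SLn borel_vimage_mult)
qed

lemma shell_not_null: "emeasure lborel (shell :: (real^'n^'n) set) \<noteq> 0"
proof
  let ?U = "{A :: real^'n^'n. 1 < det A \<and> det A < 2}"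
  assume "emeasure lborel (shell :: (real^'n^'n) set) = 0"
  then have "shell \<in> null_sets (lborel :: (real^'n^'n) measure)" by (simp add: null_sets_def)
  then have "negligible (shell :: (real^'n^'n) set)"
    by (simp add: negligible_iff_null_sets null_sets_completionI)
  then have "negligible ?U" by (rule negligible_subset) (auto simp: shell_def)
  moreover have "open ?U"
    by (intro open_Collect_conj open_Collect_less continuous_intros)
  moreover have "root CARD('n) (3/2) *\<^sub>R mat 1 \<in> ?U" by (simp add: det_scaleR)
  ultimately show False using open_not_negligible by blast
qed

lemma det_cone_fd_not_null: "emeasure lborel (det_cone fd :: (real^'n^'n) set) \<noteq> 0"
proof
  assume *: "emeasure lborel (det_cone fd :: (real^'n^'n) set) = 0"
  have "(\<Union>\<gamma>\<in>SLZ. {A. \<gamma> ** A \<in> det_cone fd}) \<in> null_sets (lborel :: (real^'n^'n) measure)"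
    by (rule null_saturation) (use * in auto)
  moreover have "(shell :: (real^'n^'n) set) \<subseteq> (\<Union>\<gamma>\<in>SLZ. {A. \<gamma> ** A \<in> det_cone fd})"
    using shell_fd by blast
  ultimately have "shell \<in> null_sets (lborel :: (real^'n^'n) measure)"
    by (rule null_sets_mono) simp
  with shell_not_null show False by (auto simp: null_sets_def)
qed

lemma det_cone_fd_finite: "emeasure lborel (det_cone fd :: (real^'n^'n) set) \<noteq> \<infinity>"
  using det_cone_finite_measure[OF strict_fd_fd] by (simp add: less_top)

definition haarX :: "(real^'n^'n) set measure" where
  "haarX = distr (uniform_measure lborel (det_cone fd)) Xmeas proj"

lemma sets_haarX [simp, measurable_cong]: "sets haarX = sets Xmeas"
  by (simp add: haarX_def)

lemma space_haarX [simp]: "space haarX = Xspace"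
  using sets_eq_imp_space_eq[OF sets_haarX] by simp

lemma prob_space_haarX: "prob_space (haarX :: (real^'n^'n) set measure)"
  unfolding haarX_def
  by (intro prob_space.prob_space_distr prob_space_uniform_measure det_cone_fd_not_null det_cone_fd_finite) simp

lemma emeasure_haarX:
  fixes S :: "(real^'n^'n) set set"
  assumes S: "S \<in> sets Xmeas"
  shows "emeasure haarX S =
    emeasure lborel {A \<in> det_cone fd. proj A \<in> S} / emeasure lborel (det_cone fd :: (real^'n^'n) set)"
proof -
  have "proj -` S \<in> sets borel" using measurable_sets[OF measurable_proj S] by simp
  then show ?thesis
    unfolding haarX_def using S
    by (simp add: emeasure_distr emeasure_uniform_measure) (simp add: vimage_def Int_def)
qed

text \<open>Null sets can be tested on all of \<open>shell\<close>, since countably many translates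
  of the fundamental domain cover it. Unlike the domain, \<open>shell\<close> is invariant under
  left multiplication by \<open>SLn\<close>, which the Fubini arguments need.\<close>

lemma haarX_null_iff:
  fixes S :: "(real^'n^'n) set set"
  assumes S: "S \<in> sets Xmeas"
  shows "emeasure haarX S = 0 \<longleftrightarrow> {A \<in> shell. proj A \<in> S} \<in> null_sets lborel"
proof -
  note S [measurable]
  have b: "{A \<in> det_cone fd. proj A \<in> S} \<in> sets borel" "{A \<in> shell. proj A \<in> S} \<in> sets borel"
    by measurable
  have "emeasure haarX S = 0 \<longleftrightarrow> emeasure lborel {A \<in> det_cone fd. proj A \<in> S} = 0"
    using S det_cone_fd_finite[where 'n='n] by (simp add: emeasure_haarX ennreal_divide_eq_0_iff)
  also have "\<dots> \<longleftrightarrow> {A \<in> shell. proj A \<in> S} \<in> null_sets lborel"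
  proof
    assume "emeasure lborel {A \<in> det_cone fd. proj A \<in> S} = 0"
    then have "(\<Union>\<gamma>\<in>SLZ. {A. \<gamma> ** A \<in> {A \<in> det_cone fd. proj A \<in> S}}) \<in> null_sets lborel"
      using b by (intro null_saturation)
    moreover have "{A \<in> shell. proj A \<in> S} \<subseteq> (\<Union>\<gamma>\<in>SLZ. {A. \<gamma> ** A \<in> {A \<in> det_cone fd. proj A \<in> S}})"
    proof
      fix A assume A: "A \<in> {A \<in> shell. proj A \<in> S}"
      then obtain \<gamma> where "\<gamma> \<in> SLZ" "\<gamma> ** A \<in> det_cone fd" using shell_fd[of A] by auto
      then show "A \<in> (\<Union>\<gamma>\<in>SLZ. {A. \<gamma> ** A \<in> {A \<in> det_cone fd. proj A \<in> S}})"
        using A by (auto simp: proj_SLZ shell_det)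
    qed
    ultimately show "{A \<in> shell. proj A \<in> S} \<in> null_sets lborel"
      by (rule null_sets_mono) (use b in auto)
  next
    assume "{A \<in> shell. proj A \<in> S} \<in> null_sets lborel"
    then have "{A \<in> det_cone fd. proj A \<in> S} \<in> null_sets lborel"
      by (rule null_sets_mono) (use b det_cone_shell in auto)
    then show "emeasure lborel {A \<in> det_cone fd. proj A \<in> S} = 0" by auto
  qed
  finally show ?thesis .
qed

section \<open>Invariance under right translation\<close>

definition xpre :: "real^'n^'n \<Rightarrow> (real^'n^'n) set set \<Rightarrow> (real^'n^'n) set set" where
  "xpre h S = {x \<in> Xspace. xact x h \<in> S}"

lemma measurable_xact [measurable]:
  fixes h :: "real^'n^'n"
  assumes h: "h \<in> SLn"
  shows "(\<lambda>x. xact x h) \<in> Xmeas \<rightarrow>\<^sub>M Xmeas"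
proof (rule measurableI)
  fix x :: "(real^'n^'n) set" assume "x \<in> space Xmeas"
  then show "xact x h \<in> space Xmeas" using h by (auto simp: Xspace_def xact_coset SLn_mult)
next
  fix S :: "(real^'n^'n) set set" assume S: "S \<in> sets Xmeas"
  have "{g \<in> SLn. coset g \<in> (\<lambda>x. xact x h) -` S \<inter> space Xmeas} = SLn \<inter> {g. g ** h \<in> {g \<in> SLn. coset g \<in> S}}"
    using h by (auto simp: xact_coset coset_in_Xspace SLn_mult)
  also have "\<dots> \<in> sets borel" using S by (intro sets.Int borel_vimage_mult) (auto simp: sets_Xmeas)
  finally show "(\<lambda>x. xact x h) -` S \<inter> space Xmeas \<in> sets Xmeas"
    by (simp add: sets_Xmeas)
qed

lemma xpre_sets: "h \<in> SLn \<Longrightarrow> S \<in> sets Xmeas \<Longrightarrow> xpre h S \<in> sets Xmeas"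
  using measurable_sets[OF measurable_xact, of h S] by (simp add: xpre_def vimage_def Int_def conj_commute)

lemma xact_xact: "x \<in> Xspace \<Longrightarrow> xact (xact x g) h = xact x (g ** h)"
  by (auto simp: Xspace_def xact_coset matrix_mul_assoc)

lemma xact_one: "x \<in> Xspace \<Longrightarrow> xact x (mat 1) = x"
  by (auto simp: Xspace_def xact_coset)

lemma xact_Xspace: "x \<in> Xspace \<Longrightarrow> h \<in> SLn \<Longrightarrow> xact x h \<in> Xspace"
  by (auto simp: Xspace_def xact_coset SLn_mult)

lemma xpre_xpre: "g \<in> SLn \<Longrightarrow> xpre g (xpre h S) = xpre (g ** h) S"
  by (auto simp: xpre_def xact_xact xact_Xspace)

definition invariant_prob :: "(real^'n^'n) set measure \<Rightarrow> bool" where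
  "invariant_prob M \<longleftrightarrow> sets M = sets Xmeas \<and> prob_space M \<and>
     (\<forall>h\<in>SLn. \<forall>S\<in>sets Xmeas. emeasure M (xpre h S) = emeasure M S)"

text \<open>The image under translation by \<open>h\<close> is the preimage under translation by its
  inverse. This links preimages, which suit measurability, with the images in the description of
  \<open>muX\<close>.\<close>

lemma invariant_prob_iff:
  "invariant_prob M \<longleftrightarrow> sets M = sets Xmeas \<and> prob_space M \<and>
      (\<forall>h\<in>SLn. \<forall>S\<in>sets M. emeasure M ((\<lambda>x. xact x h) ` S) = emeasure M S)"
proof -
  have img: "(\<lambda>x. xact x h) ` S = xpre (cramer_inv h) S" if "h \<in> SLn" "S \<in> sets Xmeas" for h S
  proof -
    have sub: "S \<subseteq> Xspace" using that by (simp add: sets_Xmeas)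
    have 1: "xact (xact x h) (cramer_inv h) = x" "xact (xact x (cramer_inv h)) h = x" if "x \<in> Xspace" for x
      using that \<open>h \<in> SLn\<close> by (simp_all add: xact_xact cramer_inv_right cramer_inv_left SLn_det_nz xact_one)
    show ?thesis
    proof (intro equalityI subsetI)
      fix y assume "y \<in> (\<lambda>x. xact x h) ` S"
      then show "y \<in> xpre (cramer_inv h) S" using sub that 1 by (auto simp: xpre_def xact_Xspace subset_iff)
    next
      fix y assume "y \<in> xpre (cramer_inv h) S"
      then show "y \<in> (\<lambda>x. xact x h) ` S"
        using 1(2)[of y] by (auto simp: xpre_def intro!: image_eqI[of y _ "xact y (cramer_inv h)"])
    qed
  qed
  have inv2: "cramer_inv (cramer_inv h) = h" if "h \<in> SLn" for h
    using that by (intro cramer_inv_unique) (simp add: cramer_inv_left SLn_det_nz)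
  show ?thesis
    unfolding invariant_prob_def using img inv2 SLn_inv by metis
qed

text \<open>Right translation moves the fundamental domain to another one. Countably many pieces of
  the new domain are carried back to the old one by elements of \<open>SLZ\<close>, and all these
  moves preserve Lebesgue measure.\<close>

lemma haarX_invariant: "invariant_prob (haarX :: (real^'n^'n) set measure)"
  unfolding invariant_prob_def
proof (intro conjI ballI prob_space_haarX sets_haarX)
  fix h :: "real^'n^'n" and S :: "(real^'n^'n) set set" assume h: "h \<in> SLn" and S: "S \<in> sets Xmeas"
  let ?F = "det_cone fd :: (real^'n^'n) set"
  note S [measurable]
  define k where "k = cramer_inv h"
  have k: "k \<in> SLn" using h by (simp add: k_def SLn_inv)
  have hk: "A ** h ** k = A" "A ** k ** h = A" for A
    using h by (simp_all add: k_def cramer_inv_cancel_right cramer_inv_cancel_right' SLn_det_nz)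
  \<comment> \<open>\<open>X\<close> is the part over \<open>S\<close> of the translated domain F h,
    and \<open>Y \<gamma>\<close> is the part over \<open>S\<close> of F that
    \<open>\<gamma>\<close> carries into F h.\<close>
  define X where "X = {A. A ** k \<in> ?F \<and> proj A \<in> S}"
  have [measurable]: "X \<in> sets borel" unfolding X_def by measurable
  define Y where "Y \<gamma> = {A \<in> ?F. proj A \<in> S \<and> \<gamma> ** A ** k \<in> ?F}" for \<gamma>
  have [measurable]: "Y \<gamma> \<in> sets borel" for \<gamma> unfolding Y_def by measurable
  have disj: "disjoint_family_on (\<lambda>\<gamma>. {A \<in> E. \<gamma> ** A ** g \<in> ?F}) SLZ" if "g \<in> SLn" "E \<subseteq> shell" for E g
  proof -
    have "\<gamma> = \<gamma>'" if "A \<in> E" "\<gamma> \<in> SLZ" "\<gamma>' \<in> SLZ" "\<gamma> ** A ** g \<in> ?F" "\<gamma>' ** A ** g \<in> ?F" for A \<gamma> \<gamma>'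
    proof -
      have "A ** g \<in> shell" using that \<open>E \<subseteq> shell\<close> \<open>g \<in> SLn\<close> by (auto simp: shell_mult_right)
      then show ?thesis using shell_fd[of "A ** g"] that by (auto simp: matrix_mul_assoc)
    qed
    then show ?thesis unfolding disjoint_family_on_def by blast
  qed
  have cover: "E = (\<Union>\<gamma>\<in>SLZ. {A \<in> E. \<gamma> ** A ** g \<in> ?F})" if "g \<in> SLn" "E \<subseteq> shell" for E g
  proof -
    have "\<exists>\<gamma>\<in>SLZ. \<gamma> ** A ** g \<in> ?F" if "A \<in> E" for A
    proof -
      have "A ** g \<in> shell" using that \<open>E \<subseteq> shell\<close> \<open>g \<in> SLn\<close> by (auto simp: shell_mult_right)
      then show ?thesis using shell_fd[of "A ** g"] by (auto simp: matrix_mul_assoc)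
    qed
    then show ?thesis by blast
  qed
  have Xsh: "X \<subseteq> shell"
    using k det_cone_shell by (auto simp: X_def shell_mult_right dest: det_cone_shell)
  have "{A \<in> ?F. proj A \<in> xpre h S} = {A. A ** h \<in> X}"
    using h by (auto simp: X_def hk xpre_def xact_proj det_cone_detD)
  then have "emeasure lborel {A \<in> ?F. proj A \<in> xpre h S} = emeasure lborel X"
    using emeasure_lborel_SL_right[OF h, of X] by simp
  also have "\<dots> = emeasure lborel (\<Union>\<gamma>\<in>SLZ. {A \<in> X. \<gamma> ** A ** mat 1 \<in> ?F})"
    using cover[of "mat 1" X] Xsh by simp
  also have "\<dots> = (\<integral>\<^sup>+\<gamma>. emeasure lborel {A \<in> X. \<gamma> ** A ** mat 1 \<in> ?F} \<partial>count_space SLZ)"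
    by (rule emeasure_UN_countable) (use disj[of "mat 1" X] Xsh in \<open>auto simp: countable_SLZ\<close>)
  also have "\<dots> = (\<integral>\<^sup>+\<gamma>. emeasure lborel (Y (cramer_inv \<gamma>)) \<partial>count_space SLZ)"
  proof (rule nn_integral_cong)
    fix \<gamma> :: "real^'n^'n" assume "\<gamma> \<in> space (count_space SLZ)"
    then have \<gamma>: "\<gamma> \<in> SLZ" by simp
    have "{A \<in> X. \<gamma> ** A ** mat 1 \<in> ?F} = {A. \<gamma> ** A \<in> Y (cramer_inv \<gamma>)}"
    proof -
      have "cramer_inv \<gamma> ** (\<gamma> ** A) = A" for A :: "real^'n^'n" using \<gamma> by (simp add: cramer_inv_cancel_left SLZ_det)
      moreover have "proj (\<gamma> ** A) = proj A" if "\<gamma> ** A \<in> ?F" for A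
      proof (rule proj_SLZ[OF \<gamma>])
        show "0 < det A" using det_cone_detD[OF that] \<gamma> by (simp add: det_mul SLZ_det)
      qed
      ultimately show ?thesis by (auto simp: X_def Y_def)
    qed
    then show "emeasure lborel {A \<in> X. \<gamma> ** A ** mat 1 \<in> ?F} = emeasure lborel (Y (cramer_inv \<gamma>))"
      using emeasure_lborel_SL_left[OF SLZ_SLn[OF \<gamma>], of "Y (cramer_inv \<gamma>)"] by simp
  qed
  also have "\<dots> = (\<integral>\<^sup>+\<gamma>. emeasure lborel (Y \<gamma>) \<partial>count_space SLZ)"
  proof (rule nn_integral_bij_count_space[of cramer_inv])
    have "cramer_inv (cramer_inv \<gamma>) = \<gamma>" if "\<gamma> \<in> SLZ" for \<gamma>
      using that by (intro cramer_inv_unique) (simp add: cramer_inv_left SLZ_det)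
    then show "bij_betw cramer_inv SLZ SLZ"
      by (intro bij_betwI[of _ _ _ cramer_inv]) (auto simp: SLZ_inv)
  qed
  also have "\<dots> = emeasure lborel (\<Union>\<gamma>\<in>SLZ. Y \<gamma>)"
    by (rule emeasure_UN_countable[symmetric])
      (use disj[of k "{A \<in> ?F. proj A \<in> S}"] k det_cone_shell in \<open>auto simp: countable_SLZ Y_def conj_assoc\<close>)
  also have "(\<Union>\<gamma>\<in>SLZ. Y \<gamma>) = {A \<in> ?F. proj A \<in> S}"
    using cover[of k "{A \<in> ?F. proj A \<in> S}"] k det_cone_shell by (auto simp: Y_def)
  finally show "emeasure haarX (xpre h S) = emeasure haarX S"
    using h S by (simp add: emeasure_haarX xpre_sets)
qed

section \<open>Continuity and ergodicity of the action\<close>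

lemma invariant_probD:
  "invariant_prob M \<Longrightarrow> h \<in> SLn \<Longrightarrow> S \<in> sets Xmeas \<Longrightarrow> emeasure M (xpre h S) = emeasure M S"
  by (simp add: invariant_prob_def)

text \<open>Outer regularity encloses the lifted set T in an open U. A point A of T has A h in U
  once h is close to 1, while A h lies in U - T only on a set of the small measure of U - T, by
  right invariance.\<close>

lemma translate_diff_seq:
  fixes S :: "(real^'n^'n) set set"
  assumes S [measurable]: "S \<in> sets Xmeas"
    and h: "\<And>i. h i \<in> SLn" "h \<longlonglongrightarrow> mat 1"
  shows "(\<lambda>i. measure haarX (S - xpre (h i) S)) \<longlonglongrightarrow> 0"
proof -
  interpret prob_space "haarX :: (real^'n^'n) set measure" by (rule prob_space_haarX)
  let ?F = "det_cone fd :: (real^'n^'n) set"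
  define T where "T = {A \<in> ?F. proj A \<in> S}"
  have [measurable]: "T \<in> sets borel" unfolding T_def by measurable
  have T_fin: "emeasure lborel T < \<infinity>"
  proof -
    have "emeasure lborel T \<le> emeasure lborel ?F" by (intro emeasure_mono) (auto simp: T_def)
    then show ?thesis using det_cone_fd_finite[where 'n='n] by (auto simp: less_top top_unique)
  qed
  define c where "c = measure lborel ?F"
  have c: "emeasure lborel ?F = ennreal c" "c > 0"
    using det_cone_fd_finite[where 'n='n] det_cone_fd_not_null[where 'n='n]
    by (auto simp: c_def emeasure_eq_ennreal_measure measure_eq_emeasure_eq_ennreal zero_less_measure_iff)
  show ?thesis
  proof (rule LIMSEQ_I)
    fix \<epsilon> :: real assume \<epsilon>: "\<epsilon> > 0"
    \<comment> \<open>Two errors below \<open>\<eta>\<close> are added and then divided by the mass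
      \<open>c\<close> of the domain.\<close>
    define \<eta> where "\<eta> = \<epsilon> * c / 2"
    have \<eta>: "\<eta> > 0" using \<epsilon> c by (simp add: \<eta>_def)
    obtain U where U: "open U" "T \<subseteq> U" "emeasure lborel (U - T) < \<eta>"
      using outer_regular_lborel[of T \<eta>] \<eta> by auto
    have [measurable]: "U \<in> sets borel" using U by simp
    have lim: "(\<lambda>i. \<integral>\<^sup>+A. indicator {A \<in> T. A ** h i \<notin> U} A \<partial>lborel) \<longlonglongrightarrow> (\<integral>\<^sup>+A. 0 \<partial>(lborel :: (real^'n^'n) measure))"
    proof (rule nn_integral_dominated_convergence[where w="indicator T"])
      show "AE A in lborel. (\<lambda>i. indicator {A \<in> T. A ** h i \<notin> U} A :: ennreal) \<longlonglongrightarrow> 0"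
      proof (intro AE_I2)
        fix A :: "real^'n^'n"
        show "(\<lambda>i. indicator {A \<in> T. A ** h i \<notin> U} A :: ennreal) \<longlonglongrightarrow> 0"
        proof (cases "A \<in> T")
          case True
          have "continuous_on UNIV (\<lambda>g. A ** g)" by (intro continuous_intros)
          then have "(\<lambda>i. A ** h i) \<longlonglongrightarrow> A ** mat 1"
            by (rule continuous_on_tendsto_compose[OF _ h(2)]) auto
          then have "eventually (\<lambda>i. A ** h i \<in> U) sequentially"
            by (rule topological_tendstoD) (use True U in auto)
          then have "eventually (\<lambda>i. (0 :: ennreal) = indicator {A \<in> T. A ** h i \<notin> U} A) sequentially"
            by (rule eventually_mono) simp
          then show ?thesis by (rule Lim_transform_eventually[OF tendsto_const])
        qed simp
      qed
    qed (use T_fin in \<open>auto split: split_indicator\<close>)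
    have "eventually (\<lambda>i. (\<integral>\<^sup>+A. indicator {A \<in> T. A ** h i \<notin> U} A \<partial>lborel) < ennreal \<eta>) sequentially"
      by (rule order_tendstoD(2)[OF lim]) (use \<eta> in simp)
    then obtain n0 where n0: "\<And>i. i \<ge> n0 \<Longrightarrow> (\<integral>\<^sup>+A. indicator {A \<in> T. A ** h i \<notin> U} A \<partial>lborel) < ennreal \<eta>"
      by (auto simp: eventually_sequentially)
    show "\<exists>n0. \<forall>i\<ge>n0. norm (measure haarX (S - xpre (h i) S) - 0) < \<epsilon>"
    proof (intro exI allI impI)
      fix i assume i: "n0 \<le> i"
      have D: "S - xpre (h i) S \<in> sets Xmeas" using xpre_sets[OF h(1) S] S by auto
      have lt: "emeasure lborel {A \<in> T. A ** h i \<notin> U} < ennreal \<eta>" using n0[OF i] by simp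
      have "{A \<in> ?F. proj A \<in> S - xpre (h i) S} \<subseteq> {A \<in> T. A ** h i \<notin> U} \<union> {A. A ** h i \<in> U - T}"
      proof
        fix A assume A: "A \<in> {A \<in> ?F. proj A \<in> S - xpre (h i) S}"
        then have "proj (A ** h i) \<notin> S"
          using h(1)[of i] by (auto simp: xpre_def xact_proj det_cone_detD)
        then have "A ** h i \<notin> T" by (auto simp: T_def)
        then show "A \<in> {A \<in> T. A ** h i \<notin> U} \<union> {A. A ** h i \<in> U - T}"
          using A by (auto simp: T_def)
      qed
      then have "emeasure lborel {A \<in> ?F. proj A \<in> S - xpre (h i) S} \<le>
          emeasure lborel ({A \<in> T. A ** h i \<notin> U} \<union> {A. A ** h i \<in> U - T})"
        by (intro emeasure_mono) auto
      also have "\<dots> \<le> emeasure lborel {A \<in> T. A ** h i \<notin> U} + emeasure lborel {A. A ** h i \<in> U - T}"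
        by (intro emeasure_subadditive) auto
      also have "emeasure lborel {A. A ** h i \<in> U - T} = emeasure lborel (U - T)"
        by (rule emeasure_lborel_SL_right[OF h(1)]) simp
      also have "emeasure lborel {A \<in> T. A ** h i \<notin> U} + emeasure lborel (U - T) < ennreal \<eta> + ennreal \<eta>"
        using lt U(3) by (rule add_strict_mono)
      also have "ennreal \<eta> + ennreal \<eta> = ennreal (\<epsilon> * c)" using \<eta> by (simp add: \<eta>_def flip: ennreal_plus)
      finally have "emeasure lborel {A \<in> ?F. proj A \<in> S - xpre (h i) S} < ennreal (\<epsilon> * c)" .
      then obtain r where r: "emeasure lborel {A \<in> ?F. proj A \<in> S - xpre (h i) S} = ennreal r" "0 \<le> r" "r < \<epsilon> * c"
        by (cases "emeasure lborel {A \<in> ?F. proj A \<in> S - xpre (h i) S}") (auto simp: ennreal_less_iff)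
      have "emeasure haarX (S - xpre (h i) S) = ennreal (r / c)"
        unfolding emeasure_haarX[OF D] c(1) r(1) using c(2) r(2) by (simp add: divide_ennreal)
      also have "\<dots> < ennreal \<epsilon>" using c r \<epsilon> by (simp add: ennreal_less_iff field_simps)
      finally show "norm (measure haarX (S - xpre (h i) S) - 0) < \<epsilon>"
        using \<epsilon> by (simp add: emeasure_eq_measure ennreal_less_iff)
    qed
  qed
qed

text \<open>Sequential continuity at the identity gives continuity there and so the limit along any
  filter; the flow and the length function use a real parameter.\<close>

lemma translate_diff_tendsto:
  fixes S :: "(real^'n^'n) set set"
  assumes S: "S \<in> sets Xmeas" and h: "\<And>i. h i \<in> SLn" "(h \<longlongrightarrow> mat 1) F"
  shows "((\<lambda>i. measure haarX (S - xpre (h i) S)) \<longlongrightarrow> 0) F"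
proof -
  have one: "S - xpre (mat 1) S = {}" using S by (auto simp: xpre_def xact_one sets_Xmeas subset_iff)
  have "((\<lambda>g. measure haarX (S - xpre g S)) \<longlongrightarrow> measure haarX (S - xpre (mat 1) S)) (at (mat 1) within SLn)"
    using translate_diff_seq[OF S] by (auto simp: tendsto_at_iff_sequentially comp_def one)
  then have "continuous (at (mat 1) within SLn) (\<lambda>g. measure haarX (S - xpre g S))"
    by (simp add: continuous_within)
  then have "((\<lambda>i. measure haarX (S - xpre (h i) S)) \<longlongrightarrow> measure haarX (S - xpre (mat 1) S)) F"
    by (rule continuous_within_tendsto_compose[OF _ _ h(2)]) (use h(1) in auto)
  then show ?thesis by (simp add: one)
qed

section \<open>A Borel section and Fubini arguments\<close>

text \<open>A Borel section turns the action on cosets into matrix multiplication, which makes the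
  action jointly measurable.\<close>

definition fd_section :: "(real^'n^'n) set \<Rightarrow> real^'n^'n" where
  "fd_section x = (THE g. g \<in> x \<and> g \<in> fd)"

lemma fd_section_coset:
  assumes g: "g \<in> SLn" and \<gamma>: "\<gamma> \<in> SLZ" "\<gamma> ** g \<in> fd"
  shows "fd_section (coset g) = \<gamma> ** g"
  unfolding fd_section_def
proof (rule the_equality)
  show "\<gamma> ** g \<in> coset g \<and> \<gamma> ** g \<in> fd" using \<gamma> by (auto simp: coset_def)
  fix k assume k: "k \<in> coset g \<and> k \<in> fd"
  then obtain \<gamma>' where "\<gamma>' \<in> SLZ" "k = \<gamma>' ** g" by (auto simp: coset_def)
  then show "k = \<gamma> ** g" using k \<gamma> g strict_fd_fd unfolding strict_fd_def by blast
qed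

lemma fd_section:
  assumes "x \<in> Xspace"
  shows "fd_section x \<in> SLn" "coset (fd_section x) = x"
proof -
  obtain g where g: "g \<in> SLn" "x = coset g" using assms by (auto simp: Xspace_def)
  then obtain \<gamma> where \<gamma>: "\<gamma> \<in> SLZ" "\<gamma> ** g \<in> fd" using strict_fd_fd unfolding strict_fd_def by blast
  have *: "fd_section x = \<gamma> ** g" using fd_section_coset[OF g(1) \<gamma>] g by simp
  show "fd_section x \<in> SLn" "coset (fd_section x) = x"
    unfolding * using g \<gamma> by (auto simp: SLn_mult SLZ_SLn coset_mult_SLZ)
qed

lemma measurable_fd_section [measurable]:
  "(fd_section :: (real^'n^'n) set \<Rightarrow> _) \<in> Xmeas \<rightarrow>\<^sub>M borel"
proof (rule measurableI)
  fix B :: "(real^'n^'n) set" assume B [measurable]: "B \<in> sets borel"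
  have "{g \<in> SLn. coset g \<in> fd_section -` B \<inter> space Xmeas} = SLn \<inter> (\<Union>\<gamma>\<in>SLZ. {g. \<gamma> ** g \<in> fd \<inter> B})"
  proof (intro equalityI subsetI)
    fix g assume g: "g \<in> {g \<in> SLn. coset g \<in> fd_section -` B \<inter> space Xmeas}"
    then obtain \<gamma> where \<gamma>: "\<gamma> \<in> SLZ" "\<gamma> ** g \<in> fd" using strict_fd_fd unfolding strict_fd_def by blast
    then show "g \<in> SLn \<inter> (\<Union>\<gamma>\<in>SLZ. {g. \<gamma> ** g \<in> fd \<inter> B})"
      using g fd_section_coset[of g \<gamma>] by auto
  next
    fix g assume "g \<in> SLn \<inter> (\<Union>\<gamma>\<in>SLZ. {g. \<gamma> ** g \<in> fd \<inter> B})"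
    then show "g \<in> {g \<in> SLn. coset g \<in> fd_section -` B \<inter> space Xmeas}"
      using fd_section_coset[of g] by (auto simp: coset_in_Xspace)
  qed
  also have "\<dots> \<in> sets borel"
    by (intro sets.Int SLn_borel sets.countable_UN'' countable_SLZ borel_vimage_mult) auto
  finally show "fd_section -` B \<inter> space Xmeas \<in> sets Xmeas" by (simp add: sets_Xmeas)
qed simp

lemma measurable_joint_action:
  assumes M: "sets M = sets (Xmeas :: (real^'n^'n) set measure)"
  shows "(\<lambda>(A, x). xact x (det_normalize A)) \<in> borel \<Otimes>\<^sub>M M \<rightarrow>\<^sub>M Xmeas"
proof -
  note M [measurable_cong]
  have sp: "space M = Xspace" using sets_eq_imp_space_eq[OF M] by simp
  have "(\<lambda>z. coset (fd_section (snd z) ** det_normalize (fst z))) \<in> borel \<Otimes>\<^sub>M M \<rightarrow>\<^sub>M (Xmeas :: (real^'n^'n) set measure)"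
    by (rule measurable_coset) (auto simp: space_pair_measure sp SLn_mult fd_section)
  moreover have "coset (fd_section (snd z) ** det_normalize (fst z)) = (\<lambda>(A, x). xact x (det_normalize A)) z"
    if "z \<in> space (borel \<Otimes>\<^sub>M M)" for z
    using that fd_section(2)[of "snd z"] by (auto simp: space_pair_measure sp simp flip: xact_coset)
  ultimately show ?thesis by (subst measurable_cong) auto
qed

text \<open>Average the invariance of \<open>M\<close> over \<open>shell\<close> and exchange the
  integrals. For a fixed coset x of g, the matrices in \<open>shell\<close> that send x into
  \<open>S\<close> form a left translate of the lift of \<open>S\<close>, which is Lebesgue
  null.\<close>

lemma invariant_abs_continuous:
  fixes M :: "(real^'n^'n) set measure"
  assumes M: "invariant_prob M" and S: "S \<in> sets Xmeas" and null: "emeasure haarX S = 0"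
  shows "emeasure M S = 0"
proof -
  let ?L = "lborel :: (real^'n^'n) measure"
  have sets_M [measurable_cong]: "sets M = sets Xmeas" using M by (simp add: invariant_prob_def)
  have sp: "space M = Xspace" using sets_eq_imp_space_eq[OF sets_M] by simp
  interpret M: prob_space M using M by (simp add: invariant_prob_def)
  interpret pair_sigma_finite lborel M ..
  note [measurable] = measurable_joint_action[OF sets_M] S
  have "emeasure lborel (shell :: (real^'n^'n) set) * emeasure M S =
      (\<integral>\<^sup>+A. indicator shell A * emeasure M S \<partial>?L)"
    by (simp add: nn_integral_multc)
  also have "\<dots> = (\<integral>\<^sup>+A. (\<integral>\<^sup>+x. indicator shell A * indicator S (xact x (det_normalize A)) \<partial>M) \<partial>?L)"
  proof (rule nn_integral_cong)
    fix A :: "real^'n^'n"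
    have [measurable]: "xpre (det_normalize A) S \<in> sets M" using S by (simp add: sets_M xpre_sets)
    have "(\<integral>\<^sup>+x. indicator S (xact x (det_normalize A)) \<partial>M) = (\<integral>\<^sup>+x. indicator (xpre (det_normalize A) S) x \<partial>M)"
      by (intro nn_integral_cong) (auto simp: indicator_def xpre_def sp)
    also have "\<dots> = emeasure M (xpre (det_normalize A) S)" by (rule nn_integral_indicator) simp
    also have "\<dots> = emeasure M S" by (rule invariant_probD[OF M _ S]) simp
    finally show "indicator shell A * emeasure M S = (\<integral>\<^sup>+x. indicator shell A * indicator S (xact x (det_normalize A)) \<partial>M)"
      by (simp add: indicator_def)
  qed
  also have "\<dots> = (\<integral>\<^sup>+x. (\<integral>\<^sup>+A. indicator shell A * indicator S (xact x (det_normalize A)) \<partial>?L) \<partial>M)"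
    by (rule Fubini'[symmetric]) measurable
  also have "\<dots> = (\<integral>\<^sup>+x. 0 \<partial>M)"
  proof (rule nn_integral_cong)
    fix x assume "x \<in> space M"
    then obtain g where g: "g \<in> SLn" "x = coset g" by (auto simp: sp Xspace_def)
    let ?N = "{A \<in> shell. proj A \<in> S}"
    have N: "?N \<in> sets borel" "emeasure lborel ?N = 0" using haarX_null_iff[OF S] null by auto
    have "(\<integral>\<^sup>+A. indicator shell A * indicator S (xact x (det_normalize A)) \<partial>?L) =
      (\<integral>\<^sup>+A. indicator {A. g ** A \<in> ?N} A \<partial>lborel)"
      using g by (intro nn_integral_cong) (auto simp: indicator_def xact_coset_normalize shell_mult_left shell_det)
    also have "\<dots> = 0" using emeasure_lborel_SL_left[OF g(1) N(1)] N borel_vimage_mult(1)[OF N(1), of g] by simp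
    finally show "(\<integral>\<^sup>+A. indicator shell A * indicator S (xact x (det_normalize A)) \<partial>?L) = 0" .
  qed
  finally show ?thesis using shell_not_null[where 'n='n] by auto
qed

text \<open>For each \<open>h\<close> the set is invariant only up to a null set depending on
  \<open>h\<close>. Fubini yields one point x such that x and x A agree about membership in
  \<open>S\<close> for almost all A; as x A sweeps out the quotient, \<open>S\<close> is null or
  conull.\<close>

lemma haarX_ergodic:
  fixes S :: "(real^'n^'n) set set"
  assumes S: "S \<in> sets Xmeas" and inv: "\<And>h. h \<in> SLn \<Longrightarrow> measure haarX (S - xpre h S) = 0"
  shows "measure haarX S = 0 \<or> measure haarX (Xspace - S) = 0"
proof -
  let ?L = "lborel :: (real^'n^'n) measure"
  let ?M = "haarX :: (real^'n^'n) set measure"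
  interpret M: prob_space ?M by (rule prob_space_haarX)
  interpret pair_sigma_finite lborel ?M ..
  note [measurable] = measurable_joint_action[OF sets_haarX] S
  define D where "D A x \<longleftrightarrow> (x \<in> S) \<noteq> (xact x (det_normalize A) \<in> S)" for x and A :: "real^'n^'n"
  have [measurable]: "Measurable.pred (borel \<Otimes>\<^sub>M ?M) (\<lambda>(A, x). D A x)" unfolding D_def by measurable
  have D_null: "emeasure ?M {x \<in> Xspace. D A x} = 0" for A
  proof -
    let ?h = "det_normalize A"
    have P: "xpre ?h S \<in> sets Xmeas" using S by (simp add: xpre_sets)
    have e: "emeasure ?M (xpre ?h S) = emeasure ?M S"
      by (rule invariant_probD[OF haarX_invariant _ S]) simp
    have "measure ?M (xpre ?h S) = measure ?M S" using e by (simp add: measure_def)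
    \<comment> \<open>\<open>S\<close> and its translate have equal measure, so if one difference is
      null, so is the other.\<close>
    moreover have "measure ?M (S - xpre ?h S) = measure ?M S - measure ?M (S \<inter> xpre ?h S)"
      using S P by (intro M.finite_measure_Diff') auto
    moreover have "measure ?M (xpre ?h S - S) = measure ?M (xpre ?h S) - measure ?M (xpre ?h S \<inter> S)"
      using S P by (intro M.finite_measure_Diff') auto
    ultimately have "measure ?M (xpre ?h S - S) = 0" using inv[of ?h] by (simp add: Int_commute)
    then have "xpre ?h S - S \<in> null_sets ?M" "S - xpre ?h S \<in> null_sets ?M"
      using inv[of ?h] S P by (auto simp: null_sets_def M.emeasure_eq_measure)
    then have "(xpre ?h S - S) \<union> (S - xpre ?h S) \<in> null_sets ?M" by auto
    moreover have "{x \<in> Xspace. D A x} = (xpre ?h S - S) \<union> (S - xpre ?h S)"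
      using S by (auto simp: D_def xpre_def sets_Xmeas)
    ultimately show ?thesis by auto
  qed
  have "(\<integral>\<^sup>+x. (\<integral>\<^sup>+A. indicator shell A * of_bool (D A x) \<partial>?L) \<partial>?M) =
    (\<integral>\<^sup>+A. (\<integral>\<^sup>+x. indicator shell A * of_bool (D A x) \<partial>?M) \<partial>?L)"
    by (rule Fubini') measurable
  also have "\<dots> = (\<integral>\<^sup>+A. 0 \<partial>?L)"
  proof (rule nn_integral_cong)
    fix A :: "real^'n^'n"
    have Dm: "{x \<in> Xspace. D A x} \<in> sets ?M"
    proof -
      have "{x \<in> space ?M. D A x} \<in> sets ?M" by measurable
      then show ?thesis by simp
    qed
    have "(\<integral>\<^sup>+x. of_bool (D A x) \<partial>?M) = (\<integral>\<^sup>+x. indicator {x \<in> Xspace. D A x} x \<partial>?M)"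
      by (intro nn_integral_cong) (auto simp: indicator_def)
    also have "\<dots> = 0" using nn_integral_indicator[OF Dm] D_null[of A] by simp
    finally show "(\<integral>\<^sup>+x. indicator shell A * of_bool (D A x) \<partial>?M) = 0" by (simp add: indicator_def)
  qed
  finally have "(\<integral>\<^sup>+x. (\<integral>\<^sup>+A. indicator shell A * of_bool (D A x) \<partial>?L) \<partial>?M) = 0"
    by simp
  then have "AE x in ?M. (\<integral>\<^sup>+A. indicator shell A * of_bool (D A x) \<partial>?L) = 0"
    by (rule nn_integral_0_iff_AE[THEN iffD1, rotated]) measurable
  then obtain x where x: "x \<in> Xspace"
    "(\<integral>\<^sup>+A. indicator shell A * of_bool (D A x) \<partial>?L) = 0"
    using M.AE_contr by (metis (mono_tags, lifting) AE_mp AE_I2 space_haarX)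
  obtain g where g: "g \<in> SLn" "x = coset g" using x(1) by (auto simp: Xspace_def)
  define N where "N = {A \<in> shell. (x \<in> S) \<noteq> (proj A \<in> S)}"
  have [measurable]: "N \<in> sets borel" unfolding N_def by measurable
  have "emeasure lborel N = emeasure lborel {A. g ** A \<in> N}"
    by (rule emeasure_lborel_SL_left[OF g(1), symmetric]) simp
  also have "\<dots> = (\<integral>\<^sup>+A. indicator {A. g ** A \<in> N} A \<partial>lborel)" by simp
  also have "\<dots> = (\<integral>\<^sup>+A. indicator shell A * of_bool (D A x) \<partial>lborel)"
    using g by (intro nn_integral_cong) (auto simp: indicator_def N_def D_def xact_coset_normalize shell_mult_left shell_det)
  finally have N: "N \<in> null_sets lborel" using x(2) by (simp add: null_sets_def)
  show ?thesis
  proof (cases "x \<in> S")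
    case True
    have "Xspace - S \<in> sets Xmeas" using sets.compl_sets[OF S] by simp
    moreover have "{A \<in> shell. proj A \<in> Xspace - S} = N" using True by (auto simp: N_def)
    ultimately have "emeasure ?M (Xspace - S) = 0" using N haarX_null_iff[of "Xspace - S"] by simp
    then show ?thesis by (simp add: measure_def)
  next
    case False
    then have "{A \<in> shell. proj A \<in> S} = N" by (auto simp: N_def)
    then have "emeasure ?M S = 0" using N haarX_null_iff[OF S] by simp
    then show ?thesis by (simp add: measure_def)
  qed
qed

section \<open>The Mautner phenomenon\<close>

definition pair_diag :: "'n \<Rightarrow> 'n \<Rightarrow> real \<Rightarrow> real^'n^'n" where
  "pair_diag a b t = (\<chi> i j. if i = j then if i = a then t else if i = b then 1 / t else 1 else 0)"

lemma pair_diag_mult_nth: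
  "(pair_diag a b t ** A) $ i $ j = (if i = a then t else if i = b then 1 / t else 1) * A $ i $ j"
  unfolding matrix_matrix_mult_def pair_diag_def
  by (simp add: if_distrib[of "\<lambda>x. x * _"] cong: if_cong)

lemma pair_diag_SLn: "a \<noteq> b \<Longrightarrow> t \<noteq> 0 \<Longrightarrow> pair_diag a b t \<in> SLn"
proof -
  assume "a \<noteq> b" "t \<noteq> 0"
  have "det (pair_diag a b t) = (\<Prod>i\<in>UNIV. if i = a then t else if i = b then 1 / t else 1)"
    by (subst det_diagonal) (auto simp: pair_diag_def)
  also have "\<dots> = (\<Prod>i\<in>{a, b}. if i = a then t else if i = b then 1 / t else 1)"
    by (rule prod.mono_neutral_right) auto
  also have "\<dots> = 1" using \<open>a \<noteq> b\<close> \<open>t \<noteq> 0\<close> by simp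
  finally show ?thesis by (simp add: SLn_def)
qed

lemma transv_SLn: "a \<noteq> b \<Longrightarrow> transv a b s \<in> SLn"
  by (simp add: SLn_def det_transv)

text \<open>An identity in a copy of SL(2). The factors \<open>transv b a\<close> have entries e and
  -e t, which tend to 0 with e; the factors \<open>transv a b\<close> may blow up because they will
  be absorbed.\<close>

lemma pair_diag_decomp:
  assumes "a \<noteq> b" "t \<noteq> 0" "e \<noteq> 0"
  shows "pair_diag a b t =
    transv a b ((t - 1) / e) ** (transv b a e ** (transv a b ((1 / t - 1) / e) ** transv b a (- e * t)))"
  using assms
  by (auto simp: vec_eq_iff transv_mult_nth) (auto simp: transv_def pair_diag_def field_simps)

text \<open>With small t, this makes every \<open>transv b a x\<close> a diagonal conjugate of an
  element close to the identity.\<close>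

lemma transv_conj_pair_diag:
  assumes "a \<noteq> b" "t \<noteq> 0"
  shows "transv b a x = pair_diag a b t ** (transv b a (x * t^2) ** pair_diag a b (1 / t))"
  using assms
  by (auto simp: vec_eq_iff pair_diag_mult_nth transv_mult_nth)
    (auto simp: transv_def pair_diag_def field_simps power2_eq_square)

lemma transv_commutator:
  assumes "a \<noteq> b" "a \<noteq> c" "b \<noteq> c"
  shows "transv a b s = transv a c s ** (transv c b 1 ** (transv a c (- s) ** transv c b (- 1)))"
  using assms
  by (auto simp: vec_eq_iff transv_mult_nth) (auto simp: transv_def)

lemma tendsto_transv:
  assumes "(f \<longlongrightarrow> 0) F"
  shows "((\<lambda>i. transv a b (f i)) \<longlongrightarrow> mat 1) F"
proof (rule vec_tendstoI, rule vec_tendstoI)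
  fix i j
  have "((\<lambda>x. if i = a \<and> j = b then f x else 0) \<longlongrightarrow> 0) F"
    using assms by (cases "i = a \<and> j = b") auto
  then have "((\<lambda>x. (if i = j then 1 else 0) + (if i = a \<and> j = b then f x else 0)) \<longlongrightarrow>
      (if i = j then 1 else 0) + 0) F"
    by (intro tendsto_add tendsto_const)
  then show "((\<lambda>x. transv a b (f x) $ i $ j) \<longlongrightarrow> mat 1 $ i $ j) F"
    by (simp add: transv_def mat_def cong: if_cong)
qed

text \<open>The Mautner phenomenon for a length function: elements \<open>u\<close> with \<^term>\<open>N u = 0\<close> can be
  absorbed, and the diagonal element \<^term>\<open>pair_diag a b t\<close> is a product of such elements
  with elements arbitrarily close to the identity.\<close>

lemma length_function_vanishes:
  fixes N :: "real^('k::finite+'j::finite)^('k+'j) \<Rightarrow> real"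
  assumes nonneg: "\<And>g. 0 \<le> N g"
    and sub: "\<And>g h. g \<in> SLn \<Longrightarrow> h \<in> SLn \<Longrightarrow> N (g ** h) \<le> N g + N h"
    and cont: "\<And>h :: real \<Rightarrow> _. (\<And>i. h i \<in> SLn) \<Longrightarrow> (h \<longlongrightarrow> mat 1) at_top \<Longrightarrow> ((\<lambda>i. N (h i)) \<longlongrightarrow> 0) at_top"
    and U: "\<And>p q s. N (transv (Inl p) (Inr q) s) = 0"
    and g: "g \<in> SLn"
  shows "N g = 0"
proof -
  have small: "((\<lambda>i. N (transv a b (c * exp (- i)))) \<longlongrightarrow> 0) at_top" if "a \<noteq> b" for a b c
  proof -
    have "((\<lambda>i :: real. c * exp (- i)) \<longlongrightarrow> c * 0) at_top"
      by (intro tendsto_intros filterlim_compose[OF exp_at_bot] filterlim_uminus_at_bot_at_top)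
    then show ?thesis using that by (intro cont tendsto_transv) (auto simp: transv_SLn)
  qed
  have zeroI: "N g = 0" if "(f \<longlongrightarrow> 0) at_top" "\<And>i :: real. N g \<le> f i" for g f
  proof -
    have "N g \<le> 0" using that by (intro tendsto_lowerbound[OF that(1)]) auto
    with nonneg[of g] show ?thesis by simp
  qed
  have sub0: "N (u ** h) \<le> N h" if "N u = 0" "u \<in> SLn" "h \<in> SLn" for u h
    using sub[OF that(2,3)] that by simp
  \<comment> \<open>Of the four factors, the two in the block have \<open>N\<close> zero and are
    absorbed; the other two approach the identity as \<open>i\<close> grows.\<close>
  have diag: "N (pair_diag a b t) = 0" if ab: "a = Inl p" "b = Inr q" and t: "t \<noteq> 0" for a b p q t
  proof (rule zeroI)
    have ne: "a \<noteq> b" using ab by simp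
    show "((\<lambda>i. N (transv b a (1 * exp (- i))) + N (transv b a (- t * exp (- i)))) \<longlongrightarrow> 0) at_top"
      using tendsto_add[OF small[of b a 1] small[of b a "- t"]] ne by simp
    fix i :: real
    let ?e = "exp (- i)"
    let ?u = "transv a b ((t - 1) / ?e)" and ?u' = "transv a b ((1 / t - 1) / ?e)"
    have G: "transv a b s \<in> SLn" "transv b a s \<in> SLn" for s using ne by (auto simp: transv_SLn)
    have "N (?u ** (transv b a ?e ** (?u' ** transv b a (- ?e * t)))) \<le> N (transv b a ?e ** (?u' ** transv b a (- ?e * t)))"
      by (intro sub0 SLn_mult G) (simp add: ab U)
    also have "\<dots> \<le> N (transv b a ?e) + N (?u' ** transv b a (- ?e * t))"
      by (intro sub SLn_mult G)
    also have "N (?u' ** transv b a (- ?e * t)) \<le> N (transv b a (- ?e * t))"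
      by (intro sub0 G) (simp add: ab U)
    finally show "N (pair_diag a b t) \<le> N (transv b a (1 * ?e)) + N (transv b a (- t * ?e))"
      using pair_diag_decomp[OF ne t, of ?e] by (simp add: mult.commute)
  qed
  \<comment> \<open>Conjugation by a diagonal element, on which \<open>N\<close> vanishes, shrinks
    the entry to x exp(-i) without cost.\<close>
  have lower: "N (transv (Inr q) (Inl p) x) = 0" for p q x
  proof (rule zeroI)
    let ?a = "Inl p :: 'k + 'j" and ?b = "Inr q :: 'k + 'j"
    have "((\<lambda>i. N (transv ?b ?a (x * exp (- i)))) \<longlongrightarrow> 0) at_top" by (rule small) simp
    then show "((\<lambda>i. N (transv ?b ?a (x * exp (- i)))) \<longlongrightarrow> 0) at_top" .
    fix i :: real
    let ?t = "exp (- (i / 2))"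
    have t2: "?t^2 = exp (- i)" by (simp add: power2_eq_square flip: exp_add)
    have "N (transv ?b ?a x) = N (pair_diag ?a ?b ?t ** (transv ?b ?a (x * ?t^2) ** pair_diag ?a ?b (1 / ?t)))"
      using transv_conj_pair_diag[of ?a ?b ?t x] by simp
    also have "\<dots> \<le> N (transv ?b ?a (x * ?t^2) ** pair_diag ?a ?b (1 / ?t))"
      by (intro sub0 diag[OF refl refl] SLn_mult pair_diag_SLn transv_SLn) auto
    also have "\<dots> \<le> N (transv ?b ?a (x * ?t^2)) + N (pair_diag ?a ?b (1 / ?t))"
      by (intro sub pair_diag_SLn transv_SLn) auto
    also have "N (pair_diag ?a ?b (1 / ?t)) = 0" by (rule diag[OF refl refl]) simp
    finally show "N (transv ?b ?a x) \<le> N (transv ?b ?a (x * exp (- i)))" by (simp add: t2)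
  qed
  \<comment> \<open>Elements inside a diagonal block are commutators through an index
    \<open>c\<close> of the other block; \<open>undefined\<close> below stands for an arbitrary such
    index.\<close>
  have comm: "N (transv a b s) = 0"
    if "a \<noteq> b" "a \<noteq> c" "b \<noteq> c" and Z: "\<And>s. N (transv a c s) = 0" "\<And>s. N (transv c b s) = 0" for a b c s
  proof -
    have G: "transv a c s \<in> SLn" "transv c b s \<in> SLn" for s using that by (auto simp: transv_SLn)
    have "N (transv a b s) = N (transv a c s ** (transv c b 1 ** (transv a c (- s) ** transv c b (- 1))))"
      using transv_commutator[of a b c s] that by simp
    also have "\<dots> \<le> N (transv c b 1 ** (transv a c (- s) ** transv c b (- 1)))"
      by (intro sub0 SLn_mult G Z)
    also have "\<dots> \<le> N (transv a c (- s) ** transv c b (- 1))" by (intro sub0 SLn_mult G Z)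
    also have "\<dots> \<le> N (transv c b (- 1))" by (intro sub0 SLn_mult G Z)
    also have "\<dots> = 0" by (rule Z)
    finally show ?thesis using nonneg[of "transv a b s"] by simp
  qed
  have all: "N (transv a b s) = 0" if "a \<noteq> b" for a b s
  proof (cases a)
    case (Inl p)
    show ?thesis
    proof (cases b)
      case (Inl p')
      show ?thesis
        by (rule comm[of a b "Inr undefined"]) (use that \<open>a = Inl p\<close> Inl U lower in auto)
    qed (use \<open>a = Inl p\<close> U in simp)
  next
    case (Inr q)
    show ?thesis
    proof (cases b)
      case (Inr q')
      show ?thesis
        by (rule comm[of a b "Inl undefined"]) (use that \<open>a = Inr q\<close> Inr U lower in auto)
    qed (use \<open>a = Inr q\<close> lower in simp)
  qed
  have "det g = 1" using g by (simp add: SLn_def)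
  then show ?thesis
  proof (rule SL_induct)
    have "((\<lambda>i. N (transv (Inl undefined) (Inr undefined) (0 * exp (- i)))) \<longlongrightarrow> 0) at_top"
      by (rule small) simp
    then show "N (mat 1) = 0" by (rule zeroI) simp
  next
    fix A :: "real^('k+'j)^('k+'j)" and m n :: "'k + 'j" and c
    assume "det A = 1" "m \<noteq> n" "N A = 0"
    then have "N (transv m n c ** A) \<le> 0"
      using sub0[of "transv m n c" A] all[of m n c] transv_SLn[of m n c] by (simp add: SLn_def)
    then show "N (transv m n c ** A) = 0" using nonneg[of "transv m n c ** A"] by simp
  qed
qed

section \<open>The diagonal flow and the block that it contracts\<close>

definition flow :: "real \<Rightarrow> real^('k::finite+'j::finite)^('k+'j)" where
  "flow L = (\<chi> a b. if a = b then case a of Inl _ \<Rightarrow> L powr (- (real CARD('j) / real CARD('k))) | Inr _ \<Rightarrow> L else 0)"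

lemma flow_SLn:
  assumes "L > 0"
  shows "(flow L :: real^('k::finite+'j::finite)^('k+'j)) \<in> SLn"
proof -
  let ?d = "\<lambda>a :: 'k + 'j. case a of Inl _ \<Rightarrow> L powr (- (real CARD('j) / real CARD('k))) | Inr _ \<Rightarrow> L"
  have "det (flow L :: real^('k::finite+'j::finite)^('k+'j)) = (\<Prod>a\<in>UNIV. ?d a)"
    by (subst det_diagonal) (auto simp: flow_def)
  also have "\<dots> = (\<Prod>a\<in>UNIV <+> UNIV. ?d a)" by simp
  also have "\<dots> = (\<Prod>a\<in>(UNIV::'k set). ?d (Inl a)) * (\<Prod>a\<in>(UNIV::'j set). ?d (Inr a))"
    by (subst prod.Plus) auto
  also have "\<dots> = (L powr (- (real CARD('j) / real CARD('k)))) ^ CARD('k) * L ^ CARD('j)" by simp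
  also have "\<dots> = L powr (- real CARD('j)) * L powr real CARD('j)"
    using assms by (simp add: powr_powr powr_realpow flip: powr_realpow[of "L powr _"])
  also have "\<dots> = 1" using assms by (simp flip: powr_add)
  finally show ?thesis by (simp add: SLn_def)
qed

lemma flow_mult_nth:
  "((flow L :: real^('k::finite+'j::finite)^('k+'j)) ** A) $ a $ b =
    (case a of Inl _ \<Rightarrow> L powr (- (real CARD('j) / real CARD('k))) | Inr _ \<Rightarrow> L) * A $ a $ b"
  unfolding matrix_matrix_mult_def flow_def
  by (simp add: if_distrib[of "\<lambda>x. x * _"] cong: if_cong)

text \<open>Moving the flow past the element multiplies its entry by the ratio of two diagonal
  entries, L^(-(m+1)/k) / L, which tends to 0. This is the contraction used for mixing.\<close>

lemma flow_transv:
  assumes "L > 0"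
  shows "(flow L :: real^('k::finite+'j::finite)^('k+'j)) ** transv (Inl p) (Inr q) s =
    transv (Inl p) (Inr q) (s * (L powr (- (real CARD('j) / real CARD('k))) / L)) ** flow L"
  using assms
  by (auto simp: vec_eq_iff flow_mult_nth transv_mult_nth)
    (auto simp: transv_def flow_def split: sum.splits)

lemma flow_contraction:
  "((\<lambda>L. s * (L powr (- (real CARD('j::finite) / real CARD('k::finite))) / L)) \<longlongrightarrow> 0) at_top"
proof -
  have "((\<lambda>L. L powr (- (real CARD('j) / real CARD('k)))) \<longlongrightarrow> 0) at_top"
    by (rule tendsto_neg_powr) (auto intro!: filterlim_ident)
  moreover have "((\<lambda>L::real. inverse L) \<longlongrightarrow> 0) at_top" by (rule tendsto_inverse_0_at_top) (rule filterlim_ident)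
  ultimately have "((\<lambda>L. s * (L powr (- (real CARD('j) / real CARD('k))) * inverse L)) \<longlongrightarrow> s * (0 * 0)) at_top"
    by (intro tendsto_intros)
  then show ?thesis by (simp add: divide_inverse)
qed

section \<open>Unipotent-invariant limits\<close>

lemma strict_set_integral_le_imp_null:
  fixes f g :: "'a \<Rightarrow> ennreal"
  assumes [measurable]: "f \<in> borel_measurable M" "g \<in> borel_measurable M" "P \<in> sets M"
    and less: "\<And>x. x \<in> P \<Longrightarrow> f x < g x"
    and le: "(\<integral>\<^sup>+x. g x * indicator P x \<partial>M) \<le> (\<integral>\<^sup>+x. f x * indicator P x \<partial>M)"
    and fin: "(\<integral>\<^sup>+x. f x * indicator P x \<partial>M) < top"
  shows "emeasure M P = 0"
proof -
  have "(\<integral>\<^sup>+x. (g x * indicator P x - f x * indicator P x) \<partial>M) =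
      (\<integral>\<^sup>+x. g x * indicator P x \<partial>M) - (\<integral>\<^sup>+x. f x * indicator P x \<partial>M)"
    by (rule nn_integral_diff) (use fin less in \<open>auto simp: indicator_def less_imp_le\<close>)
  also have "\<dots> = 0"
    using le le_less_trans[OF le fin] by (simp add: diff_eq_0_iff_ennreal)
  finally have "AE x in M. g x * indicator P x - f x * indicator P x = 0"
    by (subst (asm) nn_integral_0_iff_AE) auto
  then have "AE x in M. x \<notin> P"
  proof (rule AE_mp, intro AE_I2 impI)
    fix x assume "g x * indicator P x - f x * indicator P x = 0"
    then show "x \<notin> P" using less[of x] by (auto simp: diff_eq_0_iff_ennreal indicator_def split: if_splits)
  qed
  then have "P \<in> null_sets M" by (subst AE_iff_null_sets) auto
  then show ?thesis by auto
qed

text \<open>Tychonoff's theorem. Applied to set functions, it supplies cluster points in the sense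
  of convergence on every set.\<close>

lemma compact_unit_functions: "compact {p :: 'a \<Rightarrow> real. \<forall>i. p i \<in> {0..1}}"
proof -
  have "compactin (product_topology (\<lambda>_. euclidean) (UNIV :: 'a set)) (PiE UNIV (\<lambda>_. {0..1::real}))"
    by (simp add: compactin_PiE)
  moreover have "PiE UNIV (\<lambda>_. {0..1::real}) = {p :: 'a \<Rightarrow> real. \<forall>i. p i \<in> {0..1}}"
    by (auto simp: PiE_def)
  ultimately show ?thesis by (metis compactin_euclidean_iff euclidean_product_topology)
qed

lemma xpre_Int: "xpre h (S \<inter> T) = xpre h S \<inter> xpre h T"
  and xpre_Un: "xpre h (S \<union> T) = xpre h S \<union> xpre h T"
  and xpre_Diff: "xpre h (S - T) = xpre h S - xpre h T"
  and xpre_mono: "S \<subseteq> T \<Longrightarrow> xpre h S \<subseteq> xpre h T"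
  by (auto simp: xpre_def)

lemma xpre_Xspace: "h \<in> SLn \<Longrightarrow> xpre h Xspace = Xspace"
  by (auto simp: xpre_def xact_Xspace)

lemma measure_haarX_xpre: "h \<in> SLn \<Longrightarrow> S \<in> sets Xmeas \<Longrightarrow> measure haarX (xpre h S) = measure haarX S"
  using invariant_probD[OF haarX_invariant, of h S] by (simp add: measure_def)

text \<open>\<open>measure haarX (S - xpre h S)\<close> is subadditive in \<open>h\<close>: what a
  product loses is lost by the first factor or, after translation, by the second. Vanishing on the
  block, it vanishes on the group, and ergodicity applies.\<close>

lemma unipotent_invariant_trivial:
  fixes S :: "(real^('k::finite+'j::finite)^('k+'j)) set set"
  assumes S: "S \<in> sets Xmeas"
    and U: "\<And>p q s. measure haarX (S - xpre (transv (Inl p) (Inr q) s) S) = 0"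
  shows "measure haarX S = 0 \<or> measure haarX (Xspace - S) = 0"
proof (rule haarX_ergodic[OF S])
  interpret prob_space "haarX :: (real^('k+'j)^('k+'j)) set measure" by (rule prob_space_haarX)
  fix h :: "real^('k+'j)^('k+'j)" assume h: "h \<in> SLn"
  show "measure haarX (S - xpre h S) = 0"
  proof (rule length_function_vanishes[of "\<lambda>h. measure haarX (S - xpre h S)", OF _ _ _ U h])
    fix g h :: "real^('k+'j)^('k+'j)" assume gh: "g \<in> SLn" "h \<in> SLn"
    have m: "S - xpre g S \<in> sets Xmeas" "S - xpre h S \<in> sets Xmeas" "xpre g (S - xpre h S) \<in> sets Xmeas"
      using gh S by (auto intro!: xpre_sets)
    have "measure haarX (S - xpre (g ** h) S) \<le> measure haarX ((S - xpre g S) \<union> xpre g (S - xpre h S))"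
      using gh m by (intro finite_measure_mono) (auto simp: xpre_Diff xpre_xpre)
    also have "\<dots> \<le> measure haarX (S - xpre g S) + measure haarX (xpre g (S - xpre h S))"
      using m by (intro measure_Un_le) auto
    also have "measure haarX (xpre g (S - xpre h S)) = measure haarX (S - xpre h S)"
      using gh m by (intro measure_haarX_xpre)
    finally show "measure haarX (S - xpre (g ** h) S) \<le> measure haarX (S - xpre g S) + measure haarX (S - xpre h S)" .
  qed (auto intro!: translate_diff_tendsto[OF S])
qed

text \<open>With \<open>b\<close> the total mass, the sets \<open>{f > b}\<close> and \<open>{f < b}\<close> of the density \<open>f\<close> are invariant: a unipotent
  element moves as much mass of \<open>f\<close> and of the constant \<open>b\<close> out of such a set as into it, although the
  inequality between \<open>f\<close> and \<open>b\<close> reverses across its boundary.\<close>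

lemma unipotent_invariant_measure:
  fixes Lam :: "(real^('k::finite+'j::finite)^('k+'j)) set measure"
  assumes sets_L: "sets Lam = sets Xmeas"
    and le: "\<And>S. S \<in> sets Xmeas \<Longrightarrow> emeasure Lam S \<le> emeasure haarX S"
    and inv: "\<And>p q s S. S \<in> sets Xmeas \<Longrightarrow> emeasure Lam (xpre (transv (Inl p) (Inr q) s) S) = emeasure Lam S"
    and S: "S \<in> sets Xmeas"
  shows "emeasure Lam S = emeasure Lam Xspace * emeasure haarX S"
proof -
  let ?M = "haarX :: (real^('k+'j)^('k+'j)) set measure"
  interpret M: prob_space ?M by (rule prob_space_haarX)
  have fin: "emeasure Lam T < \<infinity>" if "T \<in> sets Xmeas" for T
    using le[OF that] M.emeasure_finite[of T] by (metis infinity_ennreal_def le_less_trans less_top)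
  have "absolutely_continuous ?M Lam"
    unfolding absolutely_continuous_def using le sets_L by (auto simp: null_sets_def) (metis le_zero_eq)
  then obtain f where f [measurable]: "f \<in> borel_measurable ?M" and Lam: "density ?M f = Lam"
    using M.Radon_Nikodym[of Lam] sets_L by auto
  have em: "emeasure Lam T = (\<integral>\<^sup>+x. f x * indicator T x \<partial>?M)" if "T \<in> sets Xmeas" for T
    using that by (simp add: Lam[symmetric] emeasure_density)
  define b where "b = emeasure Lam Xspace"
  have Xs: "Xspace \<in> sets (Xmeas :: (real^('k+'j)^('k+'j)) set measure)" using sets.top[of Xmeas] by simp
  have b: "b < \<infinity>" unfolding b_def by (rule fin[OF Xs])
  \<comment> \<open>\<open>T\<close> and its translate have the same finite mass, so the parts
    outside their intersection have equal mass.\<close>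
  have flux: "measure ?M P = measure ?M Q \<and> emeasure Lam P = emeasure Lam Q"
    if T: "T \<in> sets Xmeas" and "P = T - xpre u T" "Q = xpre u T - T" "u = transv (Inl p) (Inr q) s" for T P Q u p q s
  proof -
    have u: "u \<in> SLn" using that by (simp add: transv_SLn)
    have uT: "xpre u T \<in> sets Xmeas" by (rule xpre_sets[OF u T])
    have 1: "emeasure N P = emeasure N Q" if "sets N = sets Xmeas" "emeasure N (xpre u T) = emeasure N T" "emeasure N T < \<infinity>" for N
    proof -
      have I: "T \<inter> xpre u T \<in> sets N" "T \<in> sets N" "xpre u T \<in> sets N" using that T uT by auto
      have "emeasure N (T \<inter> xpre u T) \<le> emeasure N T" using I by (intro emeasure_mono) auto
      then have F: "emeasure N (T \<inter> xpre u T) \<noteq> \<infinity>" using that(3) by auto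
      have "P = T - (T \<inter> xpre u T)" "Q = xpre u T - (T \<inter> xpre u T)"
        using \<open>P = _\<close> \<open>Q = _\<close> by auto
      then have "emeasure N P = emeasure N T - emeasure N (T \<inter> xpre u T)"
        "emeasure N Q = emeasure N (xpre u T) - emeasure N (T \<inter> xpre u T)"
        using emeasure_Diff[OF F I(2) I(1)] emeasure_Diff[OF F I(3) I(1)] by auto
      then show ?thesis using that by simp
    qed
    have "emeasure ?M P = emeasure ?M Q"
      by (intro 1 sets_haarX invariant_probD[OF haarX_invariant u T]) (simp add: M.emeasure_eq_measure)
    moreover have "emeasure Lam P = emeasure Lam Q"
      using fin[OF T] inv[OF T] that by (intro 1 sets_L) auto
    ultimately show ?thesis by (simp add: measure_def)
  qed
  \<comment> \<open>The properties shared by the density \<open>f\<close> and the constant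
    \<open>b\<close>, so that one argument treats both level sets.\<close>
  define balanced where "balanced \<phi> \<longleftrightarrow> \<phi> \<in> borel_measurable ?M \<and> (\<integral>\<^sup>+x. \<phi> x \<partial>?M) = b \<and>
    (\<forall>T\<in>sets Xmeas. \<forall>p q s. (\<integral>\<^sup>+x. \<phi> x * indicator (T - xpre (transv (Inl p) (Inr q) s) T) x \<partial>?M) =
      (\<integral>\<^sup>+x. \<phi> x * indicator (xpre (transv (Inl p) (Inr q) s) T - T) x \<partial>?M))" for \<phi>
  have diffs: "T - xpre (transv (Inl p) (Inr q) s) T \<in> sets Xmeas"
    "xpre (transv (Inl p) (Inr q) s) T - T \<in> sets Xmeas" if "T \<in> sets Xmeas"
    for T :: "(real^('k+'j)^('k+'j)) set set" and p q s
    using that by (auto intro!: xpre_sets simp: transv_SLn)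
  have bal_f: "balanced f"
    unfolding balanced_def
  proof (intro conjI ballI allI f)
    have "(\<integral>\<^sup>+x. f x \<partial>?M) = (\<integral>\<^sup>+x. f x * indicator Xspace x \<partial>?M)" by (intro nn_integral_cong) simp
    then show "(\<integral>\<^sup>+x. f x \<partial>?M) = b" using em[OF Xs] by (simp add: b_def)
    fix T p q s assume T: "T \<in> sets (Xmeas :: (real^('k+'j)^('k+'j)) set measure)"
    let ?u = "transv (Inl p) (Inr q) s :: real^('k+'j)^('k+'j)"
    show "(\<integral>\<^sup>+x. f x * indicator (T - xpre ?u T) x \<partial>?M) = (\<integral>\<^sup>+x. f x * indicator (xpre ?u T - T) x \<partial>?M)"
      using flux[OF T refl refl refl, of p q s] unfolding em[OF diffs(1)[OF T]] em[OF diffs(2)[OF T]] by blast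
  qed
  have bal_b: "balanced (\<lambda>_. b)"
    unfolding balanced_def
  proof (intro conjI ballI allI)
    show "(\<integral>\<^sup>+x. b \<partial>?M) = b" using M.emeasure_space_1 by simp
    fix T p q s assume T: "T \<in> sets (Xmeas :: (real^('k+'j)^('k+'j)) set measure)"
    let ?u = "transv (Inl p) (Inr q) s :: real^('k+'j)^('k+'j)"
    show "(\<integral>\<^sup>+x. b * indicator (T - xpre ?u T) x \<partial>?M) = (\<integral>\<^sup>+x. b * indicator (xpre ?u T - T) x \<partial>?M)"
      using flux[OF T refl refl refl, of p q s] diffs[OF T, of p q s]
      by (simp add: nn_integral_cmult_indicator M.emeasure_eq_measure)
  qed simp
  have null: "measure ?M {x \<in> Xspace. \<phi> x < \<psi> x} = 0" if bal: "balanced \<phi>" "balanced \<psi>" for \<phi> \<psi>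
  proof -
    have [measurable]: "\<phi> \<in> borel_measurable ?M" "\<psi> \<in> borel_measurable ?M" using bal by (auto simp: balanced_def)
    define T where "T = {x \<in> Xspace. \<phi> x < \<psi> x}"
    have "{x \<in> space ?M. \<phi> x < \<psi> x} \<in> sets ?M" by measurable
    then have T: "T \<in> sets Xmeas" by (simp add: T_def)
    have zero: "measure ?M P = 0"
      if "P \<subseteq> T" "P \<in> sets Xmeas" "(\<integral>\<^sup>+x. \<psi> x * indicator P x \<partial>?M) \<le> (\<integral>\<^sup>+x. \<phi> x * indicator P x \<partial>?M)" for P
    proof -
      have "(\<integral>\<^sup>+x. \<phi> x * indicator P x \<partial>?M) \<le> (\<integral>\<^sup>+x. \<phi> x \<partial>?M)"
        by (intro nn_integral_mono) (simp add: indicator_def)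
      also have "\<dots> < top" using bal b by (simp add: balanced_def)
      finally have "emeasure ?M P = 0"
        by (rule strict_set_integral_le_imp_null[rotated 5]) (use that in \<open>auto simp: T_def\<close>)
      then show ?thesis by (simp add: measure_def)
    qed
    have "measure ?M T = 0 \<or> measure ?M (Xspace - T) = 0"
    proof (rule unipotent_invariant_trivial[OF T])
      fix p q s
      let ?u = "transv (Inl p) (Inr q) s :: real^('k+'j)^('k+'j)"
      have fl: "(\<integral>\<^sup>+x. \<rho> x * indicator (T - xpre ?u T) x \<partial>?M) = (\<integral>\<^sup>+x. \<rho> x * indicator (xpre ?u T - T) x \<partial>?M)"
        if "balanced \<rho>" for \<rho>
        using that T unfolding balanced_def by blast
      show "measure ?M (T - xpre ?u T) = 0"
      \<comment> \<open>On the part leaving \<open>T\<close> one has \<phi> < \<psi>, on the part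
        entering it \<psi> \<le> \<phi>. Balance equates the two parts for each function, and so
        reverses the inequality of the integrals over the leaving part.\<close>
      proof (rule zero)
        have "(\<integral>\<^sup>+x. \<psi> x * indicator (T - xpre ?u T) x \<partial>?M) = (\<integral>\<^sup>+x. \<psi> x * indicator (xpre ?u T - T) x \<partial>?M)"
          by (rule fl[OF bal(2)])
        also have "\<dots> \<le> (\<integral>\<^sup>+x. \<phi> x * indicator (xpre ?u T - T) x \<partial>?M)"
          by (intro nn_integral_mono) (auto simp: indicator_def T_def xpre_def)
        also have "\<dots> = (\<integral>\<^sup>+x. \<phi> x * indicator (T - xpre ?u T) x \<partial>?M)"
          by (rule fl[OF bal(1), symmetric])
        finally show "(\<integral>\<^sup>+x. \<psi> x * indicator (T - xpre ?u T) x \<partial>?M) \<le> (\<integral>\<^sup>+x. \<phi> x * indicator (T - xpre ?u T) x \<partial>?M)" .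
      qed (use diffs[OF T] in auto)
    qed
    \<comment> \<open>On a conull \<open>T\<close> both functions have integral \<open>b\<close>,
      which the strict inequality allows only for a null set.\<close>
    moreover have "measure ?M T = 0" if z: "measure ?M (Xspace - T) = 0"
    proof (rule zero)
      have "Xspace - T \<in> null_sets ?M" using z T Xs by (auto simp: null_sets_def M.emeasure_eq_measure)
      from AE_not_in[OF this] have "AE x in ?M. x \<in> T" using AE_space[of ?M] by eventually_elim auto
      then have "(\<integral>\<^sup>+x. \<rho> x * indicator T x \<partial>?M) = (\<integral>\<^sup>+x. \<rho> x \<partial>?M)" for \<rho>
        by (intro nn_integral_cong_AE) auto
      then show "(\<integral>\<^sup>+x. \<psi> x * indicator T x \<partial>?M) \<le> (\<integral>\<^sup>+x. \<phi> x * indicator T x \<partial>?M)"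
        using bal by (simp add: balanced_def)
    qed (use T in auto)
    ultimately show ?thesis by (auto simp: T_def)
  qed
  have "AE x in ?M. f x = b"
  proof -
    have "{x \<in> space ?M. b < f x} \<in> sets ?M" "{x \<in> space ?M. f x < b} \<in> sets ?M" by measurable
    then have "AE x in ?M. \<not> b < f x" "AE x in ?M. \<not> f x < b"
      using null[OF bal_b bal_f] null[OF bal_f bal_b] AE_iff_measurable[of "{x \<in> Xspace. b < f x}" ?M "\<lambda>x. \<not> b < f x"]
        AE_iff_measurable[of "{x \<in> Xspace. f x < b}" ?M "\<lambda>x. \<not> f x < b"]
      by (simp_all add: M.emeasure_eq_measure)
    then show ?thesis by eventually_elim auto
  qed
  then have "(\<integral>\<^sup>+x. f x * indicator S x \<partial>?M) = (\<integral>\<^sup>+x. b * indicator S x \<partial>?M)"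
    by (intro nn_integral_cong_AE) auto
  also have "\<dots> = b * emeasure ?M S" using S by (subst nn_integral_cmult) auto
  finally show ?thesis using em[OF S] by (simp add: b_def)
qed

section \<open>Mixing and uniqueness\<close>

lemma mixing_sets:
  fixes B S :: "(real^('k::finite+'j::finite)^('k+'j)) set set"
  assumes B: "B \<in> sets Xmeas" and S: "S \<in> sets Xmeas"
  shows "((\<lambda>L. measure haarX (B \<inter> xpre (flow L) S)) \<longlongrightarrow> measure haarX B * measure haarX S) at_top"
proof (rule ccontr)
  let ?M = "haarX :: (real^('k+'j)^('k+'j)) set measure"
  interpret M: prob_space ?M by (rule prob_space_haarX)
  assume "\<not> ?thesis"
  then obtain e where e: "e > 0"
    "\<not> eventually (\<lambda>L. dist (measure ?M (B \<inter> xpre (flow L) S)) (measure ?M B * measure ?M S) < e) at_top"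
    unfolding tendsto_iff by blast
  \<comment> \<open>\<open>F0\<close> is the filter of parameters tending to infinity while the
    value stays at distance at least \<open>e\<close> from the claimed limit. It is proper because
    convergence fails.\<close>
  define bad where "bad = {L. \<not> dist (measure ?M (B \<inter> xpre (flow L) S)) (measure ?M B * measure ?M S) < e}"
  define F0 where "F0 = inf at_top (principal bad)"
  have F0: "F0 \<noteq> bot"
    using e(2) by (simp add: F0_def trivial_limit_def eventually_inf_principal bad_def)
  \<comment> \<open>The value 0 off the measurable sets makes \<open>P L\<close> a point of the cube
    over all sets.\<close>
  define P where "P L T = (if T \<in> sets Xmeas then measure ?M (B \<inter> xpre (flow L) T) else 0)" for L T
  have Pm: "P L T = measure ?M (B \<inter> xpre (flow L) T)" if "T \<in> sets Xmeas" for L T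
    using that by (simp add: P_def)
  have "eventually (\<lambda>p. p \<in> {p. \<forall>T. p T \<in> {0..1}}) (filtermap P F0)"
    by (simp add: eventually_filtermap P_def)
  moreover have "filtermap P F0 \<noteq> bot" using F0 by (simp add: filtermap_bot_iff)
  ultimately obtain p where p: "\<And>T. p T \<in> {0..1}" "inf (nhds p) (filtermap P F0) \<noteq> bot"
    using compact_unit_functions[unfolded compact_filter] by blast
  \<comment> \<open>A filter replaces a subsequence, since a cube with so many coordinates need not
    be sequentially compact.\<close>
  define H where "H = inf (nhds p) (filtermap P F0)"
  have H: "H \<noteq> bot" "H \<le> nhds p" "H \<le> filtermap P F0" using p(2) by (auto simp: H_def)
  have lim: "((\<lambda>q. q T) \<longlongrightarrow> p T) H" for T
  proof -
    have "((\<lambda>q. q) \<longlongrightarrow> p) H" using H(2) by (simp add: filterlim_def filtermap_ident)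
    then show ?thesis
      using continuous_on_tendsto_compose[OF continuous_on_product_coordinates[of T], of "\<lambda>q. q" p H] by simp
  qed
  have transfer: "eventually Q H" if "eventually (\<lambda>L. Q (P L)) at_top" for Q
  proof -
    have "eventually Q (filtermap P F0)"
      using that by (simp add: eventually_filtermap F0_def eventually_inf_principal eventually_mono)
    then show ?thesis using H(3) by (rule filter_leD[rotated])
  qed
  have pos: "eventually (\<lambda>L :: real. L > 0) at_top" by (rule eventually_gt_at_top)
  have p_le: "p T \<le> measure ?M T" if T: "T \<in> sets Xmeas" for T
  proof (rule tendsto_upperbound[OF lim _ H(1)])
    show "eventually (\<lambda>q. q T \<le> measure ?M T) H"
    proof (rule transfer, rule eventually_mono[OF pos])
      fix L :: real assume L: "L > 0"
      have f: "(flow L :: real^('k+'j)^('k+'j)) \<in> SLn" by (rule flow_SLn[OF L])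
      have "P L T \<le> measure ?M (xpre (flow L) T)"
        unfolding Pm[OF T] by (rule M.finite_measure_mono) (use xpre_sets[OF f T] in auto)
      also have "\<dots> = measure ?M T" by (rule measure_haarX_xpre[OF f T])
      finally show "P L T \<le> measure ?M T" .
    qed
  qed
  have p_eq: "p T1 = c" if "eventually (\<lambda>L. P L T1 = c) at_top" for T1 c
  proof (rule tendsto_unique[OF H(1) lim])
    show "((\<lambda>q. q T1) \<longlongrightarrow> c) H"
      by (rule tendsto_eventually) (rule transfer, rule that)
  qed
  have Xs: "Xspace \<in> sets (Xmeas :: (real^('k+'j)^('k+'j)) set measure)" using sets.top[of Xmeas] by simp
  have p_X: "p Xspace = measure ?M B"
  proof (rule p_eq, rule eventually_mono[OF pos])
    fix L :: real assume "L > 0"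
    then show "P L Xspace = measure ?M B"
      using B Pm[OF Xs] by (simp add: xpre_Xspace flow_SLn sets_Xmeas Int_absorb2)
  qed
  have p_add: "p (T1 \<union> T2) = p T1 + p T2" if T: "T1 \<in> sets Xmeas" "T2 \<in> sets Xmeas" "T1 \<inter> T2 = {}" for T1 T2
  proof (rule tendsto_unique[OF H(1) lim])
    have "eventually (\<lambda>q. q T1 + q T2 = q (T1 \<union> T2)) H"
    proof (rule transfer, rule eventually_mono[OF pos])
      fix L :: real assume L: "L > 0"
      have f: "(flow L :: real^('k+'j)^('k+'j)) \<in> SLn" by (rule flow_SLn[OF L])
      have "B \<inter> xpre (flow L) (T1 \<union> T2) = (B \<inter> xpre (flow L) T1) \<union> (B \<inter> xpre (flow L) T2)"
        by (auto simp: xpre_Un)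
      moreover have "(B \<inter> xpre (flow L) T1) \<inter> (B \<inter> xpre (flow L) T2) = {}" using T(3) by (auto simp: xpre_def)
      ultimately show "P L T1 + P L T2 = P L (T1 \<union> T2)"
        using T B xpre_sets[OF f] by (simp add: Pm M.finite_measure_Union)
    qed
    then show "((\<lambda>q. q (T1 \<union> T2)) \<longlongrightarrow> p T1 + p T2) H"
      by (rule Lim_transform_eventually[OF tendsto_add[OF lim lim]])
  qed
  have p_inv: "p (xpre (transv (Inl i) (Inr j) s) T) = p T" if T: "T \<in> sets Xmeas" for i j s T
  proof -
    define u where "u = (transv (Inl i) (Inr j) s :: real^('k+'j)^('k+'j))"
    \<comment> \<open>\<open>v L\<close> inverts the conjugate of \<open>u\<close> by the flow, so
      it tends to the identity. Translating \<open>T\<close> by \<open>u\<close> then amounts to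
      translating \<open>B\<close> by \<open>v L\<close>, at a cost of at most
      \<open>measure ?M (B - xpre (v L) B)\<close>.\<close>
    define v where "v L = (transv (Inl i) (Inr j) (- s * (L powr (- (real CARD('j) / real CARD('k))) / L)) :: real^('k+'j)^('k+'j))" for L
    have u: "u \<in> SLn" by (simp add: u_def transv_SLn)
    have v: "v L \<in> SLn" for L by (simp add: v_def transv_SLn)
    have uT: "xpre u T \<in> sets Xmeas" by (rule xpre_sets[OF u T])
    have vl: "(v \<longlongrightarrow> mat 1) at_top"
      unfolding v_def by (intro tendsto_transv flow_contraction)
    have bound: "\<bar>P L (xpre u T) - P L T\<bar> \<le> measure ?M (B - xpre (v L) B)" if L: "L > 0" for L
    proof -
      have f: "(flow L :: real^('k+'j)^('k+'j)) \<in> SLn" by (rule flow_SLn[OF L])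
      define Z where "Z = xpre (flow L) T"
      have Z: "Z \<in> sets Xmeas" unfolding Z_def by (rule xpre_sets[OF f T])
      have vB: "xpre (v L) B \<in> sets Xmeas" by (rule xpre_sets[OF v B])
      have "v L ** (flow L ** u) = flow L"
        unfolding u_def v_def flow_transv[OF L] by (simp add: matrix_mul_assoc transv_add)
      then have e1: "xpre (v L) (xpre (flow L) (xpre u T)) = Z"
        using f v by (simp add: Z_def xpre_xpre SLn_mult)
      have "P L (xpre u T) = measure ?M (xpre (v L) (B \<inter> xpre (flow L) (xpre u T)))"
        using B uT f v by (simp add: Pm measure_haarX_xpre xpre_sets sets.Int)
      also have "\<dots> = measure ?M (xpre (v L) B \<inter> Z)" by (simp add: xpre_Int e1)
      finally have 1: "P L (xpre u T) = measure ?M (xpre (v L) B \<inter> Z)" .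
      have 2: "P L T = measure ?M (B \<inter> Z)" by (simp add: Pm T Z_def)
      have d: "measure ?M (xpre (v L) B - B) = measure ?M (B - xpre (v L) B)"
        using B vB measure_haarX_xpre[OF v B, of L]
        by (simp add: M.finite_measure_Diff' Int_commute)
      have "measure ?M (B \<inter> Z) \<le> measure ?M ((xpre (v L) B \<inter> Z) \<union> (B - xpre (v L) B))"
        using B Z vB by (intro M.finite_measure_mono) auto
      also have "\<dots> \<le> measure ?M (xpre (v L) B \<inter> Z) + measure ?M (B - xpre (v L) B)"
        using B Z vB by (intro measure_Un_le) auto
      finally have 3: "measure ?M (B \<inter> Z) \<le> measure ?M (xpre (v L) B \<inter> Z) + measure ?M (B - xpre (v L) B)" .
      have "measure ?M (xpre (v L) B \<inter> Z) \<le> measure ?M ((B \<inter> Z) \<union> (xpre (v L) B - B))"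
        using B Z vB by (intro M.finite_measure_mono) auto
      also have "\<dots> \<le> measure ?M (B \<inter> Z) + measure ?M (xpre (v L) B - B)"
        using B Z vB by (intro measure_Un_le) auto
      finally show ?thesis using 1 2 3 d by simp
    qed
    have "((\<lambda>L. P L (xpre u T) - P L T) \<longlongrightarrow> 0) at_top"
    proof (rule Lim_null_comparison)
      show "eventually (\<lambda>L. norm (P L (xpre u T) - P L T) \<le> measure ?M (B - xpre (v L) B)) at_top"
        by (rule eventually_mono[OF pos]) (simp add: bound)
      show "((\<lambda>L. measure ?M (B - xpre (v L) B)) \<longlongrightarrow> 0) at_top"
        by (rule translate_diff_tendsto[OF B v vl])
    qed
    then have "((\<lambda>q. q (xpre u T) - q T) \<longlongrightarrow> 0) H"
      unfolding tendsto_iff by (auto intro: transfer)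
    moreover have "((\<lambda>q. q (xpre u T) - q T) \<longlongrightarrow> p (xpre u T) - p T) H" by (intro tendsto_diff lim)
    ultimately have "p (xpre u T) - p T = 0" using tendsto_unique[OF H(1)] by blast
    then show ?thesis by (simp add: u_def)
  qed
  define Lam where "Lam = measure_of Xspace (sets Xmeas) (\<lambda>T. ennreal (p T))"
  have sets_L: "sets Lam = sets Xmeas"
    unfolding Lam_def using sets.sets_measure_of_eq[of Xmeas] by simp
  have p0: "p {} = 0" using p_le[of "{}"] p(1)[of "{}"] by auto
  have em: "emeasure Lam T = ennreal (p T)" if "T \<in> sets Xmeas" for T
    unfolding Lam_def
  proof (rule emeasure_measure_of_sigma)
    show "sigma_algebra Xspace (sets (Xmeas :: (real^('k+'j)^('k+'j)) set measure))"
      using sets.sigma_algebra_axioms[of Xmeas] by simp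
    show pos: "positive (sets Xmeas) (\<lambda>T. ennreal (p T))" by (simp add: positive_def p0)
    show "countably_additive (sets Xmeas) (\<lambda>T. ennreal (p T))"
    \<comment> \<open>Finite additivity passes to the limit, countable additivity need not. It
      follows from continuity at the empty set, which domination by \<open>haarX\<close>
      provides.\<close>
    proof (rule sets.empty_continuous_imp_countably_additive[OF pos])
      show "additive (sets Xmeas) (\<lambda>T. ennreal (p T))"
        using p(1) by (auto simp: additive_def p_add ennreal_plus)
      show "\<forall>A\<in>sets Xmeas. ennreal (p A) \<noteq> \<infinity>" by simp
      fix A :: "nat \<Rightarrow> (real^('k+'j)^('k+'j)) set set"
      assume A: "range A \<subseteq> sets Xmeas" "decseq A" "(\<Inter>i. A i) = {}"
      have "(\<lambda>i. measure ?M (A i)) \<longlonglongrightarrow> measure ?M (\<Inter>i. A i)"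
        using A by (intro M.finite_Lim_measure_decseq) auto
      then have "(\<lambda>i. measure ?M (A i)) \<longlonglongrightarrow> 0" using A by simp
      then have "(\<lambda>i. p (A i)) \<longlonglongrightarrow> 0"
        by (rule Lim_null_comparison[rotated]) (use A p_le p(1) in \<open>auto intro!: always_eventually\<close>)
      then have "(\<lambda>i. ennreal (p (A i))) \<longlonglongrightarrow> ennreal 0" by (rule tendsto_ennrealI)
      then show "(\<lambda>i. ennreal (p (A i))) \<longlonglongrightarrow> 0" by simp
    qed
  qed fact
  have "emeasure Lam S = emeasure Lam Xspace * emeasure ?M S"
  proof (rule unipotent_invariant_measure[OF sets_L _ _ S])
    show "emeasure Lam T \<le> emeasure ?M T" if "T \<in> sets Xmeas" for T
      using p_le[OF that] by (simp add: em that M.emeasure_eq_measure ennreal_leI)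
    show "emeasure Lam (xpre (transv (Inl i) (Inr j) s) T) = emeasure Lam T" if "T \<in> sets Xmeas" for i j s T
      using that p_inv[OF that] by (simp add: em xpre_sets transv_SLn)
  qed
  then have "ennreal (p S) = ennreal (measure ?M B * measure ?M S)"
    by (simp add: em S Xs p_X M.emeasure_eq_measure ennreal_mult)
  then have pS: "p S = measure ?M B * measure ?M S" using p(1)[of S] by simp
  \<comment> \<open>Along \<open>H\<close> the value at \<open>S\<close> converges to the claimed
    limit, although every bad parameter stays \<open>e\<close> away from it.\<close>
  have "eventually (\<lambda>L. \<not> dist (P L S) (measure ?M B * measure ?M S) < e) F0"
    by (simp add: F0_def eventually_inf_principal Pm S bad_def)
  then have "eventually (\<lambda>q. \<not> dist (q S) (measure ?M B * measure ?M S) < e) (filtermap P F0)"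
    by (simp add: eventually_filtermap)
  then have 1: "eventually (\<lambda>q. \<not> dist (q S) (measure ?M B * measure ?M S) < e) H"
    using H(3) by (rule filter_leD[rotated])
  have 2: "eventually (\<lambda>q. dist (q S) (measure ?M B * measure ?M S) < e) H"
    using lim[of S] e(1) unfolding tendsto_iff pS by blast
  have "eventually (\<lambda>q. False) H" using 1 2 by eventually_elim simp
  with H(1) show False by (simp add: trivial_limit_def)
qed

section \<open>Mixing for absolutely continuous measures\<close>

text \<open>Linearity reduces this to \<open>mixing_sets\<close> on the level sets. Values are
  finite because multiplication by infinity is discontinuous at 0.\<close>

lemma mixing_simple_function:
  fixes S :: "(real^('k::finite+'j::finite)^('k+'j)) set set"
  assumes S: "S \<in> sets Xmeas" and u: "simple_function haarX u" "\<And>x. x \<in> Xspace \<Longrightarrow> u x < top"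
  shows "((\<lambda>L. \<integral>\<^sup>+x. u x * indicator (xpre (flow L) S) x \<partial>haarX) \<longlongrightarrow> (\<integral>\<^sup>+x. u x \<partial>haarX) * emeasure haarX S) at_top"
proof -
  let ?M = "haarX :: (real^('k+'j)^('k+'j)) set measure"
  interpret M: prob_space ?M by (rule prob_space_haarX)
  define I where "I = u ` Xspace"
  have finI: "finite I" using simple_functionD(1)[OF u(1)] by (simp add: I_def)
  define E where "E y = u -` {y} \<inter> Xspace" for y
  have E: "E y \<in> sets Xmeas" for y using simple_functionD(2)[OF u(1), of "{y}"] by (simp add: E_def)
  have decomp: "u x = (\<Sum>y\<in>I. y * indicator (E y) x)" if "x \<in> Xspace" for x
  proof -
    have "(\<Sum>y\<in>I. y * indicator (E y) x) = (\<Sum>y\<in>I. if y = u x then y else 0)"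
      using that by (intro sum.cong) (auto simp: E_def indicator_def)
    then show ?thesis using finI that by (simp add: I_def)
  qed
  have int: "(\<integral>\<^sup>+x. u x * indicator Z x \<partial>?M) = (\<Sum>y\<in>I. y * ennreal (measure ?M (E y \<inter> Z)))"
    if Z: "Z \<in> sets Xmeas" for Z
  proof -
    have "(\<integral>\<^sup>+x. u x * indicator Z x \<partial>?M) = (\<integral>\<^sup>+x. (\<Sum>y\<in>I. y * indicator (E y \<inter> Z) x) \<partial>?M)"
      by (intro nn_integral_cong) (simp add: decomp sum_distrib_right indicator_inter_arith mult.assoc)
    also have "\<dots> = (\<Sum>y\<in>I. \<integral>\<^sup>+x. y * indicator (E y \<inter> Z) x \<partial>?M)"
      using E Z by (intro nn_integral_sum) auto
    also have "\<dots> = (\<Sum>y\<in>I. y * emeasure ?M (E y \<inter> Z))"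
      using E Z by (intro sum.cong refl nn_integral_cmult_indicator) auto
    finally show ?thesis by (simp add: M.emeasure_eq_measure)
  qed
  have Xs: "Xspace \<in> sets (Xmeas :: (real^('k+'j)^('k+'j)) set measure)" using sets.top[of Xmeas] by simp
  have "((\<lambda>L. \<Sum>y\<in>I. y * ennreal (measure ?M (E y \<inter> xpre (flow L) S))) \<longlongrightarrow>
      (\<Sum>y\<in>I. y * ennreal (measure ?M (E y) * measure ?M S))) at_top"
  proof (rule tendsto_sum)
    fix y assume "y \<in> I"
    then have "y < top" using u(2) by (auto simp: I_def)
    then show "((\<lambda>L. y * ennreal (measure ?M (E y \<inter> xpre (flow L) S))) \<longlongrightarrow> y * ennreal (measure ?M (E y) * measure ?M S)) at_top"
      by (intro ennreal_tendsto_cmult tendsto_ennrealI mixing_sets E S)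
  qed
  moreover have "(\<Sum>y\<in>I. y * ennreal (measure ?M (E y) * measure ?M S)) = (\<integral>\<^sup>+x. u x \<partial>?M) * emeasure ?M S"
  proof -
    have "(\<integral>\<^sup>+x. u x \<partial>?M) = (\<integral>\<^sup>+x. u x * indicator Xspace x \<partial>?M)"
      by (intro nn_integral_cong) simp
    also have "\<dots> = (\<Sum>y\<in>I. y * ennreal (measure ?M (E y)))"
      unfolding int[OF Xs] by (intro sum.cong) (auto simp: E_def Int_absorb2)
    finally show ?thesis
      by (simp add: sum_distrib_right M.emeasure_eq_measure ennreal_mult mult.assoc)
  qed
  moreover have "eventually (\<lambda>L. (\<Sum>y\<in>I. y * ennreal (measure ?M (E y \<inter> xpre (flow L) S))) =
      (\<integral>\<^sup>+x. u x * indicator (xpre (flow L) S) x \<partial>?M)) at_top"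
    by (rule eventually_mono[OF eventually_gt_at_top[of 0]]) (simp add: int xpre_sets flow_SLn S)
  ultimately show ?thesis using Lim_transform_eventually by force
qed

text \<open>A simple function below the density carries nearly all of its mass and already exceeds
  \<open>c\<close>. Approximation from below gives only this half; applied to the complement of
  \<open>S\<close>, it gives the upper bound.\<close>

lemma mixing_liminf:
  fixes lam :: "(real^('k::finite+'j::finite)^('k+'j)) set measure"
  assumes sets_l: "sets lam = sets Xmeas" and prob: "prob_space lam"
    and ac: "absolutely_continuous haarX lam" and S: "S \<in> sets Xmeas" and c: "c < measure haarX S"
  shows "eventually (\<lambda>L. c < measure lam (xpre (flow L) S)) at_top"
proof -
  let ?M = "haarX :: (real^('k+'j)^('k+'j)) set measure"
  interpret M: prob_space ?M by (rule prob_space_haarX)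
  interpret l: prob_space lam by (rule prob)
  have sp: "space lam = Xspace" using sets_eq_imp_space_eq[OF sets_l] by simp
  show ?thesis
  proof (cases "c < 0")
    case True
    then show ?thesis by (auto intro!: always_eventually elim: less_le_trans)
  next
    case False
    obtain f where f [measurable]: "f \<in> borel_measurable ?M" and lam: "density ?M f = lam"
      using M.Radon_Nikodym[OF ac] sets_l by auto
    have int1: "(\<integral>\<^sup>+x. f x \<partial>?M) = 1"
    proof -
      have "(\<integral>\<^sup>+x. f x \<partial>?M) = (\<integral>\<^sup>+x. f x * indicator (space ?M) x \<partial>?M)" by (intro nn_integral_cong) simp
      also have "\<dots> = emeasure lam (space ?M)" unfolding lam[symmetric] by (rule emeasure_density[symmetric, OF f sets.top])
      finally show ?thesis using l.emeasure_space_1 sp by simp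
    qed
    obtain g where g: "\<And>i :: nat. simple_function ?M (g i)" "incseq g" "\<And>i x. g i x < top"
      "\<And>x. (SUP i. g i x) = f x"
      by (rule borel_measurable_implies_simple_function_sequence'[OF f]) blast
    have "(SUP i. \<integral>\<^sup>+x. g i x \<partial>?M) = (\<integral>\<^sup>+x. (SUP i. g i x) \<partial>?M)"
      by (rule nn_integral_monotone_convergence_SUP[symmetric])
        (use g in \<open>auto intro: borel_measurable_simple_function\<close>)
    then have sup: "(SUP i. (\<integral>\<^sup>+x. g i x \<partial>?M)) * emeasure ?M S = ennreal (measure ?M S)"
      by (simp add: g(4) int1 M.emeasure_eq_measure)
    have "ennreal c < (SUP i. (\<integral>\<^sup>+x. g i x \<partial>?M) * emeasure ?M S)"
      using c False by (simp add: sup ennreal_less_iff flip: SUP_mult_right_ennreal)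
    then obtain i where i: "ennreal c < (\<integral>\<^sup>+x. g i x \<partial>?M) * emeasure ?M S" by (auto simp: less_SUP_iff)
    have "((\<lambda>L. \<integral>\<^sup>+x. g i x * indicator (xpre (flow L) S) x \<partial>?M) \<longlongrightarrow> (\<integral>\<^sup>+x. g i x \<partial>?M) * emeasure ?M S) at_top"
      by (rule mixing_simple_function[OF S g(1) g(3)])
    then have "eventually (\<lambda>L. ennreal c < (\<integral>\<^sup>+x. g i x * indicator (xpre (flow L) S) x \<partial>?M)) at_top"
      using i by (rule order_tendstoD(1))
    then show ?thesis using eventually_gt_at_top[of 0]
    proof eventually_elim
      case (elim L)
      have Z: "xpre (flow L) S \<in> sets Xmeas" using elim S by (simp add: xpre_sets flow_SLn)
      have "g i x \<le> f x" for x using g(4)[of x] by (metis SUP_upper UNIV_I)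
      then have "(\<integral>\<^sup>+x. g i x * indicator (xpre (flow L) S) x \<partial>?M) \<le> (\<integral>\<^sup>+x. f x * indicator (xpre (flow L) S) x \<partial>?M)"
        by (intro nn_integral_mono mult_right_mono) auto
      also have "\<dots> = emeasure lam (xpre (flow L) S)"
        unfolding lam[symmetric] using Z by (intro emeasure_density[symmetric]) auto
      finally have "ennreal c < ennreal (measure lam (xpre (flow L) S))"
        using elim by (simp add: l.emeasure_eq_measure)
      then show ?case using False by (simp add: ennreal_less_iff)
    qed
  qed
qed

lemma mixing_abs_continuous:
  fixes lam :: "(real^('k::finite+'j::finite)^('k+'j)) set measure"
  assumes sets_l: "sets lam = sets Xmeas" and prob: "prob_space lam"
    and ac: "absolutely_continuous haarX lam" and S: "S \<in> sets Xmeas"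
  shows "((\<lambda>L. measure lam (xpre (flow L) S)) \<longlongrightarrow> measure haarX S) at_top"
proof (rule order_tendstoI)
  interpret M: prob_space "haarX :: (real^('k+'j)^('k+'j)) set measure" by (rule prob_space_haarX)
  interpret l: prob_space lam by (rule prob)
  have sp: "space lam = Xspace" using sets_eq_imp_space_eq[OF sets_l] by simp
  show "eventually (\<lambda>L. c < measure lam (xpre (flow L) S)) at_top" if "c < measure haarX S" for c
    by (rule mixing_liminf[OF sets_l prob ac S that])
  fix c assume c: "measure haarX S < c"
  have C: "Xspace - S \<in> sets Xmeas" using sets.compl_sets[OF S] by simp
  have "1 - c < measure haarX (Xspace - S)" using c M.prob_compl[of S] S by simp
  then have "eventually (\<lambda>L. 1 - c < measure lam (xpre (flow L) (Xspace - S))) at_top"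
    by (rule mixing_liminf[OF sets_l prob ac C])
  then show "eventually (\<lambda>L. measure lam (xpre (flow L) S) < c) at_top"
    using eventually_gt_at_top[of 0]
  proof eventually_elim
    case (elim L)
    then have Z: "xpre (flow L) S \<in> sets lam" using S sets_l by (simp add: xpre_sets flow_SLn)
    have "measure lam (xpre (flow L) (Xspace - S)) = 1 - measure lam (xpre (flow L) S)"
      using elim l.prob_compl[OF Z] by (simp add: xpre_Diff xpre_Xspace flow_SLn sp)
    then show ?case using elim by simp
  qed
qed

section \<open>Identification of the invariant measure\<close>

text \<open>\<open>M\<close> is absolutely continuous, so its values on flow preimages of
  \<open>S\<close> tend to the \<open>haarX\<close> measure of \<open>S\<close>; by invariance these
  values are constant.\<close>

lemma invariant_prob_unique:
  fixes M :: "(real^('k::finite+'j::finite)^('k+'j)) set measure"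
  assumes M: "invariant_prob M"
  shows "M = haarX"
proof (rule measure_eqI)
  have sets_M: "sets M = sets Xmeas" using M by (simp add: invariant_prob_def)
  then show "sets M = sets haarX" by simp
  have pM: "prob_space M" using M by (simp add: invariant_prob_def)
  interpret M: prob_space M by (rule pM)
  interpret H: prob_space "haarX :: (real^('k+'j)^('k+'j)) set measure" by (rule prob_space_haarX)
  have ac: "absolutely_continuous haarX M"
    unfolding absolutely_continuous_def using invariant_abs_continuous[OF M] sets_M
    by (auto simp: null_sets_def)
  fix S assume "S \<in> sets M"
  then have S: "S \<in> sets Xmeas" using sets_M by simp
  have "((\<lambda>L. measure M (xpre (flow L) S)) \<longlongrightarrow> measure haarX S) at_top"
    by (rule mixing_abs_continuous[OF sets_M pM ac S])
  moreover have "((\<lambda>L. measure M (xpre (flow L) S)) \<longlongrightarrow> measure M S) at_top"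
  proof (rule tendsto_eventually, rule eventually_mono[OF eventually_gt_at_top[of 0]])
    fix L :: real assume "L > 0"
    then show "measure M (xpre (flow L) S) = measure M S"
      using invariant_probD[OF M flow_SLn S] by (simp add: measure_def)
  qed
  ultimately have "measure M S = measure haarX S"
    using tendsto_unique[OF trivial_limit_at_top_linorder] by blast
  then show "emeasure M S = emeasure haarX S" by (simp add: M.emeasure_eq_measure H.emeasure_eq_measure)
qed

lemma muX_eq_haarX: "(muX :: (real^('k::finite+'j::finite)^('k+'j)) set measure) = haarX"
  unfolding muX_def
proof (rule the_equality, unfold invariant_prob_iff[symmetric])
  show "invariant_prob (haarX :: (real^('k+'j)^('k+'j)) set measure)" by (rule haarX_invariant)
  show "M = haarX" if "invariant_prob M" for M :: "(real^('k+'j)^('k+'j)) set measure"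
    using that by (rule invariant_prob_unique)
qed

section \<open>Hitting times\<close>

lemma inj_vector_matrix_mult:
  fixes g :: "real^'n^'n"
  assumes "det g \<noteq> 0"
  shows "inj (\<lambda>v. v v* g)"
proof (rule injI)
  fix v w assume "v v* g = w v* g"
  then have "(v v* g) v* cramer_inv g = (w v* g) v* cramer_inv g" by simp
  then show "v = w" using assms by (simp add: vector_matrix_mul_assoc cramer_inv_right)
qed

text \<open>The gcd of the new coordinates divides all their integral combinations. Since the
  inverse matrix is integral, the old coordinates are among these, and their gcd is 1.\<close>

lemma primitive_mult_SLZ:
  fixes v :: "real^'n"
  assumes v: "primitive v" and \<gamma>: "\<gamma> \<in> SLZ"
  shows "primitive (v v* \<gamma>)"
proof -
  define w where "w = v v* \<gamma>"
  have vi: "v $ i \<in> \<int>" for i using v by (simp add: primitive_def)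
  have nth: "(x v* h) $ j = (\<Sum>i\<in>UNIV. h $ i $ j * x $ i)" for x :: "real^'n" and h :: "real^'n^'n" and j
    by (simp add: vector_matrix_mult_def mult.commute)
  have wi: "w $ j \<in> \<int>" for j
    unfolding w_def nth using vi \<gamma> by (intro Ints_sum Ints_mult) (auto simp: SLZ_def)
  let ?d = "Gcd (range (\<lambda>i. \<lfloor>w $ i\<rfloor>))"
  define k where "k = cramer_inv \<gamma>"
  have k: "k \<in> SLZ" using \<gamma> by (simp add: k_def SLZ_inv)
  have vw: "v = w v* k" using \<gamma> by (simp add: w_def k_def vector_matrix_mul_assoc cramer_inv_right SLZ_det)
  have "?d dvd \<lfloor>v $ j\<rfloor>" for j
  proof -
    have "v $ j = (\<Sum>i\<in>UNIV. k $ i $ j * w $ i)" by (subst vw) (rule nth)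
    also have "\<dots> = of_int (\<Sum>i\<in>UNIV. \<lfloor>k $ i $ j\<rfloor> * \<lfloor>w $ i\<rfloor>)"
      using k wi by (auto simp: SLZ_def intro!: sum.cong)
    finally have "\<lfloor>v $ j\<rfloor> = (\<Sum>i\<in>UNIV. \<lfloor>k $ i $ j\<rfloor> * \<lfloor>w $ i\<rfloor>)" by (metis floor_of_int)
    moreover have "?d dvd \<lfloor>w $ i\<rfloor>" for i by (rule Gcd_dvd) simp
    ultimately show ?thesis by (auto intro!: dvd_sum dvd_mult)
  qed
  then have "?d dvd Gcd (range (\<lambda>i. \<lfloor>v $ i\<rfloor>))" by (intro Gcd_greatest) auto
  then have "is_unit ?d" using v by (simp add: primitive_def)
  then have "?d = 1" by (metis Gcd_int_greater_eq_0 abs_of_nonneg zdvd1_eq)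
  then show ?thesis using wi by (simp add: primitive_def w_def)
qed

text \<open>\<open>SLZ\<close> maps primitive vectors to primitive vectors, so one representative of
  the coset yields them all.\<close>

lemma primvecs_coset: "primvecs (coset g) = (\<lambda>v. v v* g) ` {v. primitive v}"
proof (intro equalityI subsetI)
  fix y assume "y \<in> primvecs (coset g)"
  then obtain \<gamma> v where "\<gamma> \<in> SLZ" "primitive v" "y = v v* (\<gamma> ** g)"
    by (auto simp: primvecs_def coset_def)
  then show "y \<in> (\<lambda>v. v v* g) ` {v. primitive v}"
    using primitive_mult_SLZ[of v \<gamma>] by (auto simp: vector_matrix_mul_assoc[symmetric])
qed (use coset_self in \<open>auto simp: primvecs_def\<close>)

lemma countable_primitive: "countable {v :: real^'n. primitive v}"
proof (rule countable_subset)
  show "{v :: real^'n. primitive v} \<subseteq> range (\<lambda>f. \<chi> i. real_of_int (f i))"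
  proof
    fix v :: "real^'n" assume "v \<in> {v. primitive v}"
    then have "v = (\<chi> i. real_of_int \<lfloor>v $ i\<rfloor>)" by (auto simp: vec_eq_iff primitive_def)
    then show "v \<in> range (\<lambda>f. \<chi> i. real_of_int (f i))"
      by (auto intro!: image_eqI[where x = "\<lambda>i. \<lfloor>v $ i\<rfloor>"])
  qed
qed simp

lemma borel_measurable_vector_matrix_mult [measurable]:
  fixes f :: "'a \<Rightarrow> real^'n^'n"
  assumes [measurable]: "f \<in> borel_measurable M"
  shows "(\<lambda>x. v v* f x) \<in> borel_measurable M"
  unfolding vector_matrix_mult_def by measurable

text \<open>The count is the integral of an indicator against counting measure on a countable set,
  hence Borel in \<open>g\<close>. An infinite count appears as \<open>top\<close>, which differs
  from every \<open>of_nat N\<close>.\<close>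

lemma primitive_count_borel:
  fixes C :: "(real^'n) set"
  assumes [measurable]: "C \<in> sets borel"
  shows "{g :: real^'n^'n. finite {v. primitive v \<and> v v* g \<in> C} \<and> card {v. primitive v \<and> v v* g \<in> C} = N} \<in> sets borel"
proof -
  let ?P = "{v :: real^'n. primitive v}"
  interpret sigma_finite_measure "count_space ?P"
    by (rule sigma_finite_measure_count_space_countable[OF countable_primitive])
  define m where "m g = (\<integral>\<^sup>+v. indicator C (v v* g) \<partial>count_space ?P)" for g :: "real^'n^'n"
  have "(\<lambda>(v, g :: real^'n^'n). indicator C (v v* g) :: ennreal) \<in> borel_measurable (count_space ?P \<Otimes>\<^sub>M borel)"
    by (rule measurable_pair_measure_countable1[OF countable_primitive]) simp
  from measurable_pair_swap[OF this]
  have "(\<lambda>(g :: real^'n^'n, v). indicator C (v v* g) :: ennreal) \<in> borel_measurable (borel \<Otimes>\<^sub>M count_space ?P)"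
    by simp
  then have [measurable]: "m \<in> borel_measurable borel"
    unfolding m_def by (rule borel_measurable_nn_integral)
  have "m g = (if finite {v. primitive v \<and> v v* g \<in> C}
      then of_nat (card {v. primitive v \<and> v v* g \<in> C}) else top)" for g
  proof -
    have "m g = (\<integral>\<^sup>+v. indicator {v. primitive v \<and> v v* g \<in> C} v \<partial>count_space ?P)"
      unfolding m_def by (intro nn_integral_cong) (auto simp: indicator_def)
    also have "\<dots> = emeasure (count_space ?P) {v. primitive v \<and> v v* g \<in> C}"
      by (rule nn_integral_indicator) auto
    also have "\<dots> = (if finite {v. primitive v \<and> v v* g \<in> C}
        then of_nat (card {v. primitive v \<and> v v* g \<in> C}) else top)"
      by (subst emeasure_count_space) auto
    finally show ?thesis .
  qed
  then have "{g. finite {v. primitive v \<and> v v* g \<in> C} \<and> card {v. primitive v \<and> v v* g \<in> C} = N} =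
      {g. m g = of_nat N}"
    by (auto split: if_splits)
  then show ?thesis by simp
qed

section \<open>Hitting events and the flow\<close>

text \<open>The condition of \<open>hits\<close> at level 1. The quotient y' / y_n, in place of the
  image of \<open>A\<close> in \<open>coneC\<close>, makes it a Borel preimage; the two agree where
  y_n > 0.\<close>

definition hit_region :: "'j::finite \<Rightarrow> (real^'k::finite) set \<Rightarrow> (real^'j) set \<Rightarrow> (real^('k+'j)) set" where
  "hit_region j0 A W = {y. ypart2 y \<in> W \<and> (1 / y $ Inr j0) *\<^sub>R ypart1 y \<in> A}"

lemma hit_region_borel:
  fixes W :: "(real^'j::finite) set" and A :: "(real^'k::finite) set"
  assumes [measurable]: "W \<in> sets borel" "A \<in> sets borel"
  shows "hit_region j0 A W \<in> sets borel"
proof -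
  have [measurable]: "(ypart1 :: real^('k+'j) \<Rightarrow> _) \<in> borel_measurable borel"
    "(ypart2 :: real^('k+'j) \<Rightarrow> _) \<in> borel_measurable borel"
    unfolding ypart1_def[abs_def] ypart2_def[abs_def] by measurable
  show ?thesis unfolding hit_region_def by measurable
qed

lemma hits_one: "hits j0 W x 1 A = primvecs x \<inter> hit_region j0 A W"
  by (auto simp: hits_def hit_region_def)

lemma coneC_eq_hit_region:
  assumes "\<forall>w\<in>W. w $ j0 > 0"
  shows "coneC j0 A W = hit_region j0 A W"
proof -
  have "ypart1 y \<in> (\<lambda>a. (y $ Inr j0) *\<^sub>R a) ` A \<longleftrightarrow> (1 / y $ Inr j0) *\<^sub>R ypart1 y \<in> A"
    if "ypart2 y \<in> W" for y
  proof -
    have "y $ Inr j0 > 0" using assms that by (auto simp: ypart2_def)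
    then show ?thesis by (auto intro!: image_eqI[where x="(1 / y $ Inr j0) *\<^sub>R ypart1 y"])
  qed
  then show ?thesis by (auto simp: coneC_def hit_region_def)
qed

lemma vector_flow_nth:
  "(v v* (flow L :: real^('k::finite+'j::finite)^('k+'j))) $ Inl i = L powr (- (real CARD('j) / real CARD('k))) * v $ Inl i"
  "(v v* (flow L :: real^('k::finite+'j::finite)^('k+'j))) $ Inr j = L * v $ Inr j"
  by (simp_all add: vector_matrix_mult_def flow_def if_distrib[of "\<lambda>x. _ * x"] cong: if_cong)

text \<open>The flow multiplies (y'', y_n) by L, which undoes the factor 1/L on \<open>W\<close>,
  and y' / y_n by L^(-(m+1)/k) / L = L^(-n/k), the rescaling of the hitting times, as n = k + m +
  1.\<close>

lemma hits_flow:
  fixes x :: "(real^('k::finite+'j::finite)^('k+'j)) set"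
  assumes x: "x \<in> Xspace" and L: "L > 0"
  shows "hits j0 W (xact x (flow L)) 1 A = (\<lambda>v. v v* flow L) ` hits j0 W x L A"
proof -
  obtain g where g: "x = coset g" using x by (auto simp: Xspace_def)
  let ?f = "\<lambda>v :: real^('k+'j). v v* (flow L :: real^('k+'j)^('k+'j))"
  let ?a = "- (real CARD('j) / real CARD('k))"
  have pv: "primvecs (xact x (flow L)) = ?f ` primvecs x"
    by (simp add: g xact_coset primvecs_coset image_image vector_matrix_mul_assoc)
  have p2: "ypart2 (?f v) = L *\<^sub>R ypart2 v" for v
    by (simp add: ypart2_def vec_eq_iff vector_flow_nth)
  have p1: "ypart1 (?f v) = (L powr ?a) *\<^sub>R ypart1 v" for v
    by (simp add: ypart1_def vec_eq_iff vector_flow_nth)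
  have W: "L *\<^sub>R w \<in> W \<longleftrightarrow> w \<in> (\<lambda>w. (1 / L) *\<^sub>R w) ` W" for w
    using L by (auto intro!: image_eqI[where x="L *\<^sub>R w"])
  have pw: "L powr ?a / L = L powr (- (real CARD('k + 'j) / real CARD('k)))"
  proof -
    have "L powr ?a / L = L powr (?a - 1)" using L by (simp add: powr_diff)
    also have "?a - 1 = - (real CARD('k + 'j) / real CARD('k))" by (simp add: card_sum field_simps)
    finally show ?thesis .
  qed
  have "?f v \<in> hit_region j0 A W \<longleftrightarrow> ypart2 v \<in> (\<lambda>w. (1 / L) *\<^sub>R w) ` W \<and>
      (L powr (- (real CARD('k + 'j) / real CARD('k)))) *\<^sub>R ((1 / v $ Inr j0) *\<^sub>R ypart1 v) \<in> A" for v
  proof -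
    have "(1 / (L * v $ Inr j0)) * L powr ?a = (L powr ?a / L) * (1 / v $ Inr j0)" by simp
    then show ?thesis
      unfolding hit_region_def mem_Collect_eq p1 p2 W vector_flow_nth scaleR_scaleR pw by simp
  qed
  then show ?thesis
    unfolding hits_one pv by (auto simp: hits_def)
qed

theorem theorem2:
  fixes j0 :: "'j::finite" and W :: "(real^'j) set"
    and lam :: "(real^('k::finite+'j)^('k+'j)) set measure"
    and r :: nat and A :: "nat \<Rightarrow> (real^'k) set" and N :: "nat \<Rightarrow> nat"
  assumes W_borel: "W \<in> sets borel" and W_bdd: "bounded W"
    and W_int: "interior W \<noteq> {}" and W_pos: "\<forall>w\<in>W. w $ j0 > 0"
    and W_bdry: "frontier W \<in> null_sets lborel"
    and lam_sets: "sets lam = sets Xmeas" and lam_prob: "prob_space lam"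
    and lam_ac: "absolutely_continuous muX lam"
    and A_borel: "\<forall>i<r. A i \<in> sets borel"
  shows "(((\<lambda>L. measure lam {x \<in> Xspace. \<forall>i<r. finite (hits j0 W x L (A i))
              \<and> card (hits j0 W x L (A i)) = N i})
           \<longlongrightarrow> measure muX {x \<in> Xspace. \<forall>i<r. finite (hits j0 W x 1 (A i))
              \<and> card (hits j0 W x 1 (A i)) = N i}) at_top)
     \<and> measure muX {x \<in> Xspace. \<forall>i<r. finite (hits j0 W x 1 (A i))
              \<and> card (hits j0 W x 1 (A i)) = N i}
       = measure muX {coset g | g. g \<in> SLn \<and> (\<forall>i<r. finite (primvecs (coset g) \<inter> coneC j0 (A i) W)
              \<and> card (primvecs (coset g) \<inter> coneC j0 (A i) W) = N i)}"
proof -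
  let ?E = "\<lambda>L. {x \<in> Xspace. \<forall>i<r. finite (hits j0 W x L (A i)) \<and> card (hits j0 W x L (A i)) = N i}"
  have E: "?E 1 \<in> sets Xmeas"
  proof -
    let ?C = "\<lambda>i. hit_region j0 (A i) W"
    let ?G = "\<lambda>i. {g :: real^('k+'j)^('k+'j). finite {v. primitive v \<and> v v* g \<in> ?C i} \<and>
      card {v. primitive v \<and> v v* g \<in> ?C i} = N i}"
    have "finite (hits j0 W (coset g) 1 (A i)) \<and> card (hits j0 W (coset g) 1 (A i)) = N i \<longleftrightarrow> g \<in> ?G i"
      if "g \<in> SLn" for g :: "real^('k+'j)^('k+'j)" and i
    proof -
      have inj: "inj_on (\<lambda>v. v v* g) B" for B
        using inj_vector_matrix_mult[OF SLn_det_nz[OF that]] by (rule inj_on_subset) simp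
      \<comment> \<open>Injectivity of v \<mapsto> v g turns the count into one over integer
        vectors, a countable set that does not depend on \<open>g\<close>.\<close>
      have "hits j0 W (coset g) 1 (A i) = (\<lambda>v. v v* g) ` {v. primitive v \<and> v v* g \<in> ?C i}"
        by (auto simp: hits_one primvecs_coset)
      then show ?thesis by (simp add: finite_image_iff[OF inj] card_image[OF inj])
    qed
    then have "{g \<in> SLn. coset g \<in> ?E 1} = SLn \<inter> (\<Inter>i\<in>{..<r}. ?G i)"
      by (auto simp: coset_in_Xspace)
    also have "\<dots> \<in> sets borel"
    \<comment> \<open>For r = 0 the intersection is over an empty family, which
      \<open>sets.finite_INT\<close> excludes.\<close>
    proof (cases "r = 0")
      case False
      then have "(\<Inter>i\<in>{..<r}. ?G i) \<in> sets borel"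
        using A_borel W_borel
        by (intro sets.finite_INT primitive_count_borel hit_region_borel) auto
      then show ?thesis by (intro sets.Int SLn_borel)
    qed simp
    finally show ?thesis by (simp add: sets_Xmeas)
  qed
  \<comment> \<open>The flow maps the hits at level \<open>L\<close> bijectively to those at level
    1, so the whole dependence on \<open>L\<close> is in the translation.\<close>
  have pre: "?E L = xpre (flow L) (?E 1)" if L: "L > 0" for L
  proof -
    have f: "(flow L :: real^('k+'j)^('k+'j)) \<in> SLn" by (rule flow_SLn[OF L])
    have "inj_on (\<lambda>v. v v* (flow L :: real^('k+'j)^('k+'j))) B" for B
      using inj_vector_matrix_mult[OF SLn_det_nz[OF f]] by (rule inj_on_subset) simp
    then show ?thesis
      using f by (auto simp: xpre_def xact_Xspace hits_flow[OF _ L] finite_image_iff card_image)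
  qed
  have "((\<lambda>L. measure lam (xpre (flow L) (?E 1))) \<longlongrightarrow> measure muX (?E 1)) at_top"
    using mixing_abs_continuous[OF lam_sets lam_prob lam_ac[unfolded muX_eq_haarX] E]
    by (simp add: muX_eq_haarX)
  then have lim: "((\<lambda>L. measure lam (?E L)) \<longlongrightarrow> measure muX (?E 1)) at_top"
    by (rule Lim_transform_eventually)
      (rule eventually_mono[OF eventually_gt_at_top[of 0]], rule arg_cong[OF pre[symmetric]])
  have eq: "?E 1 = {coset g | g. g \<in> SLn \<and> (\<forall>i<r. finite (primvecs (coset g) \<inter> coneC j0 (A i) W)
              \<and> card (primvecs (coset g) \<inter> coneC j0 (A i) W) = N i)}"
    unfolding hits_one coneC_eq_hit_region[OF W_pos] Xspace_def by (auto simp del: finite_Int)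
  show ?thesis
    by (rule conjI[OF lim arg_cong[OF eq]])
qed

end
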